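(* Let $\Omega\subset\mathbb R^N$ be a bounded Lipschitz domain, $s\in(0,1)$, $A_s=I+(-\Delta)^s$, $t>0$, and $K=e^{-tA_s}:H_0^s(\Omega)\to L^2(\Omega)$. Let $u^\dagger\in H_0^s(\Omega)$, $\delta>0$, and $y^\delta=e^{-tA_s}u^\dagger+\eta^\delta$, where the random noise $\eta^\delta$ (with values in $L^2(\Omega)$) satisfies $\mathbb E\|\eta^\delta\|_{L^2(\Omega)}^2\le\delta^2$. Then for every $\alpha>0$ the estimator $$u_\alpha^\delta=\operatorname*{arg\,min}_{u\in H_0^s(\Omega)}\left\{\frac12\|e^{-tA_s}u-y^\delta\|_{L^2(\Omega)}^2+\frac{\alpha}{2}\|u\|_{H_0^s(\Omega)}^2\right\}$$ is well-defined and unique. Moreover, if $$A_s^{1/2}u^\dagger=(B^*B)^\beta w,\qquad B=e^{-tA_s}A_s^{-1/2},$$ with $w\in L^2(\Omega)$ and $0<\beta\le1$, then $$\mathbb E\|u_\alpha^\delta-u^\dagger\|_{H_0^s(\Omega)}^2\le C_1\alpha^{2\beta}+C_2\frac{\delta^2}{\alpha},$$ where $C_1=2c_\beta^2\|w\|_{L^2(\Omega)}^2$, $C_2=\frac12$, with $c_\beta=\beta^\beta(1-\beta)^{1-\beta}$ for $0<\beta<1$ and $c_1=1$.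
   Context: All spaces are real. $H_0^s(\Omega)$ is the space of functions $u\in H^s(\mathbb R^N)$ with $u=0$ a.e. in $\mathbb R^N\setminus\Omega$ (also regarded as functions on $\Omega$). On it consider the closed, symmetric, coercive bilinear form $$a_s(u,v)=\int_\Omega uv\,dx+\frac{C_{N,s}}{2}\iint_{\mathbb R^{2N}}\frac{(u(x)-u(y))(v(x)-v(y))}{|x-y|^{N+2s}}\,dx\,dy,$$ where $C_{N,s}>0$ is the standard normalization constant of the integral fractional Laplacian, $C_{N,s}=\frac{4^s s\,\Gamma(N/2+s)}{\pi^{N/2}\Gamma(1-s)}$. $H_0^s(\Omega)$ is a Hilbert space with norm $\|u\|_{H_0^s(\Omega)}^2=a_s(u,u)$. $A_s=I+(-\Delta)^s$ is the unique positive self-adjoint operator on $L^2(\Omega)$ associated with $a_s$; powers and the semigroup $e^{-tA_s}$ are defined by the spectral theorem. $A_s^{1/2}$ is an isometric isomorphism of $D(A_s^{1/2})=H_0^s(\Omega)$ onto $L^2(\Omega)$ with inverse $A_s^{-1/2}:L^2(\Omega)\to H_0^s(\Omega)$. *)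

theory Defs
  imports "HOL-Probability.Probability"
begin

section \<open>The Hilbert space of square-integrable functions modulo a.e. equality\<close>

definition L2_rel :: "('a::euclidean_space \<Rightarrow> real) \<Rightarrow> ('a \<Rightarrow> real) \<Rightarrow> bool" where
  "L2_rel f g \<longleftrightarrow>
     f \<in> borel_measurable lborel \<and> integrable lborel (\<lambda>x. (f x)\<^sup>2) \<and>
     g \<in> borel_measurable lborel \<and> integrable lborel (\<lambda>x. (g x)\<^sup>2) \<and>
     (AE x in lborel. f x = g x)"

lemma part_equivp_L2_rel: "part_equivp L2_rel"
proof (rule part_equivpI)
  show "\<exists>f. L2_rel f f"
    by (rule exI[of _ "\<lambda>_. 0"]) (simp add: L2_rel_def)
  show "symp L2_rel"
    by (rule sympI) (auto simp: L2_rel_def)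
  show "transp L2_rel"
    by (rule transpI) (auto simp: L2_rel_def)
qed

quotient_type (overloaded) 'a L2fun = "'a::euclidean_space \<Rightarrow> real" / partial: "L2_rel"
  by (rule part_equivp_L2_rel)

lemma integrable_square_add:
  fixes f g :: "'a \<Rightarrow> real"
  assumes "f \<in> borel_measurable M" "g \<in> borel_measurable M"
    and "integrable M (\<lambda>x. (f x)\<^sup>2)" "integrable M (\<lambda>x. (g x)\<^sup>2)"
  shows "integrable M (\<lambda>x. (f x + g x)\<^sup>2)"
proof (rule Bochner_Integration.integrable_bound)
  show "integrable M (\<lambda>x. 2 * (f x)\<^sup>2 + 2 * (g x)\<^sup>2)"
    using assms by auto
  have "(f x + g x)\<^sup>2 \<le> 2 * (f x)\<^sup>2 + 2 * (g x)\<^sup>2" for x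
    using zero_le_power2[of "f x - g x"] by (simp add: power2_eq_square algebra_simps)
  then show "AE x in M. norm ((f x + g x)\<^sup>2) \<le> norm (2 * (f x)\<^sup>2 + 2 * (g x)\<^sup>2)"
    by simp
qed (use assms in measurable)

lemma integrable_square_mult:
  fixes f g :: "'a \<Rightarrow> real"
  assumes "f \<in> borel_measurable M" "g \<in> borel_measurable M"
    and "integrable M (\<lambda>x. (f x)\<^sup>2)" "integrable M (\<lambda>x. (g x)\<^sup>2)"
  shows "integrable M (\<lambda>x. f x * g x)"
proof (rule Bochner_Integration.integrable_bound)
  show "integrable M (\<lambda>x. (f x)\<^sup>2 + (g x)\<^sup>2)"
    using assms by auto
  have "\<bar>f x * g x\<bar> \<le> (f x)\<^sup>2 + (g x)\<^sup>2" for x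
  proof -
    have "2 * \<bar>f x\<bar> * \<bar>g x\<bar> \<le> \<bar>f x\<bar>\<^sup>2 + \<bar>g x\<bar>\<^sup>2"
      by (rule sum_squares_bound)
    moreover have "0 \<le> \<bar>f x\<bar> * \<bar>g x\<bar>" by simp
    ultimately show ?thesis unfolding abs_mult power2_abs by linarith
  qed
  then show "AE x in M. norm (f x * g x) \<le> norm ((f x)\<^sup>2 + (g x)\<^sup>2)"
    by simp
qed (use assms in measurable)

instantiation L2fun :: (euclidean_space) real_inner
begin

lift_definition zero_L2fun :: "'a L2fun" is "\<lambda>_. 0"
  by (simp add: L2_rel_def)

lift_definition plus_L2fun :: "'a L2fun \<Rightarrow> 'a L2fun \<Rightarrow> 'a L2fun" is "\<lambda>f g x. f x + g x"
  by (auto simp: L2_rel_def integrable_square_add)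

lift_definition uminus_L2fun :: "'a L2fun \<Rightarrow> 'a L2fun" is "\<lambda>f x. - f x"
  by (auto simp: L2_rel_def)

lift_definition scaleR_L2fun :: "real \<Rightarrow> 'a L2fun \<Rightarrow> 'a L2fun" is "\<lambda>c f x. c * f x"
  by (auto simp: L2_rel_def power_mult_distrib)

lift_definition inner_L2fun :: "'a L2fun \<Rightarrow> 'a L2fun \<Rightarrow> real" is
  "\<lambda>f g. integral\<^sup>L lborel (\<lambda>x. f x * g x)"
  by (auto simp: L2_rel_def intro!: integral_cong_AE)

definition minus_L2fun :: "'a L2fun \<Rightarrow> 'a L2fun \<Rightarrow> 'a L2fun" where
  "minus_L2fun u v = u + (- v)"

definition norm_L2fun :: "'a L2fun \<Rightarrow> real" where
  "norm_L2fun u = sqrt (inner u u)"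

definition sgn_L2fun :: "'a L2fun \<Rightarrow> 'a L2fun" where
  "sgn_L2fun u = inverse (norm u) *\<^sub>R u"

definition dist_L2fun :: "'a L2fun \<Rightarrow> 'a L2fun \<Rightarrow> real" where
  "dist_L2fun u v = norm (u - v)"

definition uniformity_L2fun :: "('a L2fun \<times> 'a L2fun) filter" where
  "uniformity_L2fun = (INF e\<in>{0<..}. principal {(u, v). dist u v < e})"

definition open_L2fun :: "'a L2fun set \<Rightarrow> bool" where
  "open_L2fun U = (\<forall>u\<in>U. eventually (\<lambda>(u', v). u' = u \<longrightarrow> v \<in> U) uniformity)"

instance
proof
  fix u v w :: "'a L2fun" and a b :: real
  show "u + v + w = u + (v + w)"
    by transfer (auto simp: L2_rel_def algebra_simps integrable_square_add)
  show "u + v = v + u"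
    by transfer (auto simp: L2_rel_def algebra_simps integrable_square_add)
  show "0 + u = u"
    by transfer (auto simp: L2_rel_def)
  show "- u + u = 0"
    by transfer (auto simp: L2_rel_def)
  show "u - v = u + - v"
    by (rule minus_L2fun_def)
  show "a *\<^sub>R (u + v) = a *\<^sub>R u + a *\<^sub>R v"
    by transfer (auto simp: L2_rel_def power_mult_distrib distrib_left integrable_square_add)
  show "(a + b) *\<^sub>R u = a *\<^sub>R u + b *\<^sub>R u"
    by transfer (auto simp: L2_rel_def power_mult_distrib distrib_right integrable_square_add)
  show "a *\<^sub>R b *\<^sub>R u = (a * b) *\<^sub>R u"
    by transfer (auto simp: L2_rel_def power_mult_distrib mult.assoc)
  show "1 *\<^sub>R u = u"
    by transfer (auto simp: L2_rel_def)
  show "dist u v = norm (u - v)"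
    by (rule dist_L2fun_def)
  show "sgn u = inverse (norm u) *\<^sub>R u"
    by (rule sgn_L2fun_def)
  show "(uniformity :: ('a L2fun \<times> 'a L2fun) filter) =
      (INF e\<in>{0<..}. principal {(u, v). dist u v < e})"
    by (rule uniformity_L2fun_def)
  show "open U \<longleftrightarrow> (\<forall>u\<in>U. eventually (\<lambda>(u', v). u' = u \<longrightarrow> v \<in> U) uniformity)"
    for U :: "'a L2fun set"
    by (rule open_L2fun_def)
  show "inner u v = inner v u"
    by transfer (simp add: mult.commute)
  show "inner (u + v) w = inner u w + inner v w"
    by transfer (auto simp: L2_rel_def distrib_right integrable_square_mult)
  show "inner (a *\<^sub>R u) v = a * inner u v"
    by transfer (auto simp: mult.assoc)
  show "0 \<le> inner u u"
    by transfer (auto intro!: Bochner_Integration.integral_nonneg)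
  show "inner u u = 0 \<longleftrightarrow> u = 0"
  proof (transfer, goal_cases)
    case (1 f)
    then have "integrable lborel (\<lambda>x. f x * f x)"
      by (simp add: L2_rel_def power2_eq_square)
    then have "integral\<^sup>L lborel (\<lambda>x. f x * f x) = 0 \<longleftrightarrow> (AE x in lborel. f x * f x = 0)"
      by (intro integral_nonneg_eq_0_iff_AE) auto
    with 1 show ?case by (auto simp: L2_rel_def)
  qed
  show "norm u = sqrt (inner u u)"
    by (rule norm_L2fun_def)
qed

end

text \<open>A representative of the class; every use below is insensitive to null sets.\<close>

abbreviation L2_fun :: "'a::euclidean_space L2fun \<Rightarrow> 'a \<Rightarrow> real" where
  "L2_fun u \<equiv> rep_L2fun u"

text \<open>\<open>L\<^sup>2(\<Omega>)\<close>, identified through extension by zero with a closed subspace of \<open>L\<^sup>2\<close>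
  of the whole space.\<close>

definition L2_on :: "'a::euclidean_space set \<Rightarrow> 'a L2fun set" where
  "L2_on \<Omega> = {u. AE x in lborel. x \<notin> \<Omega> \<longrightarrow> L2_fun u x = 0}"

section \<open>Bounded Lipschitz domains\<close>

text \<open>Near every boundary point, \<open>\<Omega>\<close> is the strict epigraph of a Lipschitz function, where
  \<open>e\<close> is the vertical direction of the rotated coordinate system and the hyperplane orthogonal
  to \<open>e\<close> carries the remaining coordinates.\<close>

definition lipschitz_boundary :: "'a::euclidean_space set \<Rightarrow> bool" where
  "lipschitz_boundary \<Omega> \<longleftrightarrow>
     (\<forall>p\<in>frontier \<Omega>. \<exists>r>0. \<exists>e g L. norm e = 1 \<and> L-lipschitz_on {x. x \<bullet> e = 0} g \<and>
        \<Omega> \<inter> ball p r = {x \<in> ball p r. g (x - (x \<bullet> e) *\<^sub>R e) < x \<bullet> e})"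

definition bounded_lipschitz_domain :: "'a::euclidean_space set \<Rightarrow> bool" where
  "bounded_lipschitz_domain \<Omega> \<longleftrightarrow>
     open \<Omega> \<and> connected \<Omega> \<and> \<Omega> \<noteq> {} \<and> bounded \<Omega> \<and> lipschitz_boundary \<Omega>"

section \<open>The fractional Sobolev space and the form of the fractional Laplacian\<close>

definition frac_const :: "nat \<Rightarrow> real \<Rightarrow> real" where
  "frac_const N s =
     4 powr s * s * Gamma (real N / 2 + s) / (pi powr (real N / 2) * Gamma (1 - s))"

definition Hs :: "real \<Rightarrow> 'a::euclidean_space L2fun set" where
  "Hs s = {u. integrable (lborel \<Otimes>\<^sub>M lborel)
     (\<lambda>(x, y). (L2_fun u x - L2_fun u y)\<^sup>2 / norm (x - y) powr (real DIM('a) + 2 * s))}"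

definition Hs0 :: "'a::euclidean_space set \<Rightarrow> real \<Rightarrow> 'a L2fun set" where
  "Hs0 \<Omega> s = {u \<in> Hs s. AE x in lborel. x \<notin> \<Omega> \<longrightarrow> L2_fun u x = 0}"

definition frac_form ::
    "'a::euclidean_space set \<Rightarrow> real \<Rightarrow> 'a L2fun \<Rightarrow> 'a L2fun \<Rightarrow> real" where
  "frac_form \<Omega> s u v =
     set_lebesgue_integral lborel \<Omega> (\<lambda>x. L2_fun u x * L2_fun v x) +
     frac_const DIM('a) s / 2 *
       (\<integral>(x, y). (L2_fun u x - L2_fun u y) * (L2_fun v x - L2_fun v y) /
          norm (x - y) powr (real DIM('a) + 2 * s) \<partial>(lborel \<Otimes>\<^sub>M lborel))"

definition Hs0_norm :: "'a::euclidean_space set \<Rightarrow> real \<Rightarrow> 'a L2fun \<Rightarrow> real" where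
  "Hs0_norm \<Omega> s u = sqrt (frac_form \<Omega> s u u)"

section \<open>Operators in a Hilbert space and the Borel functional calculus\<close>

text \<open>Throughout, \<open>H\<close> is a closed subspace of the ambient type, regarded as a Hilbert space of
  its own. An operator is given by a domain \<open>D \<subseteq> H\<close> and a function that matters only on \<open>D\<close>.\<close>

definition form_op_dom ::
    "'h::real_inner set \<Rightarrow> 'h set \<Rightarrow> ('h \<Rightarrow> 'h \<Rightarrow> real) \<Rightarrow> 'h set" where
  "form_op_dom H V a = {u \<in> V. \<exists>f\<in>H. \<forall>v\<in>V. a u v = f \<bullet> v}"

definition form_op ::
    "'h::real_inner set \<Rightarrow> 'h set \<Rightarrow> ('h \<Rightarrow> 'h \<Rightarrow> real) \<Rightarrow> 'h \<Rightarrow> 'h" where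
  "form_op H V a u = (THE f. f \<in> H \<and> (\<forall>v\<in>V. a u v = f \<bullet> v))"

definition adjoint_on :: "'h::real_inner set \<Rightarrow> ('h \<Rightarrow> 'h) \<Rightarrow> 'h \<Rightarrow> 'h" where
  "adjoint_on H T v = (THE w. w \<in> H \<and> (\<forall>u\<in>H. T u \<bullet> v = u \<bullet> w))"

text \<open>Orthogonal projections of \<open>H\<close>; linearity follows from symmetry.\<close>

definition orth_proj_on :: "'h::real_inner set \<Rightarrow> ('h \<Rightarrow> 'h) \<Rightarrow> bool" where
  "orth_proj_on H P \<longleftrightarrow>
     (\<forall>u\<in>H. P u \<in> H \<and> P (P u) = P u) \<and> (\<forall>u\<in>H. \<forall>v\<in>H. P u \<bullet> v = u \<bullet> P v)"

definition projection_valued_measure ::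
    "'h::real_inner set \<Rightarrow> (real set \<Rightarrow> 'h \<Rightarrow> 'h) \<Rightarrow> bool" where
  "projection_valued_measure H E \<longleftrightarrow>
     (\<forall>S\<in>sets borel. orth_proj_on H (E S)) \<and>
     (\<forall>u\<in>H. E UNIV u = u) \<and>
     (\<forall>S\<in>sets borel. \<forall>T\<in>sets borel. \<forall>u\<in>H. E (S \<inter> T) u = E S (E T u)) \<and>
     (\<forall>S. range S \<subseteq> sets borel \<longrightarrow> disjoint_family S \<longrightarrow>
        (\<forall>u\<in>H. (\<lambda>i::nat. E (S i) u) sums E (\<Union>i. S i) u))"

definition spectral_scalar_measure ::
    "(real set \<Rightarrow> 'h::real_inner \<Rightarrow> 'h) \<Rightarrow> 'h \<Rightarrow> real measure" where
  "spectral_scalar_measure E u = measure_of UNIV (sets borel) (\<lambda>S. ennreal (E S u \<bullet> u))"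

definition spectral_integral_dom ::
    "'h::real_inner set \<Rightarrow> (real set \<Rightarrow> 'h \<Rightarrow> 'h) \<Rightarrow> (real \<Rightarrow> real) \<Rightarrow> 'h set" where
  "spectral_integral_dom H E f =
     {u \<in> H. integrable (spectral_scalar_measure E u) (\<lambda>x. (f x)\<^sup>2)}"

text \<open>The operator \<open>\<integral> f dE\<close>, i.e. the \<open>v\<close> with \<open>v \<bullet> z = \<integral> f d(E u \<bullet> z)\<close>. The signed measure
  \<open>S \<mapsto> E S u \<bullet> z\<close> is written by polarization; \<open>z\<close> ranges over the (dense) domain of the
  operator so that both integrals converge.\<close>

definition spectral_integral ::
    "'h::real_inner set \<Rightarrow> (real set \<Rightarrow> 'h \<Rightarrow> 'h) \<Rightarrow> (real \<Rightarrow> real) \<Rightarrow> 'h \<Rightarrow> 'h" where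
  "spectral_integral H E f u =
     (THE v. v \<in> H \<and> (\<forall>z\<in>spectral_integral_dom H E f.
        v \<bullet> z = (integral\<^sup>L (spectral_scalar_measure E (u + z)) f -
                 integral\<^sup>L (spectral_scalar_measure E (u - z)) f) / 4))"

definition is_spectral_measure ::
    "'h::real_inner set \<Rightarrow> 'h set \<Rightarrow> ('h \<Rightarrow> 'h) \<Rightarrow> (real set \<Rightarrow> 'h \<Rightarrow> 'h) \<Rightarrow> bool" where
  "is_spectral_measure H D T E \<longleftrightarrow>
     projection_valued_measure H E \<and>
     D = spectral_integral_dom H E (\<lambda>x. x) \<and>
     (\<forall>u\<in>D. T u = spectral_integral H E (\<lambda>x. x) u)"

text \<open>The spectral measure of a self-adjoint operator, unique on Borel sets and vectors of \<open>H\<close>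
  by the spectral theorem. Its values elsewhere are arbitrary, hence \<open>SOME\<close> instead of \<open>THE\<close>.\<close>

definition spectral_measure ::
    "'h::real_inner set \<Rightarrow> 'h set \<Rightarrow> ('h \<Rightarrow> 'h) \<Rightarrow> real set \<Rightarrow> 'h \<Rightarrow> 'h" where
  "spectral_measure H D T = (SOME E. is_spectral_measure H D T E)"

definition fun_calc ::
    "'h::real_inner set \<Rightarrow> 'h set \<Rightarrow> ('h \<Rightarrow> 'h) \<Rightarrow> (real \<Rightarrow> real) \<Rightarrow> 'h \<Rightarrow> 'h" where
  "fun_calc H D T f = spectral_integral H (spectral_measure H D T) f"

section \<open>The operators of the inverse problem\<close>

text \<open>\<open>A = I + (-\<Delta>)\<^sup>s\<close> on \<open>L\<^sup>2(\<Omega>)\<close>. The identity is part of \<open>frac_form\<close>.\<close>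

definition A_dom :: "'a::euclidean_space set \<Rightarrow> real \<Rightarrow> 'a L2fun set" where
  "A_dom \<Omega> s = form_op_dom (L2_on \<Omega>) (Hs0 \<Omega> s) (frac_form \<Omega> s)"

definition A_op :: "'a::euclidean_space set \<Rightarrow> real \<Rightarrow> 'a L2fun \<Rightarrow> 'a L2fun" where
  "A_op \<Omega> s = form_op (L2_on \<Omega>) (Hs0 \<Omega> s) (frac_form \<Omega> s)"

definition A_power :: "'a::euclidean_space set \<Rightarrow> real \<Rightarrow> real \<Rightarrow> 'a L2fun \<Rightarrow> 'a L2fun" where
  "A_power \<Omega> s r = fun_calc (L2_on \<Omega>) (A_dom \<Omega> s) (A_op \<Omega> s) (\<lambda>x. x powr r)"

definition A_semigroup :: "'a::euclidean_space set \<Rightarrow> real \<Rightarrow> real \<Rightarrow> 'a L2fun \<Rightarrow> 'a L2fun" where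
  "A_semigroup \<Omega> s t = fun_calc (L2_on \<Omega>) (A_dom \<Omega> s) (A_op \<Omega> s) (\<lambda>x. exp (- t * x))"

definition B_op :: "'a::euclidean_space set \<Rightarrow> real \<Rightarrow> real \<Rightarrow> 'a L2fun \<Rightarrow> 'a L2fun" where
  "B_op \<Omega> s t = A_semigroup \<Omega> s t \<circ> A_power \<Omega> s (- 1 / 2)"

definition BB_power ::
    "'a::euclidean_space set \<Rightarrow> real \<Rightarrow> real \<Rightarrow> real \<Rightarrow> 'a L2fun \<Rightarrow> 'a L2fun" where
  "BB_power \<Omega> s t \<beta> =
     fun_calc (L2_on \<Omega>) (L2_on \<Omega>) (adjoint_on (L2_on \<Omega>) (B_op \<Omega> s t) \<circ> B_op \<Omega> s t)
       (\<lambda>x. x powr \<beta>)"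

definition tikhonov ::
    "'a::euclidean_space set \<Rightarrow> real \<Rightarrow> real \<Rightarrow> real \<Rightarrow> 'a L2fun \<Rightarrow> 'a L2fun \<Rightarrow> real" where
  "tikhonov \<Omega> s t \<alpha> y u =
     1 / 2 * (norm (A_semigroup \<Omega> s t u - y))\<^sup>2 + \<alpha> / 2 * (Hs0_norm \<Omega> s u)\<^sup>2"

definition source_const :: "real \<Rightarrow> real" where
  "source_const \<beta> = (if \<beta> = 1 then 1 else \<beta> powr \<beta> * (1 - \<beta>) powr (1 - \<beta>))"

end

(*
On a bounded domain the fractional Sobolev space embeds compactly into L^2, because on a small
cube Q the deviation of u from its mean is controlled by the Gagliardo double integral over
Q x Q. Hence A_s has an orthonormal basis of eigenvectors e with eigenvalues l(e) >= 1, and every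
spectral measure of A_s is concentrated, on e, in the point l(e). In this basis all operators are
multiplications: e^(-tA_s) by k = e^(-tl), B by b = k / sqrt l. The Tikhonov minimizer has the
coefficients k y / (k^2 + alpha l), and the coefficients of A_s^(1/2) (u_alpha - u) are
(- alpha (b^2)^beta w + b eta) / (b^2 + alpha). Young's inequality bounds the first term and
AM-GM the second, uniformly in the eigenvalue, and Parseval sums up the bounds.
*)
theory Submission
  imports Defs
begin

section \<open>Complete bilinear forms and orthonormal bases\<close>

text \<open>All operators are given through \<open>SOME\<close> and \<open>THE\<close>:
  \<open>fun_calc\<close> uses whatever spectral measure \<open>SOME\<close> selects. Nothing can be
  computed before it is known that a spectral measure exists and that every one of them acts in the
  same way on a total set of vectors. A pure point spectrum gives both by elementary means, which is
  why compactness is proved at all. Moreover, the Hilbert spaces are subsets of a type that carries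
  only an inner product. Completeness is therefore a property of a set together with a form, and one
  theory of such pairs serves both L^2(\<Omega>) and the form domain.

  The constants come from one inequality: with no mean-zero property at hand, the mixed term of bias
  and noise is absorbed by (p - q)^2 <= 2 p^2 + 2 q^2. The bias filter is at most c_\<beta>
  \<alpha>^\<beta>, hence C_1; the squared noise filter is at most 1/(4 \<alpha>), hence C_2 = 2/4.
  The expectation also requires a measurable error, which follows from the Lipschitz dependence of
  the minimizer on the data.\<close>

lemma linear_coeff_zero_of_quadratic_nonneg:
  fixes b c :: real
  assumes "\<And>t. 0 \<le> 2 * t * b + t\<^sup>2 * c"
  shows "b = 0"
proof (rule ccontr)
  assume b: "b \<noteq> 0"
  \<comment> \<open>Any positive k > c works: at t = -b/k the linear term -2 b^2/k outweighs the
    quadratic term c b^2/k^2.\<close>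
  define k where "k = \<bar>c\<bar> + 1"
  have k: "k > 0" "c < k" by (auto simp: k_def)
  have "2 * (- b / k) * b + (- b / k)\<^sup>2 * c = (b\<^sup>2 / k\<^sup>2) * (c - 2 * k)"
    using k by (simp add: field_simps power2_eq_square)
  also have "\<dots> < 0"
    using b k by (intro mult_pos_neg) auto
  finally show False using assms[of "- b / k"] by linarith
qed

text \<open>Serves both Cauchy-Schwarz inequalities below, for square-summable families and for
  forms. If A = 0, an affine function of t that stays nonnegative has slope 0; otherwise the vertex
  t = -B/A gives the claim.\<close>

lemma discriminant_le:
  fixes A B D :: real
  assumes "\<And>t. 0 \<le> A * t\<^sup>2 + 2 * B * t + D" and "0 \<le> A"
  shows "B\<^sup>2 \<le> A * D"
proof (cases "A = 0")
  case True
  have "B = 0"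
  proof (rule ccontr)
    assume "B \<noteq> 0"
    then show False using assms(1)[of "- (D + 1) / (2 * B)"] True by simp
  qed
  then show ?thesis using True by simp
next
  case False
  then have A: "A > 0" using assms(2) by simp
  have "0 \<le> A * (A * (- B / A)\<^sup>2 + 2 * B * (- B / A) + D)"
    using assms(1)[of "- B / A"] A by simp
  also have "\<dots> = A * D - B\<^sup>2"
    using A by (simp add: field_simps power2_eq_square)
  finally show ?thesis by simp
qed

lemma summable_on_mult_of_squares:
  fixes f g :: "'i \<Rightarrow> real"
  assumes "(\<lambda>i. (f i)\<^sup>2) summable_on I" "(\<lambda>i. (g i)\<^sup>2) summable_on I"
  shows "(\<lambda>i. f i * g i) summable_on I"
proof -
  have "(\<lambda>i. (f i)\<^sup>2 + (g i)\<^sup>2) summable_on I"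
    using assms by (rule summable_on_add)
  moreover have "\<bar>f i * g i\<bar> \<le> (f i)\<^sup>2 + (g i)\<^sup>2" for i
    using sum_squares_bound[of "\<bar>f i\<bar>" "\<bar>g i\<bar>"] abs_ge_zero[of "f i * g i"]
    unfolding abs_mult power2_abs by linarith
  ultimately have "(\<lambda>i. norm (f i * g i)) summable_on I"
    by (auto intro: summable_on_comparison_test)
  then show ?thesis by (rule abs_summable_summable)
qed

lemma summable_on_square_comparison:
  fixes f g :: "'i \<Rightarrow> real"
  assumes "(\<lambda>i. (f i)\<^sup>2) summable_on I" "\<And>i. i \<in> I \<Longrightarrow> \<bar>g i\<bar> \<le> C * \<bar>f i\<bar>"
  shows "(\<lambda>i. (g i)\<^sup>2) summable_on I"
proof (rule summable_on_comparison_test)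
  show "(\<lambda>i. C\<^sup>2 * (f i)\<^sup>2) summable_on I"
    by (rule summable_on_cmult_right) fact
  show "(g i)\<^sup>2 \<le> C\<^sup>2 * (f i)\<^sup>2" if "i \<in> I" for i
    using power_mono[OF assms(2)[OF that], of 2] by (simp add: power_mult_distrib)
qed auto

lemma infsum_Cauchy_Schwarz:
  fixes f g :: "'i \<Rightarrow> real"
  assumes "(\<lambda>i. (f i)\<^sup>2) summable_on I" "(\<lambda>i. (g i)\<^sup>2) summable_on I"
  shows "(\<Sum>\<^sub>\<infinity>i\<in>I. f i * g i)\<^sup>2 \<le> (\<Sum>\<^sub>\<infinity>i\<in>I. (f i)\<^sup>2) * (\<Sum>\<^sub>\<infinity>i\<in>I. (g i)\<^sup>2)"
proof (rule discriminant_le)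
  fix t :: real
  note fg = summable_on_mult_of_squares[OF assms]
  have s1: "(\<lambda>i. (f i)\<^sup>2 * t\<^sup>2) summable_on I" "(\<lambda>i. f i * g i * (2 * t)) summable_on I"
    using assms fg by (auto intro!: summable_on_cmult_left)
  have "0 \<le> (\<Sum>\<^sub>\<infinity>i\<in>I. (f i * t + g i)\<^sup>2)"
    by (rule infsum_nonneg) auto
  also have "\<dots> = (\<Sum>\<^sub>\<infinity>i\<in>I. ((f i)\<^sup>2 * t\<^sup>2 + f i * g i * (2 * t)) + (g i)\<^sup>2)"
    by (rule infsum_cong) (simp add: power2_eq_square algebra_simps)
  also have "\<dots> = (\<Sum>\<^sub>\<infinity>i\<in>I. (f i)\<^sup>2) * t\<^sup>2 + (\<Sum>\<^sub>\<infinity>i\<in>I. f i * g i) * (2 * t) + (\<Sum>\<^sub>\<infinity>i\<in>I. (g i)\<^sup>2)"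
    by (simp only: infsum_add[OF summable_on_add[OF s1] assms(2)] infsum_add[OF s1]
        infsum_cmult_left'[of "\<lambda>i. (f i)\<^sup>2"] infsum_cmult_left'[of "\<lambda>i. f i * g i"])
  finally show "0 \<le> (\<Sum>\<^sub>\<infinity>i\<in>I. (f i)\<^sup>2) * t\<^sup>2 + 2 * (\<Sum>\<^sub>\<infinity>i\<in>I. f i * g i) * t + (\<Sum>\<^sub>\<infinity>i\<in>I. (g i)\<^sup>2)"
    by (simp add: algebra_simps)
qed (rule infsum_nonneg, simp)

section \<open>Hilbert spaces given by a set and a form\<close>

text \<open>Completeness refers to the form itself, since V is only a subset of its type and
  \<open>a\<close> need not be the inner product of that type. The two instances are
  \<open>L2_on\<close> with \<open>inner\<close> and \<open>Hs0\<close> with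
  \<open>frac_form\<close>.\<close>

locale hilbert_form =
  fixes V :: "'v::real_vector set" and a :: "'v \<Rightarrow> 'v \<Rightarrow> real"
  assumes subspace: "subspace V"
    and add_left: "\<And>u v w. u \<in> V \<Longrightarrow> v \<in> V \<Longrightarrow> w \<in> V \<Longrightarrow> a (u + v) w = a u w + a v w"
    and scale_left: "\<And>c u v. u \<in> V \<Longrightarrow> v \<in> V \<Longrightarrow> a (c *\<^sub>R u) v = c * a u v"
    and sym: "\<And>u v. u \<in> V \<Longrightarrow> v \<in> V \<Longrightarrow> a u v = a v u"
    and pos: "\<And>u. u \<in> V \<Longrightarrow> u \<noteq> 0 \<Longrightarrow> 0 < a u u"
    and complete: "\<And>X. (\<And>n. X n \<in> V) \<Longrightarrow>
      (\<And>e. 0 < e \<Longrightarrow> \<exists>N. \<forall>m\<ge>N. \<forall>n\<ge>N. a (X m - X n) (X m - X n) < e) \<Longrightarrow>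
      \<exists>x\<in>V. (\<lambda>n::nat. a (X n - x) (X n - x)) \<longlonglongrightarrow> 0"
begin

lemmas mem_zero [simp, intro] = subspace_0[OF subspace]
lemmas mem_add [simp, intro] = subspace_add[OF subspace]
lemmas mem_diff [simp, intro] = subspace_diff[OF subspace]
lemmas mem_scale [simp, intro] = subspace_scale[OF subspace]
lemmas mem_sum [intro] = subspace_sum[OF subspace]

lemma add_right: "u \<in> V \<Longrightarrow> v \<in> V \<Longrightarrow> w \<in> V \<Longrightarrow> a u (v + w) = a u v + a u w"
  by (metis add_left mem_add sym)

lemma scale_right: "u \<in> V \<Longrightarrow> v \<in> V \<Longrightarrow> a u (c *\<^sub>R v) = c * a u v"
  by (metis scale_left mem_scale sym)

lemma zero_left [simp]: "v \<in> V \<Longrightarrow> a 0 v = 0"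
  using scale_left[of v v 0] by simp

lemma zero_right [simp]: "v \<in> V \<Longrightarrow> a v 0 = 0"
  using scale_right[of v v 0] by simp

lemma diff_left: "u \<in> V \<Longrightarrow> v \<in> V \<Longrightarrow> w \<in> V \<Longrightarrow> a (u - v) w = a u w - a v w"
  using add_left[of u "(-1) *\<^sub>R v" w] scale_left[of v w "-1"] mem_scale[of v "-1"] by simp

lemma diff_right: "u \<in> V \<Longrightarrow> v \<in> V \<Longrightarrow> w \<in> V \<Longrightarrow> a u (v - w) = a u v - a u w"
  by (metis diff_left mem_diff sym)

lemmas bilinear = add_left add_right diff_left diff_right scale_left scale_right

lemma sum_left: "v \<in> V \<Longrightarrow> (\<And>i. i \<in> F \<Longrightarrow> f i \<in> V) \<Longrightarrow> a (\<Sum>i\<in>F. f i) v = (\<Sum>i\<in>F. a (f i) v)"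
  by (induction F rule: infinite_finite_induct) (auto simp: add_left mem_sum)

lemma sum_right: "v \<in> V \<Longrightarrow> (\<And>i. i \<in> F \<Longrightarrow> f i \<in> V) \<Longrightarrow> a v (\<Sum>i\<in>F. f i) = (\<Sum>i\<in>F. a v (f i))"
  by (induction F rule: infinite_finite_induct) (auto simp: add_right mem_sum)

lemma nonneg: "u \<in> V \<Longrightarrow> 0 \<le> a u u"
  by (cases "u = 0") (auto dest: pos)

lemma eq_zero: "u \<in> V \<Longrightarrow> a u u = 0 \<Longrightarrow> u = 0"
  using pos by fastforce

lemma Cauchy_Schwarz: "u \<in> V \<Longrightarrow> v \<in> V \<Longrightarrow> (a u v)\<^sup>2 \<le> a u u * a v v"
proof (rule discriminant_le)
  fix t :: real
  assume uv: "u \<in> V" "v \<in> V"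
  have "0 \<le> a (t *\<^sub>R u + v) (t *\<^sub>R u + v)"
    using uv by (intro nonneg) auto
  also have "\<dots> = a u u * t\<^sup>2 + 2 * a u v * t + a v v"
    using uv by (simp add: bilinear sym[of v u] power2_eq_square algebra_simps)
  finally show "0 \<le> a u u * t\<^sup>2 + 2 * a u v * t + a v v" .
qed (rule nonneg)

text \<open>The shape in which Cauchy sequences arise below: each approximating sequence comes with
  a null sequence g that measures its defect, and the parallelogram law bounds squared distances by
  g m + g n.\<close>

lemma complete_of_bound:
  assumes X: "\<And>n. X n \<in> V" and g: "g \<longlonglongrightarrow> (0::real)"
    and bound: "\<And>m n. a (X m - X n) (X m - X n) \<le> g m + g n"
  obtains x where "x \<in> V" "(\<lambda>n. a (X n - x) (X n - x)) \<longlonglongrightarrow> 0"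
proof -
  have "\<exists>N. \<forall>m\<ge>N. \<forall>n\<ge>N. a (X m - X n) (X m - X n) < e" if e: "0 < e" for e
  proof -
    have "\<forall>\<^sub>F n in sequentially. g n < e / 2"
      using order_tendstoD(2)[OF g, of "e / 2"] e by auto
    then obtain N where N: "\<And>n. n \<ge> N \<Longrightarrow> g n < e / 2" by (auto simp: eventually_sequentially)
    have "a (X m - X n) (X m - X n) < e" if "m \<ge> N" "n \<ge> N" for m n
      using bound[of m n] N[OF that(1)] N[OF that(2)] by linarith
    then show ?thesis by blast
  qed
  then show ?thesis using complete[of X] X that by blast
qed

lemma tendsto_form_left:
  assumes X: "\<And>n. X n \<in> V" and x: "x \<in> V" and v: "v \<in> V"
    and lim: "(\<lambda>n::nat. a (X n - x) (X n - x)) \<longlonglongrightarrow> 0"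
  shows "(\<lambda>n. a (X n) v) \<longlonglongrightarrow> a x v"
proof -
  have "(\<lambda>n. a (X n - x) (X n - x) * a v v) \<longlonglongrightarrow> 0"
    using tendsto_mult_right[OF lim, of "a v v"] by simp
  then have "(\<lambda>n. (a (X n - x) v)\<^sup>2) \<longlonglongrightarrow> 0"
    by (rule tendsto_sandwich[OF _ _ tendsto_const, rotated 2])
       (auto intro!: always_eventually Cauchy_Schwarz X x v)
  then have "(\<lambda>n. a (X n - x) v) \<longlonglongrightarrow> 0"
    by (simp add: tendsto_power_zero power_tendsto_0_iff)
  then have "(\<lambda>n. a (X n - x) v + a x v) \<longlonglongrightarrow> 0 + a x v"
    by (intro tendsto_intros)
  then show ?thesis using X x v by (simp add: diff_left)
qed

lemma tendsto_form_square:
  assumes X: "\<And>n. X n \<in> V" and x: "x \<in> V"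
    and lim: "(\<lambda>n::nat. a (X n - x) (X n - x)) \<longlonglongrightarrow> 0"
  shows "(\<lambda>n. a (X n) (X n)) \<longlonglongrightarrow> a x x"
proof -
  have "(\<lambda>n. a (X n - x) (X n - x) + 2 * a (X n) x - a x x) \<longlonglongrightarrow> 0 + 2 * a x x - a x x"
    by (intro tendsto_intros tendsto_form_left lim X x)
  moreover have "a (X n - x) (X n - x) + 2 * a (X n) x - a x x = a (X n) (X n)" for n
    using X x by (simp add: bilinear sym[of x "X n"])
  ultimately show ?thesis by simp
qed

text \<open>Minimizing sequences of \<open>J v = a v v - 2 f v\<close> are Cauchy by the parallelogram law.\<close>

lemma Riesz_representation:
  assumes f_add: "\<And>u v. u \<in> V \<Longrightarrow> v \<in> V \<Longrightarrow> f (u + v) = f u + f v"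
    and f_scale: "\<And>c u. u \<in> V \<Longrightarrow> f (c *\<^sub>R u) = c * f u"
    and bound: "\<And>u. u \<in> V \<Longrightarrow> (f u)\<^sup>2 \<le> C * a u u"
  obtains g where "g \<in> V" "\<And>v. v \<in> V \<Longrightarrow> a g v = f v"
proof -
  define J where "J v = a v v - 2 * f v" for v
  have lower: "- \<bar>C\<bar> \<le> J v" if "v \<in> V" for v
  proof -
    \<comment> \<open>This is 2 |f v| <= 2 sqrt (|C| a v v) <= a v v + |C| in squared form; |C|
      appears because C carries no sign.\<close>
    have "(2 * \<bar>f v\<bar>)\<^sup>2 \<le> 4 * (\<bar>C\<bar> * a v v)"
      using bound[OF that] mult_right_mono[OF abs_ge_self[of C] nonneg[OF that]]
      by (simp add: power_mult_distrib)
    also have "\<dots> \<le> (a v v + \<bar>C\<bar>)\<^sup>2"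
      using zero_le_power2[of "a v v - \<bar>C\<bar>"] by (simp add: power2_eq_square algebra_simps)
    finally have "2 * \<bar>f v\<bar> \<le> a v v + \<bar>C\<bar>"
      by (rule power2_le_imp_le) (use nonneg[OF that] in auto)
    then show ?thesis unfolding J_def by linarith
  qed
  then have bdd: "bdd_below (J ` V)" by (intro bdd_belowI[of _ "- \<bar>C\<bar>"]) auto
  define I where "I = (INF v\<in>V. J v)"
  have I_le: "I \<le> J v" if "v \<in> V" for v
    unfolding I_def using bdd that by (rule cINF_lower)
  have "\<exists>v\<in>V. J v < I + 1 / real (Suc n)" for n
    using cINF_less_iff[OF _ bdd, of "I + 1 / real (Suc n)"] unfolding I_def by fastforce
  then obtain X where X: "\<And>n. X n \<in> V" "\<And>n. J (X n) < I + 1 / real (Suc n)" by metis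
  have para: "a (u - v) (u - v) \<le> 2 * (J u - I) + 2 * (J v - I)" if uv: "u \<in> V" "v \<in> V" for u v
  proof -
    have "4 * J ((1/2) *\<^sub>R (u + v)) = 2 * J u + 2 * J v - a (u - v) (u - v)"
      using uv by (simp add: J_def bilinear f_add f_scale sym[of v u] distrib_left add_divide_distrib)
    then show ?thesis using I_le[of "(1/2) *\<^sub>R (u + v)"] uv by auto
  qed
  obtain g where g: "g \<in> V" "(\<lambda>n. a (X n - g) (X n - g)) \<longlonglongrightarrow> 0"
  proof (rule complete_of_bound[OF X(1)])
    have "(\<lambda>n. 2 * (1 / real (Suc n))) \<longlonglongrightarrow> 2 * 0"
      by (intro tendsto_intros LIMSEQ_Suc lim_1_over_n)
    then show "(\<lambda>n. 2 * (1 / real (Suc n))) \<longlonglongrightarrow> 0" by simp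
    show "a (X m - X n) (X m - X n) \<le> 2 * (1 / real (Suc m)) + 2 * (1 / real (Suc n))" for m n
      using para[OF X(1)[of m] X(1)[of n]] X(2)[of m] X(2)[of n] by argo
  qed
  have f_lim: "(\<lambda>n. f (X n)) \<longlonglongrightarrow> f g"
  proof -
    have "(\<lambda>n. C * a (X n - g) (X n - g)) \<longlonglongrightarrow> 0"
      using tendsto_mult_left[OF g(2), of C] by simp
    then have "(\<lambda>n. (f (X n - g))\<^sup>2) \<longlonglongrightarrow> 0"
      by (rule tendsto_sandwich[OF _ _ tendsto_const, rotated 2])
         (use bound X(1) g(1) in auto)
    then have "(\<lambda>n. f (X n - g)) \<longlonglongrightarrow> 0"
      by (simp add: power_tendsto_0_iff)
    then have "(\<lambda>n. f (X n - g) + f g) \<longlonglongrightarrow> 0 + f g"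
      by (intro tendsto_intros)
    moreover have "f (X n - g) + f g = f (X n)" for n
      using f_add[of "X n - g" g] X(1) g(1) by auto
    ultimately show ?thesis by simp
  qed
  have "(\<lambda>n. J (X n)) \<longlonglongrightarrow> J g"
    unfolding J_def by (intro tendsto_intros f_lim tendsto_form_square X(1) g)
  moreover have "(\<lambda>n. I + 1 / real (Suc n)) \<longlonglongrightarrow> I + 0"
    by (intro tendsto_intros LIMSEQ_Suc lim_1_over_n)
  ultimately have "J g \<le> I"
    using LIMSEQ_le[of "\<lambda>n. J (X n)" "J g" "\<lambda>n. I + 1 / real (Suc n)" I] X(2)
    by (auto intro: less_imp_le)
  have "a g w = f w" if w: "w \<in> V" for w
  proof -
    \<comment> \<open>First variation: g minimizes J, so the quadratic polynomial J (g + t w) - J g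
      in t is nonnegative and its linear coefficient vanishes.\<close>
    have "a g w - f w = 0"
    proof (rule linear_coeff_zero_of_quadratic_nonneg)
      fix t
      have "J (g + t *\<^sub>R w) = J g + (2 * t * (a g w - f w) + t\<^sup>2 * a w w)"
        using w g(1) by (simp add: J_def bilinear f_add f_scale sym[of w g] power2_eq_square algebra_simps)
      then show "0 \<le> 2 * t * (a g w - f w) + t\<^sup>2 * a w w"
        using I_le[of "g + t *\<^sub>R w"] \<open>J g \<le> I\<close> w g(1) by auto
    qed
    then show ?thesis by simp
  qed
  then show ?thesis using that g(1) by blast
qed

end

section \<open>Orthonormal families: Bessel, Riesz-Fischer, Parseval\<close>

text \<open>Indices are kept apart from vectors because one index set S later serves two bases: the
  eigenvectors themselves in H and their rescalings in V.\<close>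

locale orthonormal_family = hilbert_form V a for V :: "'v::real_vector set" and a +
  fixes I :: "'i set" and \<phi> :: "'i \<Rightarrow> 'v"
  assumes basis_mem [simp, intro]: "\<And>i. i \<in> I \<Longrightarrow> \<phi> i \<in> V"
    and orthonormal: "\<And>i j. i \<in> I \<Longrightarrow> j \<in> I \<Longrightarrow> a (\<phi> i) (\<phi> j) = (if i = j then 1 else 0)"
begin

lemma infsum_basis:
  assumes "j \<in> I"
  shows "(\<Sum>\<^sub>\<infinity>i\<in>I. c i * a (\<phi> j) (\<phi> i)) = c j"
proof -
  have "(\<Sum>\<^sub>\<infinity>i\<in>I. c i * a (\<phi> j) (\<phi> i)) = (\<Sum>\<^sub>\<infinity>i\<in>{j}. c i)"
    by (rule infsum_cong_neutral) (use assms in \<open>auto simp: orthonormal\<close>)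
  then show ?thesis by simp
qed

lemma Bessel_finite:
  assumes u: "u \<in> V" and F: "finite F" "F \<subseteq> I"
  shows "(\<Sum>i\<in>F. (a u (\<phi> i))\<^sup>2) \<le> a u u"
proof -
  \<comment> \<open>The orthogonal projection of u onto the span of F: both a u p and a p p equal
    the partial sum, so a (u - p) (u - p) >= 0 is the claim.\<close>
  define p where "p = (\<Sum>i\<in>F. a u (\<phi> i) *\<^sub>R \<phi> i)"
  have mem: "\<phi> i \<in> V" if "i \<in> F" for i using that F by auto
  have p: "p \<in> V" unfolding p_def using mem by (intro mem_sum) auto
  have up: "a u p = (\<Sum>i\<in>F. (a u (\<phi> i))\<^sup>2)"
    unfolding p_def using mem u by (simp add: sum_right scale_right power2_eq_square)
  have "a p (\<phi> i) = a u (\<phi> i)" if i: "i \<in> F" for i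
  proof -
    have "a p (\<phi> i) = (\<Sum>j\<in>F. a u (\<phi> j) * a (\<phi> j) (\<phi> i))"
      unfolding p_def using mem i by (simp add: sum_left scale_left)
    also have "\<dots> = (\<Sum>j\<in>F. if j = i then a u (\<phi> j) else 0)"
      using F i by (intro sum.cong) (auto simp: orthonormal subset_iff)
    finally show ?thesis using F i by simp
  qed
  then have pp: "a p p = (\<Sum>i\<in>F. (a u (\<phi> i))\<^sup>2)"
    using p mem by (subst (2) p_def) (simp add: sum_right scale_right power2_eq_square)
  have "0 \<le> a (u - p) (u - p)" using u p by (intro nonneg) auto
  also have "\<dots> = a u u - 2 * a u p + a p p"
    using u p by (simp add: bilinear sym[of p u])
  finally show ?thesis using up pp by simp
qed

lemma Bessel_summable: "u \<in> V \<Longrightarrow> (\<lambda>i. (a u (\<phi> i))\<^sup>2) summable_on I"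
  by (rule nonneg_bdd_above_summable_on) (auto intro!: bdd_aboveI[of _ "a u u"] Bessel_finite)

lemma Bessel: "u \<in> V \<Longrightarrow> (\<Sum>\<^sub>\<infinity>i\<in>I. (a u (\<phi> i))\<^sup>2) \<le> a u u"
  by (rule infsum_le_finite_sums[OF Bessel_summable]) (auto intro: Bessel_finite)

text \<open>No partial sums are formed. The functional v -> sum of c i * a v (\<phi> i) is bounded
  by Cauchy-Schwarz and Bessel, and its Riesz representer is the wanted vector. It comes with its
  pairing against every v, which is what Parseval needs.\<close>

lemma Riesz_Fischer_weak:
  assumes c: "(\<lambda>i. (c i)\<^sup>2) summable_on I"
  obtains u where "u \<in> V" "\<And>v. v \<in> V \<Longrightarrow> a u v = (\<Sum>\<^sub>\<infinity>i\<in>I. c i * a v (\<phi> i))"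
proof (rule Riesz_representation[of "\<lambda>v. \<Sum>\<^sub>\<infinity>i\<in>I. c i * a v (\<phi> i)" "\<Sum>\<^sub>\<infinity>i\<in>I. (c i)\<^sup>2"])
  have summ: "(\<lambda>i. c i * a v (\<phi> i)) summable_on I" if "v \<in> V" for v
    using c Bessel_summable[OF that] by (rule summable_on_mult_of_squares)
  show "(\<Sum>\<^sub>\<infinity>i\<in>I. c i * a (u + v) (\<phi> i)) = (\<Sum>\<^sub>\<infinity>i\<in>I. c i * a u (\<phi> i)) + (\<Sum>\<^sub>\<infinity>i\<in>I. c i * a v (\<phi> i))"
    if "u \<in> V" "v \<in> V" for u v
    using that by (subst infsum_add[symmetric, OF summ summ])
      (auto intro!: infsum_cong simp: add_left algebra_simps)
  show "(\<Sum>\<^sub>\<infinity>i\<in>I. c i * a (k *\<^sub>R u) (\<phi> i)) = k * (\<Sum>\<^sub>\<infinity>i\<in>I. c i * a u (\<phi> i))"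
    if "u \<in> V" for u k
    using that by (subst infsum_cmult_right'[symmetric]) (auto intro!: infsum_cong simp: scale_left)
  show "(\<Sum>\<^sub>\<infinity>i\<in>I. c i * a u (\<phi> i))\<^sup>2 \<le> (\<Sum>\<^sub>\<infinity>i\<in>I. (c i)\<^sup>2) * a u u" if u: "u \<in> V" for u
    by (rule order_trans[OF infsum_Cauchy_Schwarz[OF c Bessel_summable[OF u]]])
       (intro mult_left_mono Bessel u infsum_nonneg, simp)
qed (use that in blast)

lemma Riesz_Fischer:
  assumes c: "(\<lambda>i. (c i)\<^sup>2) summable_on I"
  obtains u where "u \<in> V" "\<And>i. i \<in> I \<Longrightarrow> a u (\<phi> i) = c i"
proof -
  obtain u where u: "u \<in> V" "\<And>v. v \<in> V \<Longrightarrow> a u v = (\<Sum>\<^sub>\<infinity>i\<in>I. c i * a v (\<phi> i))"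
    using Riesz_Fischer_weak[OF c] by blast
  have "a u (\<phi> j) = c j" if j: "j \<in> I" for j
  proof -
    show ?thesis using u(2)[OF basis_mem[OF j]] infsum_basis[OF j] by simp
  qed
  then show ?thesis using that u(1) by blast
qed

end

locale orthonormal_basis = orthonormal_family V a I \<phi> for V :: "'v::real_vector set" and a and I :: "'i set" and \<phi> +
  assumes total: "\<And>u. u \<in> V \<Longrightarrow> (\<And>i. i \<in> I \<Longrightarrow> a u (\<phi> i) = 0) \<Longrightarrow> u = 0"
begin

lemma eqI:
  assumes "u \<in> V" "v \<in> V" "\<And>i. i \<in> I \<Longrightarrow> a u (\<phi> i) = a v (\<phi> i)"
  shows "u = v"
  using total[of "u - v"] assms by (auto simp: diff_left)

text \<open>Riesz-Fischer applied to the coefficients of u yields a vector whose pairing with any v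
  is the series; totality identifies this vector with u.\<close>

lemma Parseval: 
  assumes u: "u \<in> V" and v: "v \<in> V"
  shows "((\<lambda>i. a u (\<phi> i) * a v (\<phi> i)) has_sum a u v) I"
proof -
  obtain u' where u': "u' \<in> V" "\<And>v. v \<in> V \<Longrightarrow> a u' v = (\<Sum>\<^sub>\<infinity>i\<in>I. a u (\<phi> i) * a v (\<phi> i))"
    using Riesz_Fischer_weak[OF Bessel_summable[OF u]] by blast
  have "u' = u"
  proof (rule eqI[OF u'(1) u])
    fix j assume j: "j \<in> I"
    show "a u' (\<phi> j) = a u (\<phi> j)" using u'(2)[OF basis_mem[OF j]] infsum_basis[OF j] by simp
  qed
  then have "a u v = (\<Sum>\<^sub>\<infinity>i\<in>I. a u (\<phi> i) * a v (\<phi> i))" using u' v by simp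
  then show ?thesis
    using summable_on_mult_of_squares[OF Bessel_summable[OF u] Bessel_summable[OF v]] by simp
qed

end

section \<open>Eigenbases of compactly embedded forms\<close>

text \<open>Bolzano-Weierstrass once per index. It is applied to the finitely many functionals of
  the compactness inequality along a maximizing sequence.\<close>

lemma finite_family_convergent_subsequence:
  fixes f :: "'i \<Rightarrow> nat \<Rightarrow> real"
  assumes "finite F" "\<And>i. i \<in> F \<Longrightarrow> bounded (range (f i))"
  obtains r where "strict_mono r" "\<And>i. i \<in> F \<Longrightarrow> convergent (f i \<circ> r)"
proof -
  have "\<exists>r. strict_mono r \<and> (\<forall>i\<in>F. convergent (f i \<circ> r))"
    using assms
  proof (induction F)
    case empty
    then show ?case using strict_mono_id by blast
  next
    case (insert j F)
    have "\<exists>r. strict_mono r \<and> (\<forall>i\<in>F. convergent (f i \<circ> r))"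
      using insert.prems by (intro insert.IH) simp
    then obtain r where r: "strict_mono r" "\<And>i. i \<in> F \<Longrightarrow> convergent (f i \<circ> r)" by blast
    have "bounded (range (f j \<circ> r))"
      using insert.prems[of j] by (auto intro: bounded_subset)
    then obtain l q where q: "strict_mono q" "((f j \<circ> r) \<circ> q) \<longlonglongrightarrow> l"
      using bounded_imp_convergent_subsequence by blast
    have "convergent (f i \<circ> (r \<circ> q))" if i: "i \<in> insert j F" for i
    proof (cases "i = j")
      case True
      then show ?thesis using q(2) unfolding comp_assoc convergent_def by blast
    next
      case False
      then obtain k where "(f i \<circ> r) \<longlonglongrightarrow> k" using i r(2) unfolding convergent_def by blast
      from LIMSEQ_subseq_LIMSEQ[OF this q(1)] show ?thesis
        unfolding comp_assoc convergent_def by blast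
    qed
    then show ?case using strict_mono_o[OF r(1) q(1)] by blast
  qed
  then show ?thesis using that by blast
qed

text \<open>The last assumption is the compactness of the embedding of \<open>V\<close> into \<open>H\<close>.\<close>

locale compact_form = H: hilbert_form H inner + V: hilbert_form V a
  for H V :: "'h::real_inner set" and a +
  assumes V_subset: "V \<subseteq> H"
    and coercive: "\<And>u. u \<in> V \<Longrightarrow> u \<bullet> u \<le> a u u"
    and dense: "\<And>u. u \<in> H \<Longrightarrow> (\<And>v. v \<in> V \<Longrightarrow> u \<bullet> v = 0) \<Longrightarrow> u = 0"
    and compact: "\<And>\<epsilon>. 0 < \<epsilon> \<Longrightarrow>
      \<exists>\<Phi>. finite \<Phi> \<and> (\<forall>u\<in>V. u \<bullet> u \<le> \<epsilon> * a u u + (\<Sum>\<phi>\<in>\<Phi>. (u \<bullet> \<phi>)\<^sup>2))"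
begin

lemma V_into_H: "u \<in> V \<Longrightarrow> u \<in> H" using V_subset by auto

lemma form_tendsto_imp_inner_tendsto:
  assumes X: "\<And>n. X n \<in> V" "x \<in> V" "(\<lambda>n::nat. a (X n - x) (X n - x)) \<longlonglongrightarrow> 0"
  shows "(\<lambda>n. (X n - x) \<bullet> (X n - x)) \<longlonglongrightarrow> 0"
  by (rule tendsto_sandwich[OF _ _ tendsto_const X(3)]) (use X coercive in auto)

text \<open>With \<open>m\<close> the supremum of \<open>w \<bullet> w / a w w\<close>, the form \<open>q w = m * a w w - w \<bullet> w\<close> is positive
  semidefinite, so \<open>q\<close> of a difference in a maximizing sequence tends to zero. Compactness with
  \<open>\<epsilon> = m / 2\<close> then bounds \<open>a\<close> of the difference.\<close>

lemma Rayleigh_maximizer: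
  assumes W: "subspace W" "W \<subseteq> V" "w\<^sub>0 \<in> W" "w\<^sub>0 \<noteq> 0"
    and W_closed: "\<And>X x. (\<And>n. X n \<in> W) \<Longrightarrow> x \<in> V \<Longrightarrow>
      (\<lambda>n::nat. a (X n - x) (X n - x)) \<longlonglongrightarrow> 0 \<Longrightarrow> x \<in> W"
  obtains u m where "u \<in> W" "u \<noteq> 0" "0 < m" "\<And>w. w \<in> W \<Longrightarrow> m * a u w = u \<bullet> w"
proof -
  have WV: "w \<in> V" if "w \<in> W" for w using that W by auto
  have WH: "w \<in> H" if "w \<in> W" for w using WV[OF that] V_into_H by auto
  define R where "R w = w \<bullet> w / a w w" for w
  have R_le: "R w \<le> 1" if "w \<in> W - {0}" for w
    using that V.pos[of w] coercive[of w] WV by (auto simp: R_def divide_simps)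
  then have bdd: "bdd_above (R ` (W - {0}))" by (intro bdd_aboveI) auto
  define m where "m = (SUP w\<in>W - {0}. R w)"
  have m_ge: "R w \<le> m" if "w \<in> W - {0}" for w
    unfolding m_def using bdd that by (auto intro: cSUP_upper)
  have "0 < R w\<^sub>0" using W V.pos[of w\<^sub>0] WV by (auto simp: R_def)
  also have "\<dots> \<le> m" using m_ge W by auto
  finally have m_pos: "0 < m" .
  define q where "q u v = m * a u v - u \<bullet> v" for u v
  have q_nonneg: "0 \<le> q w w" if "w \<in> W" for w
    using m_ge[of w] that V.pos[of w] WV by (cases "w = 0") (auto simp: q_def R_def field_simps)
  have q_add: "q (u + t *\<^sub>R v) (u + t *\<^sub>R v) = q u u + (2 * t * q u v + t\<^sup>2 * q v v)"
    if "u \<in> W" "v \<in> W" for u v t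
    using that WV by (simp add: q_def V.bilinear V.sym[of v u] inner_add inner_commute[of v u]
        power2_eq_square algebra_simps)
  have "\<exists>w\<in>W. a w w = 1 \<and> m - 1 / real (Suc n) < w \<bullet> w" for n
  proof -
    obtain w where w: "w \<in> W - {0}" "m - 1 / real (Suc n) < R w"
      using less_cSUP_iff[OF _ bdd, of "m - 1 / real (Suc n)"] W unfolding m_def by auto
    define c where "c = 1 / sqrt (a w w)"
    have aw: "a w w > 0" using w V.pos WV by auto
    then have c: "c * c = 1 / a w w" by (simp add: c_def)
    then have "a (c *\<^sub>R w) (c *\<^sub>R w) = 1" "(c *\<^sub>R w) \<bullet> (c *\<^sub>R w) = R w"
      using w WV aw by (auto simp: V.bilinear R_def mult.assoc[symmetric] c)
    then show ?thesis using w subspace_scale[OF W(1)] by (intro bexI[of _ "c *\<^sub>R w"]) auto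
  qed
  then obtain X where X: "\<And>n. X n \<in> W" "\<And>n. a (X n) (X n) = 1"
      "\<And>n. m - 1 / real (Suc n) < X n \<bullet> X n" by metis
  obtain \<Phi> where \<Phi>: "finite \<Phi>" "\<And>u. u \<in> V \<Longrightarrow> u \<bullet> u \<le> m / 2 * a u u + (\<Sum>\<phi>\<in>\<Phi>. (u \<bullet> \<phi>)\<^sup>2)"
    using compact[of "m / 2"] m_pos by auto
  have "bounded (range (\<lambda>n. X n \<bullet> \<phi>))" for \<phi>
  proof -
    have "norm (X n) \<le> 1" for n
      using coercive[of "X n"] X[of n] WV by (simp add: norm_eq_sqrt_inner)
    then have "norm (X n) * norm \<phi> \<le> 1 * norm \<phi>" for n
      by (intro mult_right_mono) auto
    then have "\<bar>X n \<bullet> \<phi>\<bar> \<le> norm \<phi>" for n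
      using order_trans[OF Cauchy_Schwarz_ineq2[of "X n" \<phi>]] by simp
    then show ?thesis by (auto simp: bounded_iff)
  qed
  then obtain r where r: "strict_mono r" "\<And>\<phi>. \<phi> \<in> \<Phi> \<Longrightarrow> convergent ((\<lambda>n. X n \<bullet> \<phi>) \<circ> r)"
    using finite_family_convergent_subsequence[OF \<Phi>(1), of "\<lambda>\<phi> n. X n \<bullet> \<phi>"] by blast
  define Y where "Y = X \<circ> r"
  have Y: "Y n \<in> W" "a (Y n) (Y n) = 1" for n by (auto simp: Y_def X)
  obtain L where L: "\<And>\<phi>. \<phi> \<in> \<Phi> \<Longrightarrow> (\<lambda>n. Y n \<bullet> \<phi>) \<longlonglongrightarrow> L \<phi>"
    using r(2) unfolding convergent_def Y_def comp_def by metis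
  have "(\<lambda>n. q (X n) (X n)) \<longlonglongrightarrow> 0"
  proof (rule tendsto_sandwich[OF _ _ tendsto_const])
    show "(\<lambda>n. 1 / real (Suc n)) \<longlonglongrightarrow> 0" by (rule LIMSEQ_Suc[OF lim_1_over_n])
    show "\<forall>\<^sub>F n in sequentially. q (X n) (X n) \<le> 1 / real (Suc n)"
      using X(3) by (intro always_eventually) (simp add: q_def X(2) algebra_simps less_imp_le)
  qed (use q_nonneg X in auto)
  then have qY: "(\<lambda>n. q (Y n) (Y n)) \<longlonglongrightarrow> 0"
    using LIMSEQ_subseq_LIMSEQ[OF _ r(1)] by (auto simp: Y_def comp_def)
  \<comment> \<open>For a difference d of sequence members, m a d d - d \<bullet> d is bounded
    through q, and compactness allows d \<bullet> d to consume at most half of m a d d. Dividing the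
    remaining inequality for m/2 * a d d by m/2 turns the factors 2 into 4/m.\<close>
  define g where "g n = 4 / m * (q (Y n) (Y n) + (\<Sum>\<phi>\<in>\<Phi>. (Y n \<bullet> \<phi> - L \<phi>)\<^sup>2))" for n
  have g: "g \<longlonglongrightarrow> 0"
  proof -
    have "(\<lambda>n. 4 / m * (q (Y n) (Y n) + (\<Sum>\<phi>\<in>\<Phi>. (Y n \<bullet> \<phi> - L \<phi>)\<^sup>2)))
        \<longlonglongrightarrow> 4 / m * (0 + (\<Sum>\<phi>\<in>\<Phi>. (L \<phi> - L \<phi>)\<^sup>2))"
      by (intro tendsto_intros qY L)
    then show ?thesis by (simp add: g_def[abs_def])
  qed
  have diff_le: "a (Y i - Y j) (Y i - Y j) \<le> g i + g j" for i j
  proof -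
    let ?d = "Y i - Y j"
    have d: "?d \<in> W" "Y i + Y j \<in> W" using Y subspace_diff[OF W(1)] subspace_add[OF W(1)] by auto
    have "q ?d ?d + q (Y i + Y j) (Y i + Y j) = 2 * q (Y i) (Y i) + 2 * q (Y j) (Y j)"
      using q_add[of "Y i" "Y j" 1] q_add[of "Y i" "Y j" "-1"] Y by simp
    then have "m * a ?d ?d - ?d \<bullet> ?d \<le> 2 * q (Y i) (Y i) + 2 * q (Y j) (Y j)"
      using q_nonneg[OF d(2)] by (simp add: q_def)
    moreover have "?d \<bullet> ?d \<le> m / 2 * a ?d ?d + (\<Sum>\<phi>\<in>\<Phi>. (?d \<bullet> \<phi>)\<^sup>2)"
      using \<Phi>(2) d WV by auto
    moreover have "(\<Sum>\<phi>\<in>\<Phi>. (?d \<bullet> \<phi>)\<^sup>2) \<le> (\<Sum>\<phi>\<in>\<Phi>. 2 * (Y i \<bullet> \<phi> - L \<phi>)\<^sup>2 + 2 * (Y j \<bullet> \<phi> - L \<phi>)\<^sup>2)"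
    proof (rule sum_mono)
      fix \<phi>
      show "(?d \<bullet> \<phi>)\<^sup>2 \<le> 2 * (Y i \<bullet> \<phi> - L \<phi>)\<^sup>2 + 2 * (Y j \<bullet> \<phi> - L \<phi>)\<^sup>2"
        using zero_le_power2[of "(Y i \<bullet> \<phi> - L \<phi>) + (Y j \<bullet> \<phi> - L \<phi>)"]
        by (simp add: inner_diff_left power2_eq_square algebra_simps)
    qed
    ultimately have "m / 2 * a ?d ?d \<le> m / 2 * (g i + g j)"
      using m_pos by (simp add: g_def sum.distrib sum_distrib_left[symmetric] distrib_left)
    then show ?thesis using m_pos by simp
  qed
  obtain u where u: "u \<in> V" "(\<lambda>n. a (Y n - u) (Y n - u)) \<longlonglongrightarrow> 0"
    using V.complete_of_bound[OF _ g diff_le] Y(1) WV by blast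
  have uW: "u \<in> W" using W_closed[of Y u] Y u by auto
  have "(\<lambda>n. a (Y n) (Y n)) \<longlonglongrightarrow> a u u"
    by (rule V.tendsto_form_square) (use Y u WV in auto)
  then have au: "a u u = 1" by (simp add: Y(2) LIMSEQ_const_iff)
  have "(\<lambda>n. (Y n - u) \<bullet> (Y n - u)) \<longlonglongrightarrow> 0"
    by (rule form_tendsto_imp_inner_tendsto) (use Y u WV in auto)
  then have "(\<lambda>n. Y n \<bullet> Y n) \<longlonglongrightarrow> u \<bullet> u"
    by (intro H.tendsto_form_square) (use Y uW WH in auto)
  then have "(\<lambda>n. q (Y n) (Y n)) \<longlonglongrightarrow> q u u"
    unfolding q_def Y(2) au by (intro tendsto_diff tendsto_const)
  then have qu: "q u u = 0" using qY LIMSEQ_unique by blast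
  \<comment> \<open>u is a zero of the nonnegative quadratic form q on W, hence a minimum point, and
    the first variation there vanishes.\<close>
  have "q u w = 0" if w: "w \<in> W" for w
  proof (rule linear_coeff_zero_of_quadratic_nonneg)
    show "0 \<le> 2 * t * q u w + t\<^sup>2 * q w w" for t
      using q_nonneg[of "u + t *\<^sub>R w"] q_add[OF uW w, of t] qu w uW
        subspace_add[OF W(1)] subspace_scale[OF W(1)] by simp
  qed
  moreover have "u \<noteq> 0" using au V.zero_left[OF u(1)] by auto
  ultimately show ?thesis using that[of u m] uW m_pos by (simp add: q_def)
qed

text \<open>The weak eigenvalue equation, tested against the form domain, so that no operator domain
  enters.\<close>

definition eigenvector :: "'h \<Rightarrow> real \<Rightarrow> bool" where
  "eigenvector e l \<longleftrightarrow> e \<in> V \<and> e \<bullet> e = 1 \<and> (\<forall>v\<in>V. a e v = l * (e \<bullet> v))"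

lemma eigenvalue_ge_1: "eigenvector e l \<Longrightarrow> 1 \<le> l"
  using coercive[of e] by (auto simp: eigenvector_def)

text \<open>g is the weak solution of A g = u; coercivity turns the bound of v -> u \<bullet> v in
  the norm of H into a bound in the form.\<close>

lemma inner_representation:
  assumes "u \<in> H"
  obtains g where "g \<in> V" "\<And>v. v \<in> V \<Longrightarrow> a g v = u \<bullet> v"
proof (rule V.Riesz_representation[of "\<lambda>v. u \<bullet> v" "u \<bullet> u"])
  show "(u \<bullet> v)\<^sup>2 \<le> (u \<bullet> u) * a v v" if "v \<in> V" for v
    by (rule order_trans[OF Cauchy_Schwarz_ineq])
       (use coercive that in \<open>auto intro: mult_left_mono\<close>)
qed (auto simp: inner_add_right that)

text \<open>A Rayleigh maximizer u on the complement W of S satisfies its equation only against W.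
  The weak solution g for u is again orthogonal to S, because S consists of eigenvectors. So m u - g
  lies in W, has form value 0 and vanishes, and the equation extends to all of V.\<close>

lemma eigenvector_orthogonal_to:
  assumes S: "\<And>e. e \<in> S \<Longrightarrow> \<exists>l. eigenvector e l"
    and w: "w \<in> V" "w \<noteq> 0" "\<And>e. e \<in> S \<Longrightarrow> w \<bullet> e = 0"
  obtains u l where "eigenvector u l" "\<And>e. e \<in> S \<Longrightarrow> u \<bullet> e = 0"
proof -
  define W where "W = {v \<in> V. \<forall>e\<in>S. v \<bullet> e = 0}"
  have W: "subspace W"
    unfolding W_def using V.subspace by (auto simp: subspace_def inner_add_left)
  have "x \<in> W" if X: "\<And>n. X n \<in> W" and x: "x \<in> V"
    and lim: "(\<lambda>n::nat. a (X n - x) (X n - x)) \<longlonglongrightarrow> 0" for X x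
  proof -
    have "x \<bullet> e = 0" if e: "e \<in> S" for e
    proof -
      have eH: "e \<in> H" using S[OF e] V_into_H by (auto simp: eigenvector_def)
      have "(\<lambda>n. X n \<bullet> e) \<longlonglongrightarrow> x \<bullet> e"
        by (rule H.tendsto_form_left[OF _ _ eH form_tendsto_imp_inner_tendsto[OF _ x lim]])
           (use X x V_into_H in \<open>auto simp: W_def\<close>)
      then show ?thesis using X e by (simp add: W_def LIMSEQ_const_iff)
    qed
    then show ?thesis using x by (simp add: W_def)
  qed
  moreover have "W \<subseteq> V" "w \<in> W" using w by (auto simp: W_def)
  ultimately obtain u m where u: "u \<in> W" "u \<noteq> 0" "0 < m" "\<And>w. w \<in> W \<Longrightarrow> m * a u w = u \<bullet> w"
    using Rayleigh_maximizer[OF W _ _ w(2)] by blast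
  have uV: "u \<in> V" "u \<in> H" using u(1) V_into_H by (auto simp: W_def)
  obtain g where g: "g \<in> V" "\<And>v. v \<in> V \<Longrightarrow> a g v = u \<bullet> v"
    using inner_representation[OF uV(2)] by blast
  have "g \<bullet> e = 0" if e: "e \<in> S" for e
  proof -
    obtain l where l: "eigenvector e l" using S[OF e] by blast
    have "l * (e \<bullet> g) = a g e"
      using l g(1) V.sym[of e g] by (simp add: eigenvector_def)
    also have "\<dots> = 0" using g(2)[of e] l u(1) e by (auto simp: eigenvector_def W_def)
    finally show ?thesis using eigenvalue_ge_1[OF l] by (auto simp: inner_commute)
  qed
  then have gW: "g \<in> W" using g(1) by (simp add: W_def)
  let ?d = "m *\<^sub>R u - g"
  have d: "?d \<in> W" using subspace_diff[OF W subspace_scale[OF W u(1)] gW] .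
  then have dV: "?d \<in> V" by (simp add: W_def)
  have "a ?d ?d = m * a u ?d - a g ?d"
    using dV uV g(1) by (simp add: V.diff_left V.scale_left)
  also have "\<dots> = 0" using u(4)[OF d] g(2)[OF dV] by simp
  finally have "?d = 0" using V.eq_zero[OF dV] by blast
  then have mu: "m * a u v = u \<bullet> v" if "v \<in> V" for v
    using g(2)[OF that] V.scale_left[OF uV(1) that, of m] by simp
  define c where "c = 1 / norm u"
  have "eigenvector (c *\<^sub>R u) (1 / m)"
    unfolding eigenvector_def using u(2,3) uV mu
    by (auto simp: c_def V.scale_left power2_norm_eq_inner[symmetric] power2_eq_square field_simps)
  moreover have "(c *\<^sub>R u) \<bullet> e = 0" if "e \<in> S" for e
    using u(1) that by (simp add: W_def)
  ultimately show ?thesis using that by blast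
qed

text \<open>Zorn's lemma replaces the inductive listing of eigenvalues, so S is an unordered set.
  Maximality only annihilates vectors of V orthogonal to S. For u in H, orthogonality passes to its
  weak solution g in V; hence g = 0, and density gives u = 0.\<close>

theorem exists_eigenbasis:
  obtains S l where "\<And>e. e \<in> S \<Longrightarrow> eigenvector e (l e)" "orthonormal_basis H inner S (\<lambda>e. e)"
proof -
  define A where "A = {S. (\<forall>e\<in>S. \<exists>l. eigenvector e l) \<and> (\<forall>e\<in>S. \<forall>f\<in>S. e \<noteq> f \<longrightarrow> e \<bullet> f = 0)}"
  have "\<exists>M\<in>A. \<forall>X\<in>A. M \<subseteq> X \<longrightarrow> X = M"
  proof (rule subset_Zorn')
    fix C assume C: "subset.chain A C"
    have "e \<bullet> f = 0" if ef: "X \<in> C" "Y \<in> C" "e \<in> X" "f \<in> Y" "e \<noteq> f" for X Y e f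
    proof -
      have "X \<subseteq> Y \<or> Y \<subseteq> X" using C ef by (auto simp: subset.chain_def)
      moreover have "X \<in> A" "Y \<in> A" using C ef by (auto simp: subset.chain_def)
      ultimately show ?thesis using ef unfolding A_def by blast
    qed
    moreover have "\<exists>l. eigenvector e l" if "X \<in> C" "e \<in> X" for X e
    proof -
      have "X \<in> A" using C that by (auto simp: subset.chain_def)
      then show ?thesis using that by (simp add: A_def)
    qed
    ultimately show "\<Union>C \<in> A"
      unfolding A_def by simp
  qed
  then obtain S where S: "S \<in> A" "\<And>X. X \<in> A \<Longrightarrow> S \<subseteq> X \<Longrightarrow> X = S" by blast
  then obtain l where l: "\<And>e. e \<in> S \<Longrightarrow> eigenvector e (l e)"
    unfolding A_def by simp metis
  have V_zero: "w = 0" if w: "w \<in> V" "\<And>e. e \<in> S \<Longrightarrow> w \<bullet> e = 0" for w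
  proof (rule ccontr)
    assume "w \<noteq> 0"
    then obtain u k where u: "eigenvector u k" "\<And>e. e \<in> S \<Longrightarrow> u \<bullet> e = 0"
      using eigenvector_orthogonal_to[of S w] l w by blast
    have "insert u S \<in> A"
      using S(1) u by (auto simp: A_def inner_commute)
    then have "u \<in> S" using S(2)[of "insert u S"] by auto
    then show False using u by (auto simp: eigenvector_def)
  qed
  have "orthonormal_basis H inner S (\<lambda>e. e)"
  proof
    show "e \<in> H" if "e \<in> S" for e using l[OF that] V_into_H by (auto simp: eigenvector_def)
    show "e \<bullet> f = (if e = f then 1 else 0)" if "e \<in> S" "f \<in> S" for e f
      using S(1) that l[OF that(1)] by (auto simp: A_def eigenvector_def)
    show "u = 0" if u: "u \<in> H" "\<And>e. e \<in> S \<Longrightarrow> u \<bullet> e = 0" for u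
    proof -
      obtain g where g: "g \<in> V" "\<And>v. v \<in> V \<Longrightarrow> a g v = u \<bullet> v"
        using inner_representation[OF u(1)] by blast
      have "g \<bullet> e = 0" if e: "e \<in> S" for e
      proof -
        have "l e * (e \<bullet> g) = a g e"
          using l[OF e] g(1) V.sym[of e g] by (simp add: eigenvector_def)
        also have "\<dots> = 0" using g(2)[of e] l[OF e] u(2)[OF e] by (auto simp: eigenvector_def)
        finally show ?thesis using eigenvalue_ge_1[OF l[OF e]] by (auto simp: inner_commute)
      qed
      then have "g = 0" using V_zero[OF g(1)] by blast
      then show ?thesis using dense[OF u(1)] g(2) by simp
    qed
  qed
  then show ?thesis using that l by blast
qed

end

section \<open>Diagonal description of the form and of its operator\<close>

text \<open>Compactness has done its work at this point: everything that follows about the operators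
  uses only the basis S and the eigenvalues l.\<close>

locale form_eigenbasis = H: orthonormal_basis H inner S "\<lambda>e. e" + V: hilbert_form V a
  for H V :: "'h::real_inner set" and a and S +
  fixes l :: "'h \<Rightarrow> real"
  assumes V_subset: "V \<subseteq> H" and S_subset: "S \<subseteq> V"
    and eigenvalue_ge_1: "\<And>e. e \<in> S \<Longrightarrow> 1 \<le> l e"
    and eigen: "\<And>e v. e \<in> S \<Longrightarrow> v \<in> V \<Longrightarrow> a e v = l e * (e \<bullet> v)"

text \<open>Eigenvectors are orthogonal in both forms and a e e = l e, so dividing by sqrt (l e)
  normalizes them in V. Parseval and Riesz-Fischer thereby become available for the energy form as
  well.\<close>

sublocale form_eigenbasis \<subseteq> scaled: orthonormal_basis V a S "\<lambda>e. (1 / sqrt (l e)) *\<^sub>R e"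
proof
  have SV: "e \<in> V" if "e \<in> S" for e using that S_subset by auto
  have lp: "0 < l e" if "e \<in> S" for e using eigenvalue_ge_1[OF that] by simp
  show "(1 / sqrt (l e)) *\<^sub>R e \<in> V" if "e \<in> S" for e using SV[OF that] by auto
  show "a ((1 / sqrt (l e)) *\<^sub>R e) ((1 / sqrt (l f)) *\<^sub>R f) = (if e = f then 1 else 0)"
    if "e \<in> S" "f \<in> S" for e f
    using that H.orthonormal[OF that] lp[OF that(1)]
    by (auto simp: V.scale_left V.scale_right SV eigen field_simps)
  show "u = 0" if u: "u \<in> V" "\<And>e. e \<in> S \<Longrightarrow> a u ((1 / sqrt (l e)) *\<^sub>R e) = 0" for u
  proof (rule H.total)
    show "u \<in> H" using u V_subset by auto
    show "u \<bullet> e = 0" if e: "e \<in> S" for e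
      using u(2)[OF e] u(1) e lp[OF e] SV[OF e] V.sym[of u e]
      by (auto simp: V.scale_right eigen inner_commute)
  qed
qed

context form_eigenbasis begin

lemma coeff_scaled:
  assumes "u \<in> V" "e \<in> S"
  shows "a u ((1 / sqrt (l e)) *\<^sub>R e) = sqrt (l e) * (u \<bullet> e)"
proof -
  have e: "e \<in> V" "0 < l e" using assms S_subset eigenvalue_ge_1[of e] by auto
  have "a u e = l e * (u \<bullet> e)"
    using V.sym[OF assms(1) e(1)] eigen[OF assms(2,1)] by (simp add: inner_commute)
  then show ?thesis
    using assms e real_sqrt_mult_self[of "l e"] by (simp add: V.scale_right field_simps)
qed

lemma form_has_sum:
  assumes "u \<in> V" "v \<in> V"
  shows "((\<lambda>e. l e * (u \<bullet> e) * (v \<bullet> e)) has_sum a u v) S"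
proof -
  have "a u ((1 / sqrt (l e)) *\<^sub>R e) * a v ((1 / sqrt (l e)) *\<^sub>R e) = l e * (u \<bullet> e) * (v \<bullet> e)" if "e \<in> S" for e
    using eigenvalue_ge_1[OF that] that assms by (simp add: coeff_scaled mult_ac)
  then show ?thesis
    using scaled.Parseval[OF assms] by (simp cong: has_sum_cong)
qed

text \<open>Riesz-Fischer in V produces an element with the energy coefficients of u. Its
  coefficients in H agree with those of u, so it is u.\<close>

lemma mem_form_domain:
  assumes u: "u \<in> H" and summ: "(\<lambda>e. l e * (u \<bullet> e)\<^sup>2) summable_on S"
  shows "u \<in> V"
proof -
  have "(sqrt (l e) * (u \<bullet> e))\<^sup>2 = l e * (u \<bullet> e)\<^sup>2" if "e \<in> S" for e
    using eigenvalue_ge_1[OF that] by (simp add: power_mult_distrib)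
  then have "(\<lambda>e. (sqrt (l e) * (u \<bullet> e))\<^sup>2) summable_on S"
    using summ by (simp cong: summable_on_cong)
  then obtain v where v: "v \<in> V" "\<And>e. e \<in> S \<Longrightarrow> a v ((1 / sqrt (l e)) *\<^sub>R e) = sqrt (l e) * (u \<bullet> e)"
    by (rule scaled.Riesz_Fischer) blast
  have "v \<bullet> e = u \<bullet> e" if "e \<in> S" for e
    using v(2)[OF that] coeff_scaled[OF v(1) that] eigenvalue_ge_1[OF that] by simp
  then have "v = u" using H.eqI[of v u] v(1) u V_subset by auto
  then show ?thesis using v by simp
qed

lemma form_op_representative_coeff:
  assumes u: "u \<in> V" and f: "f \<in> H" "\<And>v. v \<in> V \<Longrightarrow> a u v = f \<bullet> v" and e: "e \<in> S"
  shows "f \<bullet> e = l e * (u \<bullet> e)"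
  using f(2)[of e] e S_subset V.sym[of u e] u eigen by (auto simp: inner_commute)

lemma form_op_dom_eq:
  "form_op_dom H V a = {u \<in> H. (\<lambda>e. (l e * (u \<bullet> e))\<^sup>2) summable_on S}"
proof safe
  fix u assume "u \<in> form_op_dom H V a"
  then obtain f where f: "u \<in> V" "f \<in> H" "\<And>v. v \<in> V \<Longrightarrow> a u v = f \<bullet> v"
    by (auto simp: form_op_dom_def)
  then show "u \<in> H" using V_subset by auto
  have "(\<lambda>e. (f \<bullet> e)\<^sup>2) summable_on S" by (rule H.Bessel_summable) fact
  then show "(\<lambda>e. (l e * (u \<bullet> e))\<^sup>2) summable_on S"
    using form_op_representative_coeff[OF f] by (simp cong: summable_on_cong)
next
  fix u assume u: "u \<in> H" and summ: "(\<lambda>e. (l e * (u \<bullet> e))\<^sup>2) summable_on S"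
  \<comment> \<open>As l e >= 1, summability with weight l^2 implies summability with weight l,
    which is membership in V.\<close>
  have "(\<lambda>e. l e * (u \<bullet> e)\<^sup>2) summable_on S"
  proof (rule summable_on_comparison_test[OF summ])
    fix e assume e: "e \<in> S"
    have "1 * (l e * (u \<bullet> e)\<^sup>2) \<le> l e * (l e * (u \<bullet> e)\<^sup>2)"
      using eigenvalue_ge_1[OF e] by (intro mult_right_mono) auto
    then show "l e * (u \<bullet> e)\<^sup>2 \<le> (l e * (u \<bullet> e))\<^sup>2" by (simp add: power2_eq_square mult_ac)
    show "0 \<le> l e * (u \<bullet> e)\<^sup>2" using eigenvalue_ge_1[OF e] by simp
  qed
  then have uV: "u \<in> V" by (rule mem_form_domain[OF u])
  obtain f where f: "f \<in> H" "\<And>e. e \<in> S \<Longrightarrow> f \<bullet> e = l e * (u \<bullet> e)"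
    using H.Riesz_Fischer[OF summ] by blast
  have "a u v = f \<bullet> v" if v: "v \<in> V" for v
  proof -
    have "((\<lambda>e. (f \<bullet> e) * (v \<bullet> e)) has_sum f \<bullet> v) S"
      using H.Parseval f(1) v V_subset by auto
    then have "((\<lambda>e. l e * (u \<bullet> e) * (v \<bullet> e)) has_sum f \<bullet> v) S"
      using f(2) by (simp cong: has_sum_cong)
    then show ?thesis using form_has_sum[OF uV v] by (metis infsumI)
  qed
  then show "u \<in> form_op_dom H V a" using uV f(1) by (auto simp: form_op_dom_def)
qed

lemma form_op_coeff:
  assumes "u \<in> form_op_dom H V a"
  shows "form_op H V a u \<in> H" "\<And>e. e \<in> S \<Longrightarrow> form_op H V a u \<bullet> e = l e * (u \<bullet> e)"
proof -
  obtain f where f: "u \<in> V" "f \<in> H" "\<And>v. v \<in> V \<Longrightarrow> a u v = f \<bullet> v"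
    using assms by (auto simp: form_op_dom_def)
  have "form_op H V a u = f"
    unfolding form_op_def
  proof (rule the_equality)
    fix g assume g: "g \<in> H \<and> (\<forall>v\<in>V. a u v = g \<bullet> v)"
    then have "g \<bullet> e = f \<bullet> e" if "e \<in> S" for e
      using form_op_representative_coeff[OF f that] form_op_representative_coeff[OF f(1) _ _ that, of g]
      by simp
    then show "g = f" using g f(2) by (intro H.eqI) auto
  qed (use f in auto)
  then show "form_op H V a u \<in> H" "\<And>e. e \<in> S \<Longrightarrow> form_op H V a u \<bullet> e = l e * (u \<bullet> e)"
    using f form_op_representative_coeff[OF f] by auto
qed

end

section \<open>Functional calculus of diagonal operators\<close>

lemma summable_on_square_add:
  fixes f g :: "'i \<Rightarrow> real"
  assumes "(\<lambda>i. (f i)\<^sup>2) summable_on I" "(\<lambda>i. (g i)\<^sup>2) summable_on I"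
  shows "(\<lambda>i. (f i + g i)\<^sup>2) summable_on I"
proof -
  have "(\<lambda>i. (f i)\<^sup>2 + (g i)\<^sup>2 + 2 * (f i * g i)) summable_on I"
    using summable_on_mult_of_squares[OF assms] assms
    by (intro summable_on_add summable_on_cmult_right)
  then show ?thesis by (simp add: power2_sum mult.assoc)
qed

lemma summable_on_square_diff:
  fixes f g :: "'i \<Rightarrow> real"
  assumes "(\<lambda>i. (f i)\<^sup>2) summable_on I" "(\<lambda>i. (g i)\<^sup>2) summable_on I"
  shows "(\<lambda>i. (f i - g i)\<^sup>2) summable_on I"
  using summable_on_square_add[of f I "\<lambda>i. - g i"] assms by simp

lemma infsum_diff_eq:
  fixes f g :: "'i \<Rightarrow> real"
  assumes "f summable_on I" "g summable_on I"
  shows "(\<Sum>\<^sub>\<infinity>i\<in>I. f i - g i) = infsum f I - infsum g I"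
  using infsum_add[of f I "\<lambda>i. - g i"] assms by (simp add: infsum_uminus summable_on_uminus)

text \<open>Makes dominated convergence, densities and image measures applicable to the unordered
  sums over S.\<close>

lemma integrable_count_space_iff_summable_on:
  fixes f :: "'i \<Rightarrow> real"
  shows "integrable (count_space S) f \<longleftrightarrow> f summable_on S"
  by (metis Infinite_Set_Sum.abs_summable_on_def abs_summable_equivalent
      summable_on_iff_abs_summable_on_real)

lemma integral_count_space_eq_infsum:
  fixes f :: "'i \<Rightarrow> real"
  assumes "f summable_on S"
  shows "integral\<^sup>L (count_space S) f = infsum f S"
proof -
  have "Infinite_Set_Sum.abs_summable_on f S"
    using assms abs_summable_equivalent summable_on_iff_abs_summable_on_real by blast
  then show ?thesis by (simp add: infsetsum_infsum[symmetric] infsetsum_def)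
qed

section \<open>Spectral integrals of an arbitrary projection-valued measure\<close>

text \<open>E is arbitrary because \<open>spectral_measure\<close> is a \<open>SOME\<close>: it is
  only known to be some spectral measure, so its action on eigenvectors has to be derived from the
  axioms.\<close>

locale pvm = hilbert_form H inner for H :: "'h::real_inner set" +
  fixes E :: "real set \<Rightarrow> 'h \<Rightarrow> 'h"
  assumes pvm: "projection_valued_measure H E"
begin

abbreviation \<mu> :: "'h \<Rightarrow> real measure" where "\<mu> \<equiv> spectral_scalar_measure E"

lemma E_mem [simp, intro]: "A \<in> sets borel \<Longrightarrow> u \<in> H \<Longrightarrow> E A u \<in> H"
  using pvm by (auto simp: projection_valued_measure_def orth_proj_on_def)

lemma E_sym: "A \<in> sets borel \<Longrightarrow> u \<in> H \<Longrightarrow> v \<in> H \<Longrightarrow> E A u \<bullet> v = u \<bullet> E A v"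
  using pvm by (auto simp: projection_valued_measure_def orth_proj_on_def)

lemma E_Int: "A \<in> sets borel \<Longrightarrow> B \<in> sets borel \<Longrightarrow> u \<in> H \<Longrightarrow> E (A \<inter> B) u = E A (E B u)"
  using pvm by (auto simp: projection_valued_measure_def)

lemma E_UNIV: "u \<in> H \<Longrightarrow> E UNIV u = u"
  using pvm by (auto simp: projection_valued_measure_def)

lemma E_sums:
  "range A \<subseteq> sets borel \<Longrightarrow> disjoint_family A \<Longrightarrow> u \<in> H \<Longrightarrow> (\<lambda>i::nat. E (A i) u) sums E (\<Union>i. A i) u"
  using pvm by (auto simp: projection_valued_measure_def)

lemma inner_eqI:
  assumes "u \<in> H" "v \<in> H" "\<And>z. z \<in> H \<Longrightarrow> u \<bullet> z = v \<bullet> z"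
  shows "u = v"
proof -
  have "(u - v) \<bullet> (u - v) = 0" using assms(3)[of "u - v"] assms(1,2) by (simp add: inner_diff_left)
  then show ?thesis by simp
qed

lemma E_add: "A \<in> sets borel \<Longrightarrow> u \<in> H \<Longrightarrow> v \<in> H \<Longrightarrow> E A (u + v) = E A u + E A v"
  by (rule inner_eqI) (auto simp: E_sym inner_add_left)

lemma E_diff: "A \<in> sets borel \<Longrightarrow> u \<in> H \<Longrightarrow> v \<in> H \<Longrightarrow> E A (u - v) = E A u - E A v"
  by (rule inner_eqI) (auto simp: E_sym inner_diff_left)

text \<open>Countable additivity for the constant sequence of empty sets makes a constant series
  converge, so its terms are 0.\<close>

lemma E_empty: "u \<in> H \<Longrightarrow> E {} u = 0"
proof -
  assume "u \<in> H"
  then have "(\<lambda>i::nat. E {} u) sums E {} u"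
    using E_sums[of "\<lambda>_. {}" u] by (simp add: disjoint_family_on_def)
  then have "(\<lambda>i::nat. E {} u) \<longlonglongrightarrow> 0" by (intro summable_LIMSEQ_zero) (rule sums_summable)
  then show ?thesis by (simp add: LIMSEQ_const_iff)
qed

lemma E_Compl:
  assumes A: "A \<in> sets borel" and u: "u \<in> H"
  shows "E A u + E (- A) u = u"
proof -
  \<comment> \<open>Finite additivity is countable additivity for the sequence A, - A, {}, {},
    ...\<close>
  have "(\<lambda>i. E (binaryset A (- A) i) u) sums E (\<Union>i. binaryset A (- A) i) u"
    by (rule E_sums) (use A u in \<open>auto simp: binaryset_def disjoint_family_on_def\<close>)
  moreover have "(\<lambda>i. E (binaryset A (- A) i) u) sums (\<Sum>i<2. E (binaryset A (- A) i) u)"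
    by (rule sums_finite) (auto simp: binaryset_def E_empty u)
  ultimately have "E (\<Union>i. binaryset A (- A) i) u = (\<Sum>i<2. E (binaryset A (- A) i) u)"
    by (rule sums_unique2)
  then show ?thesis by (simp add: UN_binaryset_eq numeral_2_eq_2 binaryset_def E_UNIV u)
qed

lemma E_inner_E:
  assumes "A \<in> sets borel" "B \<in> sets borel" "u \<in> H" "v \<in> H"
  shows "E A u \<bullet> E B v = E (A \<inter> B) u \<bullet> v"
  using assms E_sym[of B "E A u" v] E_Int[of B A u] by (simp add: Int_commute)

lemma E_nonneg: "A \<in> sets borel \<Longrightarrow> u \<in> H \<Longrightarrow> 0 \<le> E A u \<bullet> u"
  using E_inner_E[of A A u u] inner_ge_zero[of "E A u"] by simp

lemma sets_\<mu> [measurable_cong]: "sets (\<mu> u) = sets borel"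
  using sets.sigma_sets_eq[of "borel :: real measure"]
  by (simp add: spectral_scalar_measure_def)

lemma space_\<mu> [simp]: "space (\<mu> u) = UNIV"
  by (simp add: spectral_scalar_measure_def)

lemma emeasure_\<mu>:
  assumes u: "u \<in> H" and A: "A \<in> sets borel"
  shows "emeasure (\<mu> u) A = ennreal (E A u \<bullet> u)"
  unfolding spectral_scalar_measure_def
proof (rule emeasure_measure_of_sigma[OF _ _ _ A])
  show "sigma_algebra UNIV (sets (borel :: real measure))"
    using sets.sigma_algebra_axioms[of "borel :: real measure"] by simp
  show "positive (sets borel) (\<lambda>A. ennreal (E A u \<bullet> u))"
    using u by (simp add: positive_def E_empty)
  show "countably_additive (sets borel) (\<lambda>A. ennreal (E A u \<bullet> u))"
  proof (rule countably_additiveI)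
    fix B :: "nat \<Rightarrow> real set"
    assume B: "range B \<subseteq> sets borel" "disjoint_family B"
    show "(\<Sum>i. ennreal (E (B i) u \<bullet> u)) = ennreal (E (\<Union>i. B i) u \<bullet> u)"
    proof (rule suminf_ennreal_eq)
      show "0 \<le> E (B i) u \<bullet> u" for i using B u by (intro E_nonneg) auto
      show "(\<lambda>i. E (B i) u \<bullet> u) sums (E (\<Union>i. B i) u \<bullet> u)"
        using bounded_linear.sums[OF bounded_linear_inner_left E_sums[OF B u]] .
    qed
  qed
qed

lemma finite_\<mu>: "u \<in> H \<Longrightarrow> finite_measure (\<mu> u)"
  by (rule finite_measureI) (simp add: emeasure_\<mu>)

lemma measure_\<mu>: "u \<in> H \<Longrightarrow> A \<in> sets borel \<Longrightarrow> measure (\<mu> u) A = E A u \<bullet> u"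
  by (simp add: measure_def emeasure_\<mu> E_nonneg)

text \<open>The origin of the division by 4 in \<open>spectral_integral\<close>.\<close>

lemma E_polarization:
  assumes "A \<in> sets borel" "u \<in> H" "z \<in> H"
  shows "E A (u + z) \<bullet> (u + z) - E A (u - z) \<bullet> (u - z) = 4 * (E A u \<bullet> z)"
  using assms E_sym[of A z u]
  by (simp add: E_add E_diff inner_simps inner_commute[of z])

text \<open>The operator integral of a simple function against E, from which the general integral is
  obtained by L^2 limits.\<close>

definition simple_op :: "(real \<Rightarrow> real) \<Rightarrow> 'h \<Rightarrow> 'h" where
  "simple_op s u = (\<Sum>c\<in>range s. c *\<^sub>R E (s -` {c}) u)"

lemma simple_function_borelD:
  fixes s :: "real \<Rightarrow> real"
  assumes "simple_function (borel :: real measure) s"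
  shows "finite (range s)" "s -` {c} \<in> sets borel"
  using simple_functionD[OF assms] by auto

lemma simple_function_sum_indicator:
  fixes s :: "real \<Rightarrow> real"
  assumes "simple_function (borel :: real measure) s"
  shows "s x = (\<Sum>c\<in>range s. c * indicator (s -` {c}) x)"
proof -
  have "(\<Sum>c\<in>range s. c * indicator (s -` {c}) x) = (\<Sum>c\<in>range s. if c = s x then c else 0)"
    by (rule sum.cong) (auto simp: indicator_def)
  then show ?thesis using simple_function_borelD(1)[OF assms] by simp
qed

lemma integrable_indicator_\<mu>:
  "u \<in> H \<Longrightarrow> A \<in> sets borel \<Longrightarrow> integrable (\<mu> u) (indicator A :: real \<Rightarrow> real)"
  by (rule integrable_real_indicator) (auto simp: sets_\<mu> emeasure_\<mu>)

lemma integral_simple_function: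
  fixes s :: "real \<Rightarrow> real"
  assumes s: "simple_function borel s" and u: "u \<in> H"
  shows "integral\<^sup>L (\<mu> u) s = (\<Sum>c\<in>range s. c * (E (s -` {c}) u \<bullet> u))"
proof -
  have "integral\<^sup>L (\<mu> u) s = (\<integral>x. (\<Sum>c\<in>range s. c * indicator (s -` {c}) x) \<partial>\<mu> u)"
    by (rule Bochner_Integration.integral_cong[OF refl simple_function_sum_indicator[OF s]])
  also have "\<dots> = (\<Sum>c\<in>range s. c * (E (s -` {c}) u \<bullet> u))"
    using s u by (subst Bochner_Integration.integral_sum)
      (auto simp: integrable_indicator_\<mu> measure_\<mu> simple_function_borelD(2))
  finally show ?thesis .
qed

lemma simple_op_mem: "simple_function borel s \<Longrightarrow> u \<in> H \<Longrightarrow> simple_op s u \<in> H"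
  unfolding simple_op_def by (intro mem_sum mem_scale E_mem simple_function_borelD(2))

lemma simple_op_inner:
  assumes s: "simple_function borel s" and u: "u \<in> H" and z: "z \<in> H"
  shows "simple_op s u \<bullet> z = (integral\<^sup>L (\<mu> (u + z)) s - integral\<^sup>L (\<mu> (u - z)) s) / 4"
proof -
  have "4 * (simple_op s u \<bullet> z) = (\<Sum>c\<in>range s. c * (4 * (E (s -` {c}) u \<bullet> z)))"
    by (simp add: simple_op_def inner_sum_left sum_distrib_left mult_ac)
  also have "\<dots> = (\<Sum>c\<in>range s. c * (E (s -` {c}) (u + z) \<bullet> (u + z)) - c * (E (s -` {c}) (u - z) \<bullet> (u - z)))"
    by (intro sum.cong refl) (simp add: E_polarization[OF simple_function_borelD(2)[OF s] u z, symmetric] right_diff_distrib)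
  also have "\<dots> = integral\<^sup>L (\<mu> (u + z)) s - integral\<^sup>L (\<mu> (u - z)) s"
    using u z by (simp add: sum_subtractf integral_simple_function[OF s])
  finally show ?thesis by simp
qed

text \<open>In polarized form, the isometry from L^2 of \<open>\<mu> u\<close> into H. Products of
  projections become projections on intersections of level sets.\<close>

lemma simple_op_inner_simple_op:
  assumes s: "simple_function borel s" and s': "simple_function borel s'" and u: "u \<in> H"
  shows "integrable (\<mu> u) (\<lambda>x. s x * s' x)"
    and "simple_op s u \<bullet> simple_op s' u = (\<integral>x. s x * s' x \<partial>\<mu> u)"
proof -
  let ?I = "\<lambda>c d. indicator (s -` {c} \<inter> s' -` {d}) :: real \<Rightarrow> real"
  have mem: "s -` {c} \<inter> s' -` {d} \<in> sets borel" for c d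
    using simple_function_borelD(2)[OF s] simple_function_borelD(2)[OF s'] by auto
  have eq: "s x * s' x = (\<Sum>c\<in>range s. \<Sum>d\<in>range s'. c * d * ?I c d x)" for x
    by (subst simple_function_sum_indicator[OF s], subst simple_function_sum_indicator[OF s'])
       (simp add: sum_product indicator_inter_arith mult_ac)
  show "integrable (\<mu> u) (\<lambda>x. s x * s' x)"
    unfolding eq using u mem by (intro Bochner_Integration.integrable_sum integrable_mult_right) (auto intro: integrable_indicator_\<mu>)
  have "simple_op s u \<bullet> simple_op s' u = (\<Sum>c\<in>range s. \<Sum>d\<in>range s'. c * d * (E (s -` {c} \<inter> s' -` {d}) u \<bullet> u))"
    unfolding simple_op_def[of s] inner_sum_left
    by (simp add: simple_op_def inner_sum_right sum_distrib_left mult_ac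
        E_inner_E[OF simple_function_borelD(2)[OF s] simple_function_borelD(2)[OF s'] u u])
  also have "\<dots> = (\<integral>x. s x * s' x \<partial>\<mu> u)"
    unfolding eq using u mem
    by (subst Bochner_Integration.integral_sum; (intro sum.cong refl Bochner_Integration.integrable_sum)?)
       (auto simp: Bochner_Integration.integral_sum integrable_indicator_\<mu> measure_\<mu>)
  finally show "simple_op s u \<bullet> simple_op s' u = (\<integral>x. s x * s' x \<partial>\<mu> u)" .
qed

lemma integrable_of_square_integrable:
  fixes f :: "real \<Rightarrow> real"
  assumes "u \<in> H" "f \<in> borel_measurable borel" "integrable (\<mu> u) (\<lambda>x. (f x)\<^sup>2)"
  shows "integrable (\<mu> u) f"
  using finite_measure.square_integrable_imp_integrable[OF finite_\<mu>[OF assms(1)], of f] assms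
  by (simp add: measurable_cong_sets[OF sets_\<mu> refl])

text \<open>Simple functions converging to f in L^2 of \<open>\<mu> u\<close> have Cauchy images by
  the isometry. Their limit inherits the polarized formula, and also the values of v \<bullet> u and
  v \<bullet> v on which the eigenvector argument rests. Closure of the domain under u + z and u - z
  makes f integrable for both polarizing measures.\<close>

lemma spectral_integral_exists:
  assumes u: "u \<in> spectral_integral_dom H E f" and f: "f \<in> borel_measurable borel"
    and dom: "\<And>z. z \<in> spectral_integral_dom H E f \<Longrightarrow> u + z \<in> spectral_integral_dom H E f"
      "\<And>z. z \<in> spectral_integral_dom H E f \<Longrightarrow> u - z \<in> spectral_integral_dom H E f"
  obtains v where "v \<in> H" "\<And>z. z \<in> spectral_integral_dom H E f \<Longrightarrow>
      v \<bullet> z = (integral\<^sup>L (\<mu> (u + z)) f - integral\<^sup>L (\<mu> (u - z)) f) / 4"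
    "v \<bullet> u = integral\<^sup>L (\<mu> u) f" "v \<bullet> v = (\<integral>x. (f x)\<^sup>2 \<partial>\<mu> u)"
proof -
  let ?D = "spectral_integral_dom H E f"
  have D: "z \<in> H" "integrable (\<mu> z) (\<lambda>x. (f x)\<^sup>2)" "integrable (\<mu> z) f" if "z \<in> ?D" for z
    using that integrable_of_square_integrable[OF _ f] by (auto simp: spectral_integral_dom_def)
  obtain s where s: "\<And>i. simple_function borel (s i)" "\<And>x. (\<lambda>i. s i x) \<longlonglongrightarrow> f x"
      "\<And>i x. \<bar>s i x\<bar> \<le> 2 * \<bar>f x\<bar>"
    using borel_measurable_implies_sequence_metric[OF f, of 0] by auto
  have s_meas [measurable]: "s i \<in> borel_measurable borel" for i
    using s(1) by (rule borel_measurable_simple_function)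
  note f [measurable]
  define v where "v i = simple_op (s i) u" for i
  have vH: "v i \<in> H" for i unfolding v_def using s(1) D(1)[OF u] by (rule simple_op_mem)
  define g where "g i = 2 * (\<integral>x. (s i x - f x)\<^sup>2 \<partial>\<mu> u)" for i
  \<comment> \<open>9 = (1 + 2)^2 since |s i| <= 2 |f|; this is the dominating function for the L^2
    convergence of s i to f.\<close>
  have le: "(s i x - f x)\<^sup>2 \<le> 9 * (f x)\<^sup>2" for i x
  proof -
    have "\<bar>s i x - f x\<bar> \<le> 3 * \<bar>f x\<bar>" using s(3)[of i x] by linarith
    from power_mono[OF this, of 2] show ?thesis by (simp add: power_mult_distrib)
  qed
  have "(\<lambda>i. \<integral>x. (s i x - f x)\<^sup>2 \<partial>\<mu> u) \<longlonglongrightarrow> (\<integral>x. 0 \<partial>\<mu> u)"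
  proof (rule integral_dominated_convergence[where w = "\<lambda>x. 9 * (f x)\<^sup>2"])
    show "AE x in \<mu> u. (\<lambda>i. (s i x - f x)\<^sup>2) \<longlonglongrightarrow> 0"
    proof (rule AE_I2)
      fix x
      have "(\<lambda>i. (s i x - f x)\<^sup>2) \<longlonglongrightarrow> (f x - f x)\<^sup>2" by (intro tendsto_intros s)
      then show "(\<lambda>i. (s i x - f x)\<^sup>2) \<longlonglongrightarrow> 0" by simp
    qed
  qed (use D(2)[OF u] le in auto)
  then have g: "g \<longlonglongrightarrow> 0" unfolding g_def using tendsto_mult_left[of _ 0 sequentially 2] by simp
  have int_sf: "integrable (\<mu> u) (\<lambda>x. (s i x - f x)\<^sup>2)" for i
  proof (rule Bochner_Integration.integrable_bound)
    show "integrable (\<mu> u) (\<lambda>x. 9 * (f x)\<^sup>2)" using D(2)[OF u] by simp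
  qed (use le in auto)
  have diff_le: "(v i - v j) \<bullet> (v i - v j) \<le> g i + g j" for i j
  proof -
    note op = simple_op_inner_simple_op[OF s(1) s(1) D(1)[OF u]]
    have "(v i - v j) \<bullet> (v i - v j) = v i \<bullet> v i - 2 * (v i \<bullet> v j) + v j \<bullet> v j"
      by (simp add: inner_simps inner_commute)
    also have "\<dots> = (\<integral>x. s i x * s i x - 2 * (s i x * s j x) + s j x * s j x \<partial>\<mu> u)"
      unfolding v_def op(2) using op(1) by simp
    also have "\<dots> \<le> (\<integral>x. 2 * (s i x - f x)\<^sup>2 + 2 * (s j x - f x)\<^sup>2 \<partial>\<mu> u)"
    proof (rule integral_mono)
      fix x
      show "s i x * s i x - 2 * (s i x * s j x) + s j x * s j x \<le> 2 * (s i x - f x)\<^sup>2 + 2 * (s j x - f x)\<^sup>2"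
        using zero_le_power2[of "(s i x - f x) + (s j x - f x)"] by (simp add: power2_eq_square algebra_simps)
    qed (use op(1) int_sf in simp_all)
    also have "\<dots> = g i + g j" unfolding g_def using int_sf by simp
    finally show ?thesis .
  qed
  obtain w where w: "w \<in> H" "(\<lambda>i. (v i - w) \<bullet> (v i - w)) \<longlonglongrightarrow> 0"
    using complete_of_bound[OF vH g diff_le] .
  have lim: "(\<lambda>i. integral\<^sup>L (\<mu> z) (s i)) \<longlonglongrightarrow> integral\<^sup>L (\<mu> z) f" if "z \<in> ?D" for z
  proof (rule integral_dominated_convergence[where w = "\<lambda>x. 2 * \<bar>f x\<bar>"])
    show "integrable (\<mu> z) (\<lambda>x. 2 * \<bar>f x\<bar>)" using D(3)[OF that] by simp
  qed (use s in auto)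
  have "w \<bullet> z = (integral\<^sup>L (\<mu> (u + z)) f - integral\<^sup>L (\<mu> (u - z)) f) / 4" if z: "z \<in> ?D" for z
  proof (rule LIMSEQ_unique)
    show "(\<lambda>i. v i \<bullet> z) \<longlonglongrightarrow> w \<bullet> z" by (rule tendsto_form_left[OF vH w(1) D(1)[OF z] w(2)])
    have "(\<lambda>i. (integral\<^sup>L (\<mu> (u + z)) (s i) - integral\<^sup>L (\<mu> (u - z)) (s i)) / 4)
        \<longlonglongrightarrow> (integral\<^sup>L (\<mu> (u + z)) f - integral\<^sup>L (\<mu> (u - z)) f) / 4"
      by (intro tendsto_intros lim dom z) simp
    then show "(\<lambda>i. v i \<bullet> z) \<longlonglongrightarrow> (integral\<^sup>L (\<mu> (u + z)) f - integral\<^sup>L (\<mu> (u - z)) f) / 4"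
      unfolding v_def simple_op_inner[OF s(1) D(1)[OF u] D(1)[OF z]] .
  qed
  moreover have "w \<bullet> u = integral\<^sup>L (\<mu> u) f"
  proof (rule LIMSEQ_unique)
    show "(\<lambda>i. v i \<bullet> u) \<longlonglongrightarrow> w \<bullet> u" by (rule tendsto_form_left[OF vH w(1) D(1)[OF u] w(2)])
    have "v i \<bullet> u = integral\<^sup>L (\<mu> u) (s i)" for i
      by (simp add: integral_simple_function[OF s(1) D(1)[OF u]] v_def simple_op_def inner_sum_left)
    then show "(\<lambda>i. v i \<bullet> u) \<longlonglongrightarrow> integral\<^sup>L (\<mu> u) f" using lim[OF u] by simp
  qed
  moreover have "w \<bullet> w = (\<integral>x. (f x)\<^sup>2 \<partial>\<mu> u)"
  proof (rule LIMSEQ_unique)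
    show "(\<lambda>i. v i \<bullet> v i) \<longlonglongrightarrow> w \<bullet> w" by (rule tendsto_form_square[OF vH w])
    have "(\<lambda>i. \<integral>x. (s i x)\<^sup>2 \<partial>\<mu> u) \<longlonglongrightarrow> (\<integral>x. (f x)\<^sup>2 \<partial>\<mu> u)"
    proof (rule integral_dominated_convergence[where w = "\<lambda>x. 4 * (f x)\<^sup>2"])
      show "AE x in \<mu> u. (\<lambda>i. (s i x)\<^sup>2) \<longlonglongrightarrow> (f x)\<^sup>2" by (intro AE_I2 tendsto_intros s)
      show "AE x in \<mu> u. norm ((s i x)\<^sup>2) \<le> 4 * (f x)\<^sup>2" for i
      proof (rule AE_I2)
        fix x
        show "norm ((s i x)\<^sup>2) \<le> 4 * (f x)\<^sup>2"
          using power_mono[OF s(3)[of i x], of 2] by (simp add: power_mult_distrib)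
      qed
    qed (use D(2)[OF u] in auto)
    then show "(\<lambda>i. v i \<bullet> v i) \<longlonglongrightarrow> (\<integral>x. (f x)\<^sup>2 \<partial>\<mu> u)"
      unfolding v_def simple_op_inner_simple_op(2)[OF s(1) s(1) D(1)[OF u]] by (simp add: power2_eq_square)
  qed
  ultimately show ?thesis using that w(1) by blast
qed

text \<open>The identities \<open>\<integral> x d\<mu>\<^sub>e = k (e \<bullet> e)\<close> and \<open>\<integral> x\<^sup>2 d\<mu>\<^sub>e = k\<^sup>2 (e \<bullet> e)\<close> give
  \<open>\<integral> (x - k)\<^sup>2 d\<mu>\<^sub>e = 0\<close>.\<close>

lemma spectral_measure_eigenvector:
  assumes D: "D = spectral_integral_dom H E (\<lambda>x. x)"
    and dom_add: "\<And>u v. u \<in> D \<Longrightarrow> v \<in> D \<Longrightarrow> u + v \<in> D"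
    and dom_diff: "\<And>u v. u \<in> D \<Longrightarrow> v \<in> D \<Longrightarrow> u - v \<in> D"
    and dense: "\<And>v. v \<in> H \<Longrightarrow> (\<And>z. z \<in> D \<Longrightarrow> v \<bullet> z = 0) \<Longrightarrow> v = 0"
    and e: "e \<in> D" and eigen: "spectral_integral H E (\<lambda>x. x) e = k *\<^sub>R e"
    and A: "A \<in> sets borel"
  shows "E A e = (if k \<in> A then e else 0)"
proof -
  have eH: "e \<in> H" and sq: "integrable (\<mu> e) (\<lambda>x. x\<^sup>2)"
    using e by (auto simp: D spectral_integral_dom_def)
  have int_id: "integrable (\<mu> e) (\<lambda>x. x)"
    using integrable_of_square_integrable[of e "\<lambda>x. x"] eH sq by simp
  let ?P = "\<lambda>v. v \<in> H \<and> (\<forall>z\<in>D. v \<bullet> z = (integral\<^sup>L (\<mu> (e + z)) (\<lambda>x. x) - integral\<^sup>L (\<mu> (e - z)) (\<lambda>x. x)) / 4)"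
  have id: "(\<lambda>x::real. x) \<in> borel_measurable borel" by simp
  obtain v where "v \<in> H" "\<And>z. z \<in> D \<Longrightarrow>
      v \<bullet> z = (integral\<^sup>L (\<mu> (e + z)) (\<lambda>x. x) - integral\<^sup>L (\<mu> (e - z)) (\<lambda>x. x)) / 4"
      and ve: "v \<bullet> e = integral\<^sup>L (\<mu> e) (\<lambda>x. x)" and vv: "v \<bullet> v = (\<integral>x. x\<^sup>2 \<partial>\<mu> e)"
    using spectral_integral_exists[OF e[unfolded D] id
        dom_add[OF e, unfolded D] dom_diff[OF e, unfolded D]] unfolding D by blast
  then have v: "?P v" by blast
  \<comment> \<open>The description determines v because the test vectors z are dense; the
    eigenvalue hypothesis then identifies v with k e.\<close>
  have "(THE v. ?P v) = v"
  proof (rule the_equality, rule v)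
    fix w assume w: "?P w"
    have "(w - v) \<bullet> z = 0" if "z \<in> D" for z
      using bspec[OF conjunct2[OF w] that] bspec[OF conjunct2[OF v] that] by (simp add: inner_diff_left)
    then show "w = v" using dense[of "w - v"] v w by auto
  qed
  then have v_eq: "v = k *\<^sub>R e" using eigen by (simp add: spectral_integral_def D)
  note const = finite_measure.integrable_const[OF finite_\<mu>[OF eH]]
  have expand: "(x - k)\<^sup>2 = x * x - 2 * k * x + k\<^sup>2" for x by (simp add: power2_eq_square algebra_simps)
  have int: "integrable (\<mu> e) (\<lambda>x. (x - k)\<^sup>2)"
    unfolding expand
    by (intro Bochner_Integration.integrable_add Bochner_Integration.integrable_diff
        integrable_mult_right sq[unfolded power2_eq_square] int_id const)
  have "(\<integral>x. (x - k)\<^sup>2 \<partial>\<mu> e) = (\<integral>x. x * x - 2 * k * x \<partial>\<mu> e) + (\<integral>x. k\<^sup>2 \<partial>\<mu> e)"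
    unfolding expand
    by (intro Bochner_Integration.integral_add Bochner_Integration.integrable_diff
        integrable_mult_right sq[unfolded power2_eq_square] int_id const)
  also have "\<dots> = v \<bullet> v - 2 * k * (v \<bullet> e) + k\<^sup>2 * (e \<bullet> e)"
    unfolding ve vv
    using Bochner_Integration.integral_diff[OF sq integrable_mult_right[OF int_id, of "2 * k"]] measure_\<mu>[OF eH, of UNIV]
    by (simp add: E_UNIV[OF eH] power2_eq_square)
  also have "\<dots> = 0" by (simp add: v_eq power2_eq_square)
  finally have "AE x in \<mu> e. x = k"
    using integral_nonneg_eq_0_iff_AE[OF int] by simp
  then have zero: "E B e = 0" if B: "B \<in> sets borel" "k \<notin> B" for B
  proof -
    have "AE x in \<mu> e. x \<notin> B" using \<open>AE x in \<mu> e. x = k\<close> B(2) by (auto elim: eventually_mono)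
    then have "emeasure (\<mu> e) B = 0" using B(1) by (subst (asm) AE_iff_measurable[of B]) (auto simp: sets_\<mu>)
    then have "E B e \<bullet> e = 0"
      using E_nonneg[OF B(1) eH] by (simp add: emeasure_\<mu>[OF eH B(1)])
    then show ?thesis using E_inner_E[OF B(1) B(1) eH eH] by simp
  qed
  show ?thesis
  proof (cases "k \<in> A")
    case False
    then show ?thesis using zero A by simp
  next
    case True
    then show ?thesis using E_Compl[OF A eH] zero[of "- A"] A by simp
  qed
qed

end

section \<open>Diagonal operators and their functional calculus\<close>

text \<open>There are two instances: A on its domain, with eigenvalues at least 1, and B*B on all of
  H, with eigenvalues in [0, 1]. Hence l is left arbitrary.\<close>

locale diagonal_operator = orthonormal_basis H inner S "\<lambda>e. e"
  for H :: "'h::real_inner set" and S +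
  fixes l :: "'h \<Rightarrow> real" and D T
  assumes D_eq: "D = {u \<in> H. (\<lambda>e. (l e * (u \<bullet> e))\<^sup>2) summable_on S}"
    and T_mem: "\<And>u. u \<in> D \<Longrightarrow> T u \<in> H"
    and T_coeff: "\<And>u e. u \<in> D \<Longrightarrow> e \<in> S \<Longrightarrow> T u \<bullet> e = l e * (u \<bullet> e)"
begin

lemma basis_inner: "e \<in> S \<Longrightarrow> f \<in> S \<Longrightarrow> e \<bullet> f = (if e = f then 1 else 0)"
  using orthonormal by simp

lemma S_mem: "e \<in> S \<Longrightarrow> e \<in> H"
  using basis_mem by simp

lemma basis_finite_support:
  assumes "e \<in> S"
  shows "(\<lambda>f. g f * (e \<bullet> f)\<^sup>2 :: real) summable_on S"
proof -
  have "(\<lambda>f. g f * (e \<bullet> f)\<^sup>2) summable_on {e} \<longleftrightarrow> (\<lambda>f. g f * (e \<bullet> f)\<^sup>2) summable_on S"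
    by (rule summable_on_cong_neutral) (use assms in \<open>auto simp: basis_inner\<close>)
  then show ?thesis by simp
qed

lemma D_subspace: "u \<in> D \<Longrightarrow> v \<in> D \<Longrightarrow> u + v \<in> D" "u \<in> D \<Longrightarrow> v \<in> D \<Longrightarrow> u - v \<in> D"
  using summable_on_square_add[of "\<lambda>e. l e * (u \<bullet> e)" S "\<lambda>e. l e * (v \<bullet> e)"]
    summable_on_square_diff[of "\<lambda>e. l e * (u \<bullet> e)" S "\<lambda>e. l e * (v \<bullet> e)"]
  by (auto simp: D_eq inner_simps distrib_left right_diff_distrib simp del: power_mult_distrib)

lemma S_subset_D: "e \<in> S \<Longrightarrow> e \<in> D"
  using basis_finite_support[of e "\<lambda>f. (l f)\<^sup>2"] S_mem by (simp add: D_eq power_mult_distrib)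

lemma T_eigen: "e \<in> S \<Longrightarrow> T e = l e *\<^sub>R e"
  by (rule eqI) (auto simp: T_mem T_coeff S_subset_D S_mem basis_inner)

definition diagonal_pvm :: "(real set \<Rightarrow> 'h \<Rightarrow> 'h) \<Rightarrow> bool" where
  "diagonal_pvm E \<longleftrightarrow> projection_valued_measure H E \<and>
     (\<forall>A\<in>sets borel. \<forall>u\<in>H. \<forall>e\<in>S. E A u \<bullet> e = indicator A (l e) * (u \<bullet> e))"

text \<open>The right-hand side is the sum of point masses (u \<bullet> e)^2 at l e. Writing it as
  the image of a weighted counting measure turns integrals into sums over S. Both measures agree on
  a Borel set A by Parseval for E A u and u.\<close>

lemma spectral_scalar_measure_diagonal:
  assumes E: "diagonal_pvm E" and u: "u \<in> H"
  shows "spectral_scalar_measure E u = distr (density (count_space S) (\<lambda>e. ennreal ((u \<bullet> e)\<^sup>2))) borel l"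
proof -
  interpret pvm H E by unfold_locales (use E in \<open>simp add: diagonal_pvm_def\<close>)
  show ?thesis
  proof (rule measure_eqI)
    fix A assume "A \<in> sets (\<mu> u)"
    then have A: "A \<in> sets borel" by (simp add: sets_\<mu>)
    have "((\<lambda>e. (E A u \<bullet> e) * (u \<bullet> e)) has_sum (E A u \<bullet> u)) S"
      using A u by (intro Parseval) auto
    then have s: "((\<lambda>e. indicator A (l e) * (u \<bullet> e)\<^sup>2) has_sum (E A u \<bullet> u)) S"
      using E A u by (simp add: diagonal_pvm_def power2_eq_square mult.assoc cong: has_sum_cong)
    have "emeasure (distr (density (count_space S) (\<lambda>e. ennreal ((u \<bullet> e)\<^sup>2))) borel l) A =
        (\<integral>\<^sup>+e. ennreal ((u \<bullet> e)\<^sup>2) * indicator (l -` A \<inter> S) e \<partial>count_space S)"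
      using A by (simp add: emeasure_distr emeasure_density)
    also have "\<dots> = (\<integral>\<^sup>+e. ennreal (indicator A (l e) * (u \<bullet> e)\<^sup>2) \<partial>count_space S)"
      by (intro nn_integral_cong) (auto simp: indicator_def)
    also have "\<dots> = ennreal (integral\<^sup>L (count_space S) (\<lambda>e. indicator A (l e) * (u \<bullet> e)\<^sup>2))"
      using s by (intro nn_integral_eq_integral)
        (auto simp: integrable_count_space_iff_summable_on summable_on_def)
    also have "\<dots> = emeasure (\<mu> u) A"
      using s u A by (subst integral_count_space_eq_infsum) (auto simp: summable_on_def emeasure_\<mu> infsumI)
    finally show "emeasure (\<mu> u) A = emeasure (distr (density (count_space S) (\<lambda>e. ennreal ((u \<bullet> e)\<^sup>2))) borel l) A"
      by simp
  qed (simp add: sets_\<mu>)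
qed

lemma
  fixes f :: "real \<Rightarrow> real"
  assumes E: "diagonal_pvm E" and u: "u \<in> H" and f [measurable]: "f \<in> borel_measurable borel"
  shows integrable_diagonal_iff:
      "integrable (spectral_scalar_measure E u) f \<longleftrightarrow> (\<lambda>e. f (l e) * (u \<bullet> e)\<^sup>2) summable_on S"
    and integral_diagonal: "(\<lambda>e. f (l e) * (u \<bullet> e)\<^sup>2) summable_on S \<Longrightarrow>
      integral\<^sup>L (spectral_scalar_measure E u) f = (\<Sum>\<^sub>\<infinity>e\<in>S. f (l e) * (u \<bullet> e)\<^sup>2)"
  unfolding spectral_scalar_measure_diagonal[OF E u]
  by (auto simp: integrable_distr_eq integrable_density integral_distr integral_density
      integrable_count_space_iff_summable_on integral_count_space_eq_infsum mult.commute)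

lemma spectral_integral_dom_diagonal:
  fixes f :: "real \<Rightarrow> real"
  assumes E: "diagonal_pvm E" and f [measurable]: "f \<in> borel_measurable borel"
  shows "spectral_integral_dom H E f = {u \<in> H. (\<lambda>e. (f (l e) * (u \<bullet> e))\<^sup>2) summable_on S}"
  using integrable_diagonal_iff[OF E, of _ "\<lambda>x. (f x)\<^sup>2"]
  by (auto simp: spectral_integral_dom_def power_mult_distrib)

text \<open>Since (p + q)^2 - (p - q)^2 = 4 p q in every coefficient, the vector that Riesz-Fischer
  builds from the multiplied coefficients meets the polarized description. It is the only one,
  because every e in S lies in the domain of f.\<close>

lemma spectral_integral_diagonal:
  fixes f :: "real \<Rightarrow> real"
  assumes E: "diagonal_pvm E" and f: "f \<in> borel_measurable borel"
    and u: "u \<in> H" and summ: "(\<lambda>e. (f (l e) * (u \<bullet> e))\<^sup>2) summable_on S"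
  shows "spectral_integral H E f u \<in> H"
    and "\<And>e. e \<in> S \<Longrightarrow> spectral_integral H E f u \<bullet> e = f (l e) * (u \<bullet> e)"
proof -
  note dom = spectral_integral_dom_diagonal[OF E f]
  let ?P = "\<lambda>v. v \<in> H \<and> (\<forall>z\<in>spectral_integral_dom H E f.
      v \<bullet> z = (integral\<^sup>L (spectral_scalar_measure E (u + z)) f -
               integral\<^sup>L (spectral_scalar_measure E (u - z)) f) / 4)"
  obtain v where v: "v \<in> H" "\<And>e. e \<in> S \<Longrightarrow> v \<bullet> e = f (l e) * (u \<bullet> e)"
    using Riesz_Fischer[OF summ] by auto
  have "v \<bullet> z = (integral\<^sup>L (spectral_scalar_measure E (u + z)) f -
               integral\<^sup>L (spectral_scalar_measure E (u - z)) f) / 4"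
    if "z \<in> spectral_integral_dom H E f" for z
  proof -
    have z: "z \<in> H" "(\<lambda>e. (f (l e) * (z \<bullet> e))\<^sup>2) summable_on S" using that by (auto simp: dom)
    have "(\<lambda>e. f (l e) * ((u + z) \<bullet> e)\<^sup>2) summable_on S"
      using summable_on_mult_of_squares[OF summable_on_square_add[OF summ z(2)] Bessel_summable[of "u + z"]] u z(1)
      by (simp add: inner_simps power2_eq_square algebra_simps)
    moreover have "(\<lambda>e. f (l e) * ((u - z) \<bullet> e)\<^sup>2) summable_on S"
      using summable_on_mult_of_squares[OF summable_on_square_diff[OF summ z(2)] Bessel_summable[of "u - z"]] u z(1)
      by (simp add: inner_simps power2_eq_square algebra_simps)
    ultimately have "integral\<^sup>L (spectral_scalar_measure E (u + z)) f -
          integral\<^sup>L (spectral_scalar_measure E (u - z)) f =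
        (\<Sum>\<^sub>\<infinity>e\<in>S. f (l e) * ((u + z) \<bullet> e)\<^sup>2 - f (l e) * ((u - z) \<bullet> e)\<^sup>2)"
      using u z(1) by (simp add: integral_diagonal[OF E _ f] infsum_diff_eq)
    also have "\<dots> = (\<Sum>\<^sub>\<infinity>e\<in>S. 4 * ((v \<bullet> e) * (z \<bullet> e)))"
      by (intro infsum_cong) (simp add: v(2) inner_simps power2_eq_square algebra_simps)
    also have "\<dots> = 4 * (v \<bullet> z)"
      using infsumI[OF Parseval[OF v(1) z(1)]] by (simp add: infsum_cmult_right')
    finally show ?thesis by simp
  qed
  then have "?P v" using v(1) by blast
  moreover have "w = v" if w: "?P w" for w
  proof (rule eqI)
    fix e assume e: "e \<in> S"
    then have "e \<in> spectral_integral_dom H E f"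
      using basis_finite_support[of e "\<lambda>e. (f (l e))\<^sup>2"] S_mem by (simp add: dom power_mult_distrib)
    then show "w \<bullet> e = v \<bullet> e"
      using bspec[OF conjunct2[OF w]] bspec[OF conjunct2[OF \<open>?P v\<close>]] by metis
  qed (use w v in auto)
  ultimately have "spectral_integral H E f u = v"
    unfolding spectral_integral_def by (rule the_equality)
  then show "spectral_integral H E f u \<in> H"
    and "\<And>e. e \<in> S \<Longrightarrow> spectral_integral H E f u \<bullet> e = f (l e) * (u \<bullet> e)"
    using v by auto
qed

text \<open>Without a witness, \<open>SOME\<close> would say nothing about
  \<open>spectral_measure\<close>. Truncation of coefficients defines the projections; the algebraic
  axioms hold coefficientwise, and only countable additivity needs a limit argument.\<close>

lemma diagonal_pvm_exists: "\<exists>E. diagonal_pvm E"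
proof -
  have "\<exists>v. v \<in> H \<and> (\<forall>e\<in>S. v \<bullet> e = indicator A (l e) * (u \<bullet> e))" if u: "u \<in> H" for A u
  proof -
    have "(\<lambda>e. (indicator A (l e) * (u \<bullet> e))\<^sup>2) summable_on S"
      by (rule summable_on_square_comparison[OF Bessel_summable[OF u], where C = 1])
         (auto simp: indicator_def)
    then obtain v where "v \<in> H" "\<And>e. e \<in> S \<Longrightarrow> v \<bullet> e = indicator A (l e) * (u \<bullet> e)"
      by (rule Riesz_Fischer) simp
    then show ?thesis by blast
  qed
  note ex = this
  define E where "E A u = (SOME v. v \<in> H \<and> (\<forall>e\<in>S. v \<bullet> e = indicator A (l e) * (u \<bullet> e)))" for A u
  have E: "E A u \<in> H" "e \<in> S \<Longrightarrow> E A u \<bullet> e = indicator A (l e) * (u \<bullet> e)" if "u \<in> H" for A u e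
    using someI_ex[OF ex[OF that, of A]] by (auto simp: E_def)
  have sums: "(\<lambda>i. E (A i) u) sums E (\<Union>i. A i) u"
    if A: "disjoint_family A" and u: "u \<in> H" for A :: "nat \<Rightarrow> real set" and u
  proof -
    \<comment> \<open>By disjointness, the union of the A i with i >= n. Each l e lies in only
      finitely many B n, so the remainder tends to 0 by dominated convergence with dominant (u
      \<bullet> e)^2.\<close>
    define B where "B n = (\<Union>i. A i) - (\<Union>i<n. A i)" for n
    have rest: "E (\<Union>i. A i) u - (\<Sum>i<n. E (A i) u) = E (B n) u" for n
    proof (rule eqI)
      fix e assume e: "e \<in> S"
      have "(\<Sum>i<n. indicator (A i) (l e)) = (indicator (\<Union>i<n. A i) (l e) :: real)"
        using A by (intro indicator_UN_disjoint[symmetric]) (auto simp: disjoint_family_on_def)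
      then show "(E (\<Union>i. A i) u - (\<Sum>i<n. E (A i) u)) \<bullet> e = E (B n) u \<bullet> e"
        using u e by (auto simp: inner_diff_left inner_sum_left E(2) sum_distrib_right[symmetric] B_def indicator_def)
    qed (use u E(1) in \<open>auto intro!: mem_sum mem_diff\<close>)
    have norm_B: "E (B n) u \<bullet> E (B n) u = integral\<^sup>L (count_space S) (\<lambda>e. indicator (B n) (l e) * (u \<bullet> e)\<^sup>2)" for n
    proof -
      have "((\<lambda>e. (E (B n) u \<bullet> e) * (E (B n) u \<bullet> e)) has_sum (E (B n) u \<bullet> E (B n) u)) S"
        using u E(1) by (intro Parseval) auto
      moreover have "(E (B n) u \<bullet> e) * (E (B n) u \<bullet> e) = indicator (B n) (l e) * (u \<bullet> e)\<^sup>2" if "e \<in> S" for e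
        using u that by (simp add: E(2) indicator_def power2_eq_square)
      ultimately have "((\<lambda>e. indicator (B n) (l e) * (u \<bullet> e)\<^sup>2) has_sum (E (B n) u \<bullet> E (B n) u)) S"
        by (simp cong: has_sum_cong)
      then show ?thesis by (subst integral_count_space_eq_infsum) (auto simp: summable_on_def infsumI)
    qed
    have "(\<lambda>n. integral\<^sup>L (count_space S) (\<lambda>e. indicator (B n) (l e) * (u \<bullet> e)\<^sup>2)) \<longlonglongrightarrow>
        integral\<^sup>L (count_space S) (\<lambda>e. 0 :: real)"
    proof (rule integral_dominated_convergence[where w = "\<lambda>e. (u \<bullet> e)\<^sup>2"])
      show "integrable (count_space S) (\<lambda>e. (u \<bullet> e)\<^sup>2)"
        using Bessel_summable[OF u] by (simp add: integrable_count_space_iff_summable_on)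
      show "AE e in count_space S. (\<lambda>n. indicator (B n) (l e) * (u \<bullet> e)\<^sup>2) \<longlonglongrightarrow> 0"
      proof (rule AE_I2)
        fix e
        have "\<forall>\<^sub>F n in sequentially. l e \<notin> B n"
        proof (cases "l e \<in> (\<Union>i. A i)")
          case True
          then obtain j where "l e \<in> A j" by auto
          then have "l e \<notin> B n" if "n \<ge> Suc j" for n using that by (auto simp: B_def)
          then show ?thesis unfolding eventually_sequentially by blast
        qed (auto simp: B_def)
        then show "(\<lambda>n. indicator (B n) (l e) * (u \<bullet> e)\<^sup>2) \<longlonglongrightarrow> 0"
          by (intro tendsto_eventually) (auto elim: eventually_mono)
      qed
    qed (auto simp: indicator_def)
    then have "(\<lambda>n. norm (E (B n) u) ^ 2) \<longlonglongrightarrow> 0"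
      by (simp add: power2_norm_eq_inner norm_B)
    then have "(\<lambda>n. E (B n) u) \<longlonglongrightarrow> 0"
      by (simp add: power_tendsto_0_iff tendsto_norm_zero_iff)
    then have "(\<lambda>n. E (\<Union>i. A i) u - E (B n) u) \<longlonglongrightarrow> E (\<Union>i. A i) u - 0"
      by (intro tendsto_intros)
    moreover have "E (\<Union>i. A i) u - E (B n) u = (\<Sum>i<n. E (A i) u)" for n
      using rest[of n] by (simp add: algebra_simps)
    ultimately show ?thesis by (simp add: sums_def)
  qed
  have "projection_valued_measure H E"
    unfolding projection_valued_measure_def orth_proj_on_def
  proof (intro conjI ballI allI impI)
    fix A u v assume uv: "u \<in> H" "v \<in> H"
    have "((\<lambda>e. indicator A (l e) * (u \<bullet> e) * (v \<bullet> e)) has_sum (E A u \<bullet> v)) S"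
      using Parseval[OF E(1)[OF uv(1)] uv(2), of A] uv by (simp add: E(2) cong: has_sum_cong)
    moreover have "((\<lambda>e. indicator A (l e) * (u \<bullet> e) * (v \<bullet> e)) has_sum (u \<bullet> E A v)) S"
      using Parseval[OF uv(1) E(1)[OF uv(2)], of A] uv by (simp add: E(2) mult_ac cong: has_sum_cong)
    ultimately show "E A u \<bullet> v = u \<bullet> E A v" by (metis infsumI)
  next
    fix A u assume u: "u \<in> H"
    show "E A (E A u) = E A u"
      by (rule eqI) (use u E(1) in \<open>auto simp: E(2) indicator_def\<close>)
  next
    fix u assume u: "u \<in> H"
    show "E UNIV u = u"
      by (rule eqI) (use u E(1) in \<open>auto simp: E(2)\<close>)
  next
    fix A B u assume u: "u \<in> H"
    show "E (A \<inter> B) u = E A (E B u)"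
      by (rule eqI) (use u E(1) in \<open>auto simp: E(2) indicator_def\<close>)
  qed (use E(1) sums in auto)
  then show ?thesis using E by (auto simp: diagonal_pvm_def)
qed

text \<open>The diagonal measure is a spectral measure of T, so the selected E is one too. The
  eigenvector lemma determines E A on each e, and symmetry of E A moves this to the coefficients of
  E A u for every u.\<close>

lemma spectral_measure_diagonal: "diagonal_pvm (spectral_measure H D T)"
proof -
  have D_id: "spectral_integral_dom H E (\<lambda>x. x) = D" if "diagonal_pvm E" for E
    using spectral_integral_dom_diagonal[OF that, of "\<lambda>x. x"] by (simp add: D_eq)
  obtain E0 where E0: "diagonal_pvm E0" using diagonal_pvm_exists by blast
  have "is_spectral_measure H D T E0"
    unfolding is_spectral_measure_def
  proof (intro conjI ballI)
    fix u assume u: "u \<in> D"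
    then have u': "u \<in> H" "(\<lambda>e. (l e * (u \<bullet> e))\<^sup>2) summable_on S" by (auto simp: D_eq)
    show "T u = spectral_integral H E0 (\<lambda>x. x) u"
      using spectral_integral_diagonal[OF E0 _ u'] u by (intro eqI) (auto simp: T_mem T_coeff)
  qed (use E0 D_id[OF E0] in \<open>auto simp: diagonal_pvm_def\<close>)
  then have spec: "is_spectral_measure H D T (spectral_measure H D T)"
    unfolding spectral_measure_def by (rule someI[of "is_spectral_measure H D T"])
  define E where "E = spectral_measure H D T"
  interpret pvm H E
    by unfold_locales (use spec in \<open>simp add: E_def is_spectral_measure_def\<close>)
  have D: "spectral_integral_dom H E (\<lambda>x. x) = D" and T: "\<And>u. u \<in> D \<Longrightarrow> spectral_integral H E (\<lambda>x. x) u = T u"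
    using spec by (auto simp: E_def is_spectral_measure_def)
  have "E A e = (if l e \<in> A then e else 0)" if "A \<in> sets borel" "e \<in> S" for A e
  proof (rule spectral_measure_eigenvector[OF D[symmetric]])
    show "v = 0" if "v \<in> H" "\<And>z. z \<in> D \<Longrightarrow> v \<bullet> z = 0" for v
      using that S_subset_D by (intro total) auto
  qed (use that T T_eigen S_subset_D D_subspace in auto)
  then have "E A u \<bullet> e = indicator A (l e) * (u \<bullet> e)" if "A \<in> sets borel" "u \<in> H" "e \<in> S" for A u e
    using E_sym[of A u e] that S_mem by (simp add: indicator_def)
  then show ?thesis using pvm unfolding diagonal_pvm_def E_def by blast
qed

theorem
  fixes f :: "real \<Rightarrow> real"
  assumes "f \<in> borel_measurable borel" "u \<in> H" "(\<lambda>e. (f (l e) * (u \<bullet> e))\<^sup>2) summable_on S"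
  shows fun_calc_mem: "fun_calc H D T f u \<in> H"
    and fun_calc_coeff: "\<And>e. e \<in> S \<Longrightarrow> fun_calc H D T f u \<bullet> e = f (l e) * (u \<bullet> e)"
  using spectral_integral_diagonal[OF spectral_measure_diagonal assms] by (auto simp: fun_calc_def)

end

section \<open>Completeness of the function spaces\<close>

lemma L2_fun_measurable [measurable]: "L2_fun u \<in> borel_measurable borel"
  and L2_fun_square_integrable: "integrable lborel (\<lambda>x. (L2_fun u x)\<^sup>2)"
  using Quotient3_rep_reflp[OF Quotient3_L2fun, of u] by (auto simp: L2_rel_def)

lemma L2_fun_mult_integrable: "integrable lborel (\<lambda>x. L2_fun u x * L2_fun v x)"
  by (intro integrable_square_mult L2_fun_square_integrable) auto

lemma L2_fun_eqI: "AE x in lborel. L2_fun u x = L2_fun v x \<Longrightarrow> u = v"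
  using Quotient3_rel_rep[OF Quotient3_L2fun, of u v] L2_fun_square_integrable[of u] L2_fun_square_integrable[of v]
  by (auto simp: L2_rel_def)

text \<open>The chosen representative agrees with f only almost everywhere, so all pointwise algebra
  of classes below is stated with \<open>AE\<close>.\<close>

lemma L2_fun_abs:
  assumes "f \<in> borel_measurable lborel" "integrable lborel (\<lambda>x. (f x)\<^sup>2)"
  shows "AE x in lborel. L2_fun (abs_L2fun f) x = f x"
  using Quotient3_rep_abs[OF Quotient3_L2fun, of f] assms by (auto simp: L2_rel_def)

lemma L2_fun_zero: "AE x in lborel. L2_fun (0::'a::euclidean_space L2fun) x = 0"
  unfolding zero_L2fun_def by (rule L2_fun_abs) auto

lemma L2_fun_add: "AE x in lborel. L2_fun (u + v) x = L2_fun u x + L2_fun v x"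
  unfolding plus_L2fun_def map_fun_def comp_def id_def
  by (rule L2_fun_abs) (auto intro!: integrable_square_add L2_fun_square_integrable)

lemma L2_fun_scaleR: "AE x in lborel. L2_fun (c *\<^sub>R u) x = c * L2_fun u x"
  unfolding scaleR_L2fun_def map_fun_def comp_def id_def
  by (rule L2_fun_abs) (auto intro!: L2_fun_square_integrable simp: power_mult_distrib)

lemma L2_fun_diff: "AE x in lborel. L2_fun (u - v) x = L2_fun u x - L2_fun v x"
  using L2_fun_add[of "u - v" v] by eventually_elim simp

lemma inner_L2fun_eq: "u \<bullet> v = (\<integral>x. L2_fun u x * L2_fun v x \<partial>lborel)"
  unfolding inner_L2fun_def by simp

lemma nn_integral_L2_fun: "(\<integral>\<^sup>+x. ennreal ((L2_fun u x)\<^sup>2) \<partial>lborel) = ennreal (u \<bullet> u)"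
  by (subst nn_integral_eq_integral)
     (auto simp: L2_fun_mult_integrable inner_L2fun_eq power2_eq_square)

lemma nn_integral_L2_fun_diff:
  "(\<integral>\<^sup>+x. ennreal ((L2_fun u x - L2_fun v x)\<^sup>2) \<partial>lborel) = ennreal ((u - v) \<bullet> (u - v))"
  unfolding nn_integral_L2_fun[symmetric]
  by (rule nn_integral_cong_AE) (use L2_fun_diff[of u v] in \<open>auto elim!: eventually_mono\<close>)

text \<open>Fatou's lemma, in the form that carries a Cauchy estimate over to the pointwise limit of
  a subsequence.\<close>

lemma nn_integral_square_le_of_AE_limit:
  fixes g :: "nat \<Rightarrow> 'a \<Rightarrow> real"
  assumes [measurable]: "\<And>m. g m \<in> borel_measurable M"
    and lim: "AE x in M. (\<lambda>m. g m x) \<longlonglongrightarrow> h x"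
    and bound: "\<forall>\<^sub>F m in sequentially. (\<integral>\<^sup>+x. ennreal ((g m x)\<^sup>2) \<partial>M) \<le> c"
  shows "(\<integral>\<^sup>+x. ennreal ((h x)\<^sup>2) \<partial>M) \<le> c"
proof -
  have "AE x in M. ennreal ((h x)\<^sup>2) = liminf (\<lambda>m. ennreal ((g m x)\<^sup>2))"
    using lim
  proof eventually_elim
    case (elim x)
    have "(\<lambda>m. ennreal ((g m x)\<^sup>2)) \<longlonglongrightarrow> ennreal ((h x)\<^sup>2)"
      by (intro tendsto_ennrealI tendsto_intros elim)
    from lim_imp_Liminf[OF _ this] show ?case by simp
  qed
  then have "(\<integral>\<^sup>+x. ennreal ((h x)\<^sup>2) \<partial>M) = (\<integral>\<^sup>+x. liminf (\<lambda>m. ennreal ((g m x)\<^sup>2)) \<partial>M)"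
    by (rule nn_integral_cong_AE)
  also have "\<dots> \<le> liminf (\<lambda>m. \<integral>\<^sup>+x. ennreal ((g m x)\<^sup>2) \<partial>M)"
    by (intro nn_integral_liminf) measurable
  also have "\<dots> \<le> liminf (\<lambda>m::nat. c)"
    by (rule Liminf_mono[OF bound])
  also have "\<dots> = c" by (simp add: Liminf_const)
  finally show ?thesis .
qed

lemma rapid_subsequence:
  fixes q :: "nat \<Rightarrow> nat \<Rightarrow> real"
  assumes "\<And>e. 0 < e \<Longrightarrow> \<exists>N. \<forall>m\<ge>N. \<forall>n\<ge>N. q m n < e" and "\<And>n. 0 < c n"
  obtains r where "strict_mono r" "\<And>n. q (r (Suc n)) (r n) < c n"
proof -
  obtain N where N: "\<And>k m n. m \<ge> N k \<Longrightarrow> n \<ge> N k \<Longrightarrow> q m n < c k"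
    using assms(1)[OF assms(2)] by metis
  \<comment> \<open>\<open>Suc k\<close> forces strict growth, and N (Suc n) secures the bound with
    the next c.\<close>
  define r where "r = rec_nat (N 0) (\<lambda>n k. max (Suc k) (N (Suc n)))"
  have r: "r (Suc n) = max (Suc (r n)) (N (Suc n))" "r 0 = N 0" for n by (auto simp: r_def)
  have "r n \<ge> N n" for n by (cases n) (auto simp: r)
  moreover have "strict_mono r" by (rule strict_mono_Suc_iff[THEN iffD2]) (auto simp: r)
  moreover have "r (Suc n) \<ge> r n" for n by (simp add: r)
  ultimately show ?thesis using that N by (meson order_trans)
qed

text \<open>Along a rapidly Cauchy subsequence the increments \<open>d n\<close> satisfy
  \<open>\<bar>d n\<bar> \<le> 2\<^sup>-\<^sup>n + 2\<^sup>n (d n)\<^sup>2\<close>, and the right-hand side is almost everywhere summable.\<close>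

lemma L2fun_Cauchy_limit:
  fixes X :: "nat \<Rightarrow> 'a::euclidean_space L2fun"
  assumes Cauchy: "\<And>e. 0 < e \<Longrightarrow> \<exists>N. \<forall>m\<ge>N. \<forall>n\<ge>N. (X m - X n) \<bullet> (X m - X n) < e"
  obtains u r where "strict_mono r" "AE x in lborel. (\<lambda>n. L2_fun (X (r n)) x) \<longlonglongrightarrow> L2_fun u x"
    "(\<lambda>n. (X n - u) \<bullet> (X n - u)) \<longlonglongrightarrow> 0"
proof -
  \<comment> \<open>Squared increments below 4^-n, weighted by 2^n, still form the summable series
    2^-n.\<close>
  obtain r where r: "strict_mono r"
    "\<And>n. (X (r (Suc n)) - X (r n)) \<bullet> (X (r (Suc n)) - X (r n)) < (1/4) ^ n"
    using rapid_subsequence[of "\<lambda>m n. (X m - X n) \<bullet> (X m - X n)" "\<lambda>n. (1/4) ^ n", OF Cauchy] by auto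
  define d where "d n x = L2_fun (X (r (Suc n))) x - L2_fun (X (r n)) x" for n x
  have [measurable]: "d n \<in> borel_measurable borel" for n
    unfolding d_def by measurable
  have "(\<integral>\<^sup>+x. (\<Sum>n. ennreal (2 ^ n * (d n x)\<^sup>2)) \<partial>lborel) = (\<Sum>n. \<integral>\<^sup>+x. ennreal (2 ^ n * (d n x)\<^sup>2) \<partial>lborel)"
    by (rule nn_integral_suminf) measurable
  also have "\<dots> \<le> (\<Sum>n. ennreal ((1/2) ^ n))"
  proof (intro suminf_le allI summableI)
    fix n
    have "(\<integral>\<^sup>+x. ennreal (2 ^ n * (d n x)\<^sup>2) \<partial>lborel) = ennreal (2 ^ n) * (\<integral>\<^sup>+x. ennreal ((d n x)\<^sup>2) \<partial>lborel)"
      by (subst nn_integral_cmult[symmetric]) (auto simp: ennreal_mult')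
    also have "\<dots> = ennreal (2 ^ n * ((X (r (Suc n)) - X (r n)) \<bullet> (X (r (Suc n)) - X (r n))))"
      unfolding d_def nn_integral_L2_fun_diff by (simp add: ennreal_mult')
    also have "\<dots> \<le> ennreal (2 ^ n * (1/4) ^ n)"
      using r(2)[of n] by (intro ennreal_leI mult_left_mono) auto
    also have "2 ^ n * (1/4) ^ n = ((1/2) ^ n :: real)" by (simp flip: power_mult_distrib)
    finally show "(\<integral>\<^sup>+x. ennreal (2 ^ n * (d n x)\<^sup>2) \<partial>lborel) \<le> ennreal ((1/2) ^ n)" .
  qed
  also have "\<dots> = ennreal 2"
    by (intro suminf_ennreal_eq) (use geometric_sums[of "1/2::real"] in auto)
  also have "\<dots> < \<infinity>" by simp
  finally have "AE x in lborel. (\<Sum>n. ennreal (2 ^ n * (d n x)\<^sup>2)) \<noteq> \<infinity>"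
    by (intro nn_integral_PInf_AE) auto
  then have conv: "AE x in lborel. convergent (\<lambda>n. L2_fun (X (r n)) x)"
  proof eventually_elim
    case (elim x)
    have "summable (\<lambda>n. 2 ^ n * (d n x)\<^sup>2)"
      by (rule summable_suminf_not_top) (use elim in auto)
    then have "summable (\<lambda>n. (1/2) ^ n + 2 ^ n * (d n x)\<^sup>2)"
      by (intro summable_add summable_geometric) auto
    moreover have "\<bar>d n x\<bar> \<le> (1/2) ^ n + 2 ^ n * (d n x)\<^sup>2" for n
    proof (cases "\<bar>d n x\<bar> \<le> (1/2) ^ n")
      case True
      then show ?thesis by (smt (verit) zero_le_mult_iff zero_le_power zero_le_power2)
    next
      case False
      then have "(1/2) ^ n * \<bar>d n x\<bar> \<le> \<bar>d n x\<bar> * \<bar>d n x\<bar>"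
        by (intro mult_right_mono) auto
      then have "2 ^ n * ((1/2) ^ n * \<bar>d n x\<bar>) \<le> 2 ^ n * (d n x)\<^sup>2"
        by (intro mult_left_mono) (auto simp: power2_eq_square)
      moreover have "2 ^ n * ((1/2) ^ n * \<bar>d n x\<bar>) = \<bar>d n x\<bar>"
        by (simp flip: mult.assoc power_mult_distrib)
      moreover have "0 \<le> ((1/2) ^ n :: real)" by simp
      ultimately show ?thesis by linarith
    qed
    ultimately have "summable (\<lambda>n. d n x)"
      unfolding real_norm_def[symmetric] by (rule summable_comparison_test')
    then have "(\<lambda>n. \<Sum>i<n. d i x) \<longlonglongrightarrow> (\<Sum>i. d i x)"
      by (rule summable_LIMSEQ)
    then have "(\<lambda>n. (\<Sum>i<n. d i x) + L2_fun (X (r 0)) x) \<longlonglongrightarrow> (\<Sum>i. d i x) + L2_fun (X (r 0)) x"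
      by (intro tendsto_intros)
    moreover have "(\<Sum>i<n. d i x) + L2_fun (X (r 0)) x = L2_fun (X (r n)) x" for n
      by (simp add: d_def sum_lessThan_telescope[of "\<lambda>n. L2_fun (X (r n)) x"])
    ultimately show ?case by (auto simp: convergent_def)
  qed
  define f where "f x = lim (\<lambda>n. L2_fun (X (r n)) x)" for x
  have f [measurable]: "f \<in> borel_measurable borel"
    unfolding f_def by measurable
  have lim: "AE x in lborel. (\<lambda>n. L2_fun (X (r n)) x) \<longlonglongrightarrow> f x"
    using conv by eventually_elim (simp add: f_def convergent_LIMSEQ_iff)
  have bound: "\<exists>N. \<forall>n\<ge>N. (\<integral>\<^sup>+x. ennreal ((L2_fun (X n) x - f x)\<^sup>2) \<partial>lborel) \<le> ennreal e" if e: "0 < e" for e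
  proof -
    obtain N where N: "\<And>m n. m \<ge> N \<Longrightarrow> n \<ge> N \<Longrightarrow> (X m - X n) \<bullet> (X m - X n) < e"
      using Cauchy[OF e] by blast
    have "(\<integral>\<^sup>+x. ennreal ((L2_fun (X n) x - f x)\<^sup>2) \<partial>lborel) \<le> ennreal e" if n: "n \<ge> N" for n
    proof (rule nn_integral_square_le_of_AE_limit)
      show "AE x in lborel. (\<lambda>m. L2_fun (X n) x - L2_fun (X (r m)) x) \<longlonglongrightarrow> L2_fun (X n) x - f x"
        using lim by eventually_elim (intro tendsto_intros)
      show "\<forall>\<^sub>F m in sequentially. (\<integral>\<^sup>+x. ennreal ((L2_fun (X n) x - L2_fun (X (r m)) x)\<^sup>2) \<partial>lborel) \<le> ennreal e"
        unfolding nn_integral_L2_fun_diff eventually_sequentially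
        using N[OF n order_trans[OF _ seq_suble[OF r(1)]]]
        by (intro exI[of _ N] allI impI ennreal_leI less_imp_le)
    qed measurable
    then show ?thesis by blast
  qed
  \<comment> \<open>f is square integrable because it differs from X n0 by a square-integrable
    function.\<close>
  obtain n0 where "(\<integral>\<^sup>+x. ennreal ((L2_fun (X n0) x - f x)\<^sup>2) \<partial>lborel) \<le> ennreal 1"
    using bound[of 1] by auto
  then have "integrable lborel (\<lambda>x. (f x - L2_fun (X n0) x)\<^sup>2)"
    by (intro integrableI_bounded) (auto simp: power2_commute[of "f _"] intro: le_less_trans)
  from integrable_square_add[OF _ _ this L2_fun_square_integrable[of "X n0"]]
  have "integrable lborel (\<lambda>x. (f x)\<^sup>2)" by simp
  then have u: "AE x in lborel. L2_fun (abs_L2fun f) x = f x" by (intro L2_fun_abs) auto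
  have "(\<lambda>n. (X n - abs_L2fun f) \<bullet> (X n - abs_L2fun f)) \<longlonglongrightarrow> 0"
  proof (rule LIMSEQ_I)
    fix e :: real assume e: "0 < e"
    then obtain N where N: "\<And>n. n \<ge> N \<Longrightarrow> (\<integral>\<^sup>+x. ennreal ((L2_fun (X n) x - f x)\<^sup>2) \<partial>lborel) \<le> ennreal (e / 2)"
      using bound[of "e / 2"] by auto
    have "(X n - abs_L2fun f) \<bullet> (X n - abs_L2fun f) < e" if "n \<ge> N" for n
    proof -
      have "ennreal ((X n - abs_L2fun f) \<bullet> (X n - abs_L2fun f)) = (\<integral>\<^sup>+x. ennreal ((L2_fun (X n) x - f x)\<^sup>2) \<partial>lborel)"
        unfolding nn_integral_L2_fun_diff[symmetric]
        by (rule nn_integral_cong_AE) (use u in \<open>auto elim!: eventually_mono\<close>)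
      also have "\<dots> \<le> ennreal (e / 2)" by (rule N[OF that])
      finally show ?thesis using e by (subst (asm) ennreal_le_iff) auto
    qed
    then show "\<exists>no. \<forall>n\<ge>no. norm ((X n - abs_L2fun f) \<bullet> (X n - abs_L2fun f) - 0) < e" by auto
  qed
  moreover have "AE x in lborel. (\<lambda>n. L2_fun (X (r n)) x) \<longlonglongrightarrow> L2_fun (abs_L2fun f) x"
    using lim u by eventually_elim simp
  ultimately show ?thesis using that r(1) by blast
qed

lemma subspace_L2_on: "subspace (L2_on \<Omega>)"
proof (rule subspaceI)
  show "0 \<in> L2_on \<Omega>" using L2_fun_zero by (auto simp: L2_on_def elim!: eventually_mono)
  show "u + v \<in> L2_on \<Omega>" if "u \<in> L2_on \<Omega>" "v \<in> L2_on \<Omega>" for u v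
  proof -
    have "AE x in lborel. x \<notin> \<Omega> \<longrightarrow> L2_fun u x = 0" "AE x in lborel. x \<notin> \<Omega> \<longrightarrow> L2_fun v x = 0"
      using that by (auto simp: L2_on_def)
    with L2_fun_add[of u v] show ?thesis unfolding L2_on_def mem_Collect_eq by eventually_elim auto
  qed
  show "c *\<^sub>R u \<in> L2_on \<Omega>" if "u \<in> L2_on \<Omega>" for c u
  proof -
    have "AE x in lborel. x \<notin> \<Omega> \<longrightarrow> L2_fun u x = 0" using that by (auto simp: L2_on_def)
    with L2_fun_scaleR[of c u] show ?thesis unfolding L2_on_def mem_Collect_eq by eventually_elim auto
  qed
qed

lemma L2_on_AE_limit:
  fixes X :: "nat \<Rightarrow> 'a::euclidean_space L2fun" and r :: "nat \<Rightarrow> nat"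
  assumes "\<And>n. X n \<in> L2_on \<Omega>" "AE x in lborel. (\<lambda>n. L2_fun (X (r n)) x) \<longlonglongrightarrow> L2_fun u x"
  shows "u \<in> L2_on \<Omega>"
proof -
  have "AE x in lborel. x \<notin> \<Omega> \<longrightarrow> L2_fun (X n) x = 0" for n
    using assms(1)[of n] by (simp add: L2_on_def)
  then have "AE x in lborel. \<forall>n. x \<notin> \<Omega> \<longrightarrow> L2_fun (X n) x = 0"
    unfolding AE_all_countable by blast
  with assms(2) show ?thesis
    unfolding L2_on_def mem_Collect_eq by eventually_elim (auto simp: LIMSEQ_const_iff)
qed

lemma hilbert_form_L2_on: "hilbert_form (L2_on \<Omega>) inner"
proof
  fix X :: "nat \<Rightarrow> 'a L2fun"
  assume X: "\<And>n. X n \<in> L2_on \<Omega>" and "\<And>e. 0 < e \<Longrightarrow> \<exists>N. \<forall>m\<ge>N. \<forall>n\<ge>N. (X m - X n) \<bullet> (X m - X n) < e"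
  then obtain u and r :: "nat \<Rightarrow> nat" where "AE x in lborel. (\<lambda>n. L2_fun (X (r n)) x) \<longlonglongrightarrow> L2_fun u x"
      "(\<lambda>n. (X n - u) \<bullet> (X n - u)) \<longlonglongrightarrow> 0"
    by - (rule L2fun_Cauchy_limit[of X], blast+)
  then show "\<exists>u\<in>L2_on \<Omega>. (\<lambda>n. (X n - u) \<bullet> (X n - u)) \<longlonglongrightarrow> 0"
    using L2_on_AE_limit[of X \<Omega>] X by blast
qed (auto simp: subspace_L2_on inner_add_left intro: inner_commute)

section \<open>The Gagliardo form and completeness of the form domain\<close>

abbreviation lborel2 :: "('a::euclidean_space \<times> 'a) measure" where
  "lborel2 \<equiv> lborel \<Otimes>\<^sub>M lborel"

text \<open>For a null set N, the pairs with some coordinate in N form a null set. This carries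
  identities between representatives over to difference quotients.\<close>

lemma AE_lborel_pair:
  assumes "AE x in (lborel :: 'a::euclidean_space measure). P x"
  shows "AE z in (lborel2 :: ('a \<times> 'a) measure). P (fst z) \<and> P (snd z)"
proof -
  obtain N where N: "{x. \<not> P x} \<subseteq> N" "emeasure lborel N = 0" "N \<in> sets lborel"
    using AE_E[OF assms] by auto
  have "N \<times> UNIV \<in> null_sets lborel2" "UNIV \<times> N \<in> null_sets lborel2"
    using N by (auto simp: null_sets_def lborel.emeasure_pair_measure_Times)
  then have "N \<times> UNIV \<union> UNIV \<times> N \<in> null_sets lborel2" by blast
  then show ?thesis by (rule AE_I') (use N in auto)
qed

text \<open>Half of the exponent N + 2 s goes to each factor, so that the double integral becomes an
  L^2 inner product on pairs of points. On the diagonal the quotient is 0/0 = 0.\<close>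

definition gagliardo :: "real \<Rightarrow> 'a::euclidean_space L2fun \<Rightarrow> 'a \<times> 'a \<Rightarrow> real" where
  "gagliardo s u z = (L2_fun u (fst z) - L2_fun u (snd z)) / norm (fst z - snd z) powr (real DIM('a) / 2 + s)"

lemma gagliardo_measurable [measurable]: "gagliardo s u \<in> borel_measurable lborel2"
  unfolding gagliardo_def by measurable

lemma gagliardo_mult:
  fixes u v :: "'a::euclidean_space L2fun"
  shows "gagliardo s u z * gagliardo s v z =
    (L2_fun u (fst z) - L2_fun u (snd z)) * (L2_fun v (fst z) - L2_fun v (snd z)) /
      norm (fst z - snd z) powr (real DIM('a) + 2 * s)"
proof -
  have "norm (fst z - snd z) powr (real DIM('a) + 2 * s) =
      norm (fst z - snd z) powr (real DIM('a) / 2 + s) * norm (fst z - snd z) powr (real DIM('a) / 2 + s)"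
    by (subst powr_add[symmetric]) (simp add: algebra_simps)
  then show ?thesis by (simp add: gagliardo_def)
qed

lemma Hs_iff: "u \<in> Hs s \<longleftrightarrow> integrable lborel2 (\<lambda>z. (gagliardo s u z)\<^sup>2)"
  by (simp add: Hs_def power2_eq_square gagliardo_mult case_prod_unfold)

lemma gagliardo_mult_integrable:
  "u \<in> Hs s \<Longrightarrow> v \<in> Hs s \<Longrightarrow> integrable lborel2 (\<lambda>z. gagliardo s u z * gagliardo s v z)"
  by (intro integrable_square_mult) (auto simp: Hs_iff)

lemma gagliardo_linear:
  fixes u v :: "'a::euclidean_space L2fun"
  shows "AE z in lborel2. gagliardo s (u + v) z = gagliardo s u z + gagliardo s v z"
    and "AE z in lborel2. gagliardo s (u - v) z = gagliardo s u z - gagliardo s v z"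
    and "AE z in lborel2. gagliardo s (c *\<^sub>R u) z = c * gagliardo s u z"
    and "AE z in lborel2. gagliardo s (0 :: 'a L2fun) z = 0"
proof -
  show "AE z in lborel2. gagliardo s (u + v) z = gagliardo s u z + gagliardo s v z"
    using AE_lborel_pair[OF L2_fun_add[of u v]]
    by eventually_elim (simp add: gagliardo_def diff_divide_distrib add_divide_distrib)
  show "AE z in lborel2. gagliardo s (u - v) z = gagliardo s u z - gagliardo s v z"
    using AE_lborel_pair[OF L2_fun_diff[of u v]]
    by eventually_elim (simp add: gagliardo_def diff_divide_distrib)
  show "AE z in lborel2. gagliardo s (c *\<^sub>R u) z = c * gagliardo s u z"
    using AE_lborel_pair[OF L2_fun_scaleR[of c u]]
    by eventually_elim (simp add: gagliardo_def right_diff_distrib)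
  show "AE z in lborel2. gagliardo s (0 :: 'a L2fun) z = 0"
    using AE_lborel_pair[OF L2_fun_zero] by eventually_elim (simp add: gagliardo_def)
qed

lemma Hs0_iff: "u \<in> Hs0 \<Omega> s \<longleftrightarrow> u \<in> L2_on \<Omega> \<and> u \<in> Hs s"
  by (auto simp: Hs0_def L2_on_def)

lemma integrable_AE_cong: "integrable M f \<Longrightarrow> g \<in> borel_measurable M \<Longrightarrow> AE x in M. g x = f x \<Longrightarrow> integrable M g"
  for f g :: "'a \<Rightarrow> real"
  by (rule integrable_cong_AE_imp) (auto elim: eventually_mono)

lemma subspace_Hs0: "subspace (Hs0 (\<Omega> :: 'a::euclidean_space set) s)"
proof (rule subspaceI)
  have "integrable lborel2 (\<lambda>z. (gagliardo s (0 :: 'a L2fun) z)\<^sup>2)"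
    by (rule integrable_AE_cong[of _ "\<lambda>_. 0"])
      (use gagliardo_linear(4)[of s] in \<open>auto elim!: eventually_mono\<close>)
  then show "0 \<in> Hs0 \<Omega> s"
    unfolding Hs0_iff Hs_iff using subspace_0[OF subspace_L2_on] by auto
  show "u + v \<in> Hs0 \<Omega> s" if "u \<in> Hs0 \<Omega> s" "v \<in> Hs0 \<Omega> s" for u v
  proof -
    have "integrable lborel2 (\<lambda>z. (gagliardo s u z + gagliardo s v z)\<^sup>2)"
      using that by (intro integrable_square_add) (auto simp: Hs0_iff Hs_iff)
    then have "integrable lborel2 (\<lambda>z. (gagliardo s (u + v) z)\<^sup>2)"
      by (rule integrable_AE_cong)
        (use gagliardo_linear(1)[of s u v] in \<open>auto elim!: eventually_mono\<close>)
    then show ?thesis using that subspace_add[OF subspace_L2_on] by (auto simp: Hs0_iff Hs_iff)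
  qed
  show "c *\<^sub>R u \<in> Hs0 \<Omega> s" if "u \<in> Hs0 \<Omega> s" for c u
  proof -
    have "integrable lborel2 (\<lambda>z. c\<^sup>2 * (gagliardo s u z)\<^sup>2)"
      using that by (intro integrable_mult_right) (auto simp: Hs0_iff Hs_iff)
    then have "integrable lborel2 (\<lambda>z. (gagliardo s (c *\<^sub>R u) z)\<^sup>2)"
      by (rule integrable_AE_cong)
        (use gagliardo_linear(3)[of s c u] in \<open>auto simp: power_mult_distrib elim!: eventually_mono\<close>)
    then show ?thesis using that subspace_scale[OF subspace_L2_on] by (auto simp: Hs0_iff Hs_iff)
  qed
qed

lemma frac_form_eq:
  fixes u v :: "'a::euclidean_space L2fun"
  assumes u: "u \<in> L2_on \<Omega>" and \<Omega>: "\<Omega> \<in> sets borel"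
  shows "frac_form \<Omega> s u v = u \<bullet> v +
    frac_const DIM('a) s / 2 * (\<integral>z. gagliardo s u z * gagliardo s v z \<partial>lborel2)"
proof -
  have "set_lebesgue_integral lborel \<Omega> (\<lambda>x. L2_fun u x * L2_fun v x) = u \<bullet> v"
    unfolding inner_L2fun_eq set_lebesgue_integral_def
  proof (rule integral_cong_AE)
    have "AE x in lborel. x \<notin> \<Omega> \<longrightarrow> L2_fun u x = 0" using u by (auto simp: L2_on_def)
    then show "AE x in lborel. indicator \<Omega> x *\<^sub>R (L2_fun u x * L2_fun v x) = L2_fun u x * L2_fun v x"
      by eventually_elim (auto simp: indicator_def)
  qed (use \<Omega> in measurable)
  then show ?thesis by (simp add: frac_form_def gagliardo_mult case_prod_unfold)
qed

lemma frac_const_pos: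
  assumes "0 < s" "s < 1"
  shows "0 < frac_const N s"
  using assms by (auto simp: frac_const_def intro!: divide_pos_pos mult_pos_pos Gamma_real_pos)

lemma nn_integral_gagliardo:
  "u \<in> Hs s \<Longrightarrow> (\<integral>\<^sup>+z. ennreal ((gagliardo s u z)\<^sup>2) \<partial>lborel2) =
    ennreal (\<integral>z. gagliardo s u z * gagliardo s u z \<partial>lborel2)"
  by (subst nn_integral_eq_integral) (auto simp: Hs_iff power2_eq_square)

context
  fixes \<Omega> :: "'a::euclidean_space set" and s :: real
  assumes \<Omega>: "\<Omega> \<in> sets borel" and s: "0 < s" "s < 1"
begin

lemma gagliardo_le_frac_form:
  assumes "u \<in> Hs0 \<Omega> s"
  shows "(\<integral>z. gagliardo s u z * gagliardo s u z \<partial>lborel2) \<le> 2 / frac_const DIM('a) s * frac_form \<Omega> s u u"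
  using assms frac_const_pos[OF s, of "DIM('a)"] inner_ge_zero[of u]
  by (subst frac_form_eq) (auto simp: \<Omega> Hs0_iff divide_simps algebra_simps)

lemma inner_le_frac_form:
  assumes "u \<in> Hs0 \<Omega> s"
  shows "u \<bullet> u \<le> frac_form \<Omega> s u u"
proof -
  have "0 \<le> (\<integral>z. gagliardo s u z * gagliardo s u z \<partial>lborel2)"
    by (rule Bochner_Integration.integral_nonneg) simp
  then show ?thesis using assms frac_const_pos[OF s, of "DIM('a)"]
    by (subst frac_form_eq) (auto simp: \<Omega> Hs0_iff)
qed

text \<open>For completeness: coercivity makes the sequence Cauchy in L^2, so a subsequence
  converges a.e., and so do the difference quotients at almost all pairs. Fatou then bounds the
  Gagliardo integral of X n - u. In particular one X n0 - u lies in the space, hence u does.\<close>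

lemma hilbert_form_Hs0: "hilbert_form (Hs0 \<Omega> s) (frac_form \<Omega> s)"
proof
  let ?V = "Hs0 \<Omega> s" and ?a = "frac_form \<Omega> s"
  let ?G = "\<lambda>u v. \<integral>z. gagliardo s u z * gagliardo s v z \<partial>lborel2"
  note [simp] = frac_form_eq[OF _ \<Omega>] 
  note mem = subspace_add[OF subspace_Hs0] subspace_scale[OF subspace_Hs0]
  show "subspace ?V" by (rule subspace_Hs0)
  show "?a (u + v) w = ?a u w + ?a v w" if "u \<in> ?V" "v \<in> ?V" "w \<in> ?V" for u v w
  proof -
    have "?G (u + v) w = (\<integral>z. gagliardo s u z * gagliardo s w z + gagliardo s v z * gagliardo s w z \<partial>lborel2)"
      by (rule integral_cong_AE) (use gagliardo_linear(1)[of s u v] in \<open>auto simp: algebra_simps elim!: eventually_mono\<close>)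
    also have "\<dots> = ?G u w + ?G v w"
      using that by (intro Bochner_Integration.integral_add gagliardo_mult_integrable) (auto simp: Hs0_iff)
    finally show ?thesis using that mem(1)[of u \<Omega> s v] by (simp add: Hs0_iff inner_add_left algebra_simps)
  qed
  show "?a (c *\<^sub>R u) v = c * ?a u v" if "u \<in> ?V" "v \<in> ?V" for c u v
  proof -
    have "?G (c *\<^sub>R u) v = (\<integral>z. c * (gagliardo s u z * gagliardo s v z) \<partial>lborel2)"
      by (rule integral_cong_AE) (use gagliardo_linear(3)[of s c u] in \<open>auto simp: algebra_simps elim!: eventually_mono\<close>)
    then show ?thesis using that mem(2)[of u \<Omega> s c] by (simp add: Hs0_iff algebra_simps)
  qed
  show "?a u v = ?a v u" if "u \<in> ?V" "v \<in> ?V" for u v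
    using that by (simp add: Hs0_iff inner_commute mult.commute)
  show "0 < ?a u u" if "u \<in> ?V" "u \<noteq> 0" for u
    using inner_le_frac_form[OF that(1)] that(2) inner_gt_zero_iff[of u] by linarith
  show "\<exists>x\<in>?V. (\<lambda>n. ?a (X n - x) (X n - x)) \<longlonglongrightarrow> 0"
    if X: "\<And>n. X n \<in> ?V" and Cauchy: "\<And>e. 0 < e \<Longrightarrow> \<exists>N. \<forall>m\<ge>N. \<forall>n\<ge>N. ?a (X m - X n) (X m - X n) < e"
    for X :: "nat \<Rightarrow> 'a L2fun"
  proof -
    have diff: "X m - X n \<in> ?V" for m n using X subspace_diff[OF subspace_Hs0] by blast
    have "\<exists>N. \<forall>m\<ge>N. \<forall>n\<ge>N. (X m - X n) \<bullet> (X m - X n) < e" if "0 < e" for e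
      using Cauchy[OF that] inner_le_frac_form[OF diff] by (meson le_less_trans)
    then obtain u r where u: "strict_mono r" "AE x in lborel. (\<lambda>n. L2_fun (X (r n)) x) \<longlonglongrightarrow> L2_fun u x"
      "(\<lambda>n. (X n - u) \<bullet> (X n - u)) \<longlonglongrightarrow> 0"
      by (rule L2fun_Cauchy_limit[of X]) blast
    have u_mem: "u \<in> L2_on \<Omega>" using L2_on_AE_limit[of X \<Omega> r u] u(2) X by (simp add: Hs0_iff)
    have lim: "AE z in lborel2. (\<lambda>m. gagliardo s (X n) z - gagliardo s (X (r m)) z) \<longlonglongrightarrow> gagliardo s (X n) z - gagliardo s u z" for n
      using AE_lborel_pair[OF u(2)]
    proof eventually_elim
      case (elim z)
      then show ?case unfolding gagliardo_def divide_inverse by (intro tendsto_intros) auto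
    qed
    let ?c = "2 / frac_const DIM('a) s"
    have c: "?c > 0" using frac_const_pos[OF s] by simp
    have nn: "(\<integral>\<^sup>+z. ennreal ((gagliardo s v z - gagliardo s w z)\<^sup>2) \<partial>lborel2) =
        (\<integral>\<^sup>+z. ennreal ((gagliardo s (v - w) z)\<^sup>2) \<partial>lborel2)" for v w :: "'a L2fun"
      by (rule nn_integral_cong_AE) (use gagliardo_linear(2)[of s v w] in \<open>auto elim!: eventually_mono\<close>)
    have bound: "\<exists>N. \<forall>n\<ge>N. (\<integral>\<^sup>+z. ennreal ((gagliardo s (X n - u) z)\<^sup>2) \<partial>lborel2) \<le> ennreal e"
      if e: "0 < e" for e
    proof -
      obtain N where N: "\<And>m n. m \<ge> N \<Longrightarrow> n \<ge> N \<Longrightarrow> ?a (X m - X n) (X m - X n) < e / ?c"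
        using Cauchy[of "e / ?c"] e c by auto
      have "(\<integral>\<^sup>+z. ennreal ((gagliardo s (X n - u) z)\<^sup>2) \<partial>lborel2) \<le> ennreal e" if n: "n \<ge> N" for n
        unfolding nn[symmetric]
      proof (rule nn_integral_square_le_of_AE_limit[OF _ lim])
        show "\<forall>\<^sub>F m in sequentially.
          (\<integral>\<^sup>+z. ennreal ((gagliardo s (X n) z - gagliardo s (X (r m)) z)\<^sup>2) \<partial>lborel2) \<le> ennreal e"
          unfolding eventually_sequentially
        proof (intro exI allI impI)
          fix m assume "N \<le> m"
          then have "N \<le> r m" using seq_suble[OF u(1), of m] by linarith
          have "?G (X n - X (r m)) (X n - X (r m)) \<le> ?c * ?a (X n - X (r m)) (X n - X (r m))"
            by (rule gagliardo_le_frac_form[OF diff])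
          also have "\<dots> \<le> e" using mult_left_mono[OF less_imp_le[OF N[OF n \<open>N \<le> r m\<close>]], of ?c] c
            by (simp del: frac_form_eq)
          finally show "(\<integral>\<^sup>+z. ennreal ((gagliardo s (X n) z - gagliardo s (X (r m)) z)\<^sup>2) \<partial>lborel2) \<le> ennreal e"
            unfolding nn using diff[of n "r m"] by (simp add: nn_integral_gagliardo Hs0_iff ennreal_leI)
        qed
      qed measurable
      then show ?thesis by blast
    qed
    obtain n0 where "(\<integral>\<^sup>+z. ennreal ((gagliardo s (X n0 - u) z)\<^sup>2) \<partial>lborel2) \<le> ennreal 1"
      using bound[of 1] by auto
    then have "X n0 - u \<in> Hs s"
      unfolding Hs_iff by (intro integrableI_bounded) (auto intro: le_less_trans)
    moreover have "X n0 - u \<in> L2_on \<Omega>" using X u_mem subspace_diff[OF subspace_L2_on] by (auto simp: Hs0_iff)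
    ultimately have "X n0 - u \<in> ?V" by (simp add: Hs0_iff)
    from subspace_diff[OF subspace_Hs0 X[of n0] this] have uV: "u \<in> ?V" by simp
    have XuV: "X n - u \<in> ?V" for n by (rule subspace_diff[OF subspace_Hs0 X uV])
    have "(\<lambda>n. ?G (X n - u) (X n - u)) \<longlonglongrightarrow> 0"
    proof (rule LIMSEQ_I)
      fix e :: real assume e: "0 < e"
      then obtain N where N: "\<And>n. n \<ge> N \<Longrightarrow>
          (\<integral>\<^sup>+z. ennreal ((gagliardo s (X n - u) z)\<^sup>2) \<partial>lborel2) \<le> ennreal (e / 2)"
        using bound[of "e / 2"] by auto
      have "norm (?G (X n - u) (X n - u) - 0) < e" if "n \<ge> N" for n
      proof -
        have "?G (X n - u) (X n - u) \<le> e / 2"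
          using N[OF that] XuV[of n] e by (simp add: nn_integral_gagliardo Hs0_iff)
        moreover have "0 \<le> ?G (X n - u) (X n - u)" by (rule Bochner_Integration.integral_nonneg) simp
        ultimately show ?thesis using e by simp
      qed
      then show "\<exists>no. \<forall>n\<ge>no. norm (?G (X n - u) (X n - u) - 0) < e" by blast
    qed
    then have "(\<lambda>n. (X n - u) \<bullet> (X n - u) + frac_const DIM('a) s / 2 * ?G (X n - u) (X n - u)) \<longlonglongrightarrow> 0 + frac_const DIM('a) s / 2 * 0"
      by (intro tendsto_intros u)
    moreover have "(X n - u) \<bullet> (X n - u) + frac_const DIM('a) s / 2 * ?G (X n - u) (X n - u) = ?a (X n - u) (X n - u)" for n
      using XuV[of n] by (simp add: Hs0_iff)
    ultimately have "(\<lambda>n. ?a (X n - u) (X n - u)) \<longlonglongrightarrow> 0"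
      by (simp only: mult_zero_right add_0)
    then show ?thesis using uV by blast
  qed
qed

end

section \<open>Compactness of the embedding\<close>

lemma
  fixes f g :: "'a::euclidean_space \<Rightarrow> real"
  assumes f: "integrable lborel f" and g: "integrable lborel g"
  shows integrable_lborel_pair_mult: "integrable lborel2 (\<lambda>z. f (fst z) * g (snd z))"
    and integral_lborel_pair_mult:
      "(\<integral>z. f (fst z) * g (snd z) \<partial>lborel2) = integral\<^sup>L lborel f * integral\<^sup>L lborel g"
proof -
  have [measurable]: "f \<in> borel_measurable borel" "g \<in> borel_measurable borel"
    using borel_measurable_integrable[OF f] borel_measurable_integrable[OF g] by simp_all
  show int: "integrable lborel2 (\<lambda>z. f (fst z) * g (snd z))"
    by (rule lborel_pair.Fubini_integrable) (use f g in \<open>auto simp: abs_mult\<close>)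
  show "(\<integral>z. f (fst z) * g (snd z) \<partial>lborel2) = integral\<^sup>L lborel f * integral\<^sup>L lborel g"
    using lborel_pair.integral_fst'[OF int] by simp
qed

lemma integrable_L2_fun_indicator:
  assumes Q: "Q \<in> sets borel" "emeasure lborel Q < \<infinity>"
  shows "integrable lborel (\<lambda>x. indicator Q x * L2_fun u x)"
proof -
  have "integrable lborel (\<lambda>x. indicator Q x * L2_fun u x :: real)"
  proof (rule integrable_square_mult)
    show "integrable lborel (\<lambda>x. (indicator Q x :: real)\<^sup>2)"
      using Q by (simp add: power2_eq_square flip: indicator_inter_arith)
  qed (use Q in \<open>auto intro: L2_fun_square_integrable\<close>)
  then show ?thesis .
qed

text \<open>Expanding the square gives
  \<open>\<integral>\<integral>\<^bsub>Q\<times>Q\<^esub> (u x - u y)\<^sup>2 = 2 \<bar>Q\<bar> \<integral>\<^bsub>Q\<^esub> u\<^sup>2 - 2 (\<integral>\<^bsub>Q\<^esub> u)\<^sup>2\<close>.\<close>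

lemma Poincare_cell:
  fixes u :: "'a::euclidean_space L2fun"
  assumes Q: "Q \<in> sets borel" "emeasure lborel Q = ennreal q" "0 < q"
    and diam: "\<And>x y. x \<in> Q \<Longrightarrow> y \<in> Q \<Longrightarrow> norm (x - y) \<le> d"
    and u: "u \<in> Hs s" and s: "0 < s"
  shows "(\<integral>x. indicator Q x * (L2_fun u x)\<^sup>2 \<partial>lborel) \<le>
    d powr (real DIM('a) + 2 * s) / (2 * q) *
      (\<integral>z. indicator (Q \<times> Q) z * (gagliardo s u z)\<^sup>2 \<partial>lborel2) +
    (\<integral>x. indicator Q x * L2_fun u x \<partial>lborel)\<^sup>2 / q"
proof -
  let ?L = "lborel2 :: ('a \<times> 'a) measure"
  let ?p = "real DIM('a) + 2 * s"
  define f where "f x = indicator Q x * L2_fun u x" for x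
  define F where "F x = indicator Q x * (L2_fun u x)\<^sup>2" for x
  define k where "k x = (indicator Q x :: real)" for x :: 'a
  have f: "integrable lborel f" unfolding f_def using Q by (intro integrable_L2_fun_indicator) auto
  have F: "integrable lborel F"
    unfolding F_def using integrable_mult_indicator[OF _ L2_fun_square_integrable[of u], of Q] Q by simp
  have k: "integrable lborel k" "integral\<^sup>L lborel k = q"
    unfolding k_def[abs_def] using Q by (auto simp: measure_def)
  have expand: "indicator (Q \<times> Q) z * (L2_fun u (fst z) - L2_fun u (snd z))\<^sup>2 =
      F (fst z) * k (snd z) + k (fst z) * F (snd z) - 2 * (f (fst z) * f (snd z))" for z
    by (auto simp: indicator_def F_def k_def f_def mem_Times_iff power2_eq_square algebra_simps)
  have int: "integrable ?L (\<lambda>z. indicator (Q \<times> Q) z * (L2_fun u (fst z) - L2_fun u (snd z))\<^sup>2)"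
    unfolding expand using f F k
    by (intro Bochner_Integration.integrable_add Bochner_Integration.integrable_diff integrable_mult_right integrable_lborel_pair_mult)
  have "(\<integral>z. indicator (Q \<times> Q) z * (L2_fun u (fst z) - L2_fun u (snd z))\<^sup>2 \<partial>?L) =
      2 * q * integral\<^sup>L lborel F - 2 * (integral\<^sup>L lborel f)\<^sup>2"
    unfolding expand using f F k
    by (simp add: integrable_lborel_pair_mult integral_lborel_pair_mult power2_eq_square)
  moreover have "(\<integral>z. indicator (Q \<times> Q) z * (L2_fun u (fst z) - L2_fun u (snd z))\<^sup>2 \<partial>?L) \<le>
      (\<integral>z. d powr ?p * (indicator (Q \<times> Q) z * (gagliardo s u z)\<^sup>2) \<partial>?L)"
  proof (rule integral_mono[OF int])
    have "Q \<times> Q \<in> sets ?L" using Q by auto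
    then show "integrable ?L (\<lambda>z. d powr ?p * (indicator (Q \<times> Q) z * (gagliardo s u z)\<^sup>2))"
      using integrable_mult_indicator[of "Q \<times> Q" ?L "\<lambda>z. (gagliardo s u z)\<^sup>2"] u
      by (auto simp: Hs_iff)
    fix z :: "'a \<times> 'a"
    \<comment> \<open>Off Q x Q and on the diagonal both sides are 0; elsewhere |x - y| <= d trades
      the singular weight for the power of d.\<close>
    show "indicator (Q \<times> Q) z * (L2_fun u (fst z) - L2_fun u (snd z))\<^sup>2 \<le>
        d powr ?p * (indicator (Q \<times> Q) z * (gagliardo s u z)\<^sup>2)"
    proof (cases "z \<in> Q \<times> Q \<and> fst z \<noteq> snd z")
      case True
      then have le: "norm (fst z - snd z) powr ?p \<le> d powr ?p"
        using diam[of "fst z" "snd z"] s by (intro powr_mono2) auto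
      have "(L2_fun u (fst z) - L2_fun u (snd z))\<^sup>2 = norm (fst z - snd z) powr ?p * (gagliardo s u z)\<^sup>2"
        using True by (simp add: power2_eq_square gagliardo_mult)
      also have "\<dots> \<le> d powr ?p * (gagliardo s u z)\<^sup>2" using le by (rule mult_right_mono) simp
      finally show ?thesis using True by simp
    qed (auto simp: indicator_def)
  qed
  ultimately have "2 * q * integral\<^sup>L lborel F - 2 * (integral\<^sup>L lborel f)\<^sup>2 \<le>
      d powr ?p * (\<integral>z. indicator (Q \<times> Q) z * (gagliardo s u z)\<^sup>2 \<partial>?L)" by simp
  then show ?thesis using Q(3) unfolding f_def[abs_def, symmetric] F_def[abs_def, symmetric]
    by (simp add: field_simps)
qed

text \<open>Only an inequality, because it is applied to the diagonal blocks cell x cell, which do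
  not cover all pairs.\<close>

lemma integral_partition_le:
  fixes G :: "'b \<Rightarrow> real"
  assumes K: "finite K" and disj: "disjoint_family_on R K" and R: "\<And>k. k \<in> K \<Longrightarrow> R k \<in> sets M"
    and G: "integrable M G" "\<And>x. 0 \<le> G x"
  shows "(\<Sum>k\<in>K. \<integral>x. indicator (R k) x * G x \<partial>M) \<le> integral\<^sup>L M G"
proof -
  have int: "integrable M (\<lambda>x. indicator (R k) x * G x)" if "k \<in> K" for k
    using integrable_mult_indicator[OF R[OF that] G(1)] by simp
  have "(\<Sum>k\<in>K. \<integral>x. indicator (R k) x * G x \<partial>M) = (\<integral>x. (\<Sum>k\<in>K. indicator (R k) x * G x) \<partial>M)"
    using int by (rule Bochner_Integration.integral_sum[symmetric])
  also have "\<dots> \<le> integral\<^sup>L M G"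
  proof (rule integral_mono)
    fix x
    have "(\<Sum>k\<in>K. indicator (R k) x * G x) = indicator (\<Union>k\<in>K. R k) x * G x"
      by (simp add: indicator_UN_disjoint[OF K disj] sum_distrib_right)
    also have "\<dots> \<le> G x" using G(2)[of x] by (simp add: indicator_def)
    finally show "(\<Sum>k\<in>K. indicator (R k) x * G x) \<le> G x" .
  qed (use int G in auto)
  finally show ?thesis .
qed

section \<open>Grids of half-open cubes\<close>

text \<open>For h > 0, the half-open cube of side h with lowest corner h k. The index k is read only
  on \<open>Basis\<close>; inside \<open>PiE Basis\<close> distinct indices give disjoint
  cells.\<close>

definition cell :: "real \<Rightarrow> ('a::euclidean_space \<Rightarrow> int) \<Rightarrow> 'a set" where
  "cell h k = {x. \<forall>b\<in>Basis. \<lfloor>x \<bullet> b / h\<rfloor> = k b}"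

lemma cell_measurable [measurable]: "cell h k \<in> sets borel"
proof -
  have "{x \<in> space borel. \<forall>b\<in>Basis. \<lfloor>x \<bullet> b / h\<rfloor> = k b} \<in> sets (borel :: 'a measure)"
    by measurable
  then show ?thesis by (simp add: cell_def)
qed

lemma cell_disjoint: "disjoint_family_on (cell h) (PiE Basis A)"
proof (unfold disjoint_family_on_def, intro ballI impI, rule ccontr)
  fix j k assume jk: "j \<in> PiE Basis A" "k \<in> PiE Basis A" "j \<noteq> k" "cell h j \<inter> cell h k \<noteq> {}"
  then obtain x where "x \<in> cell h j" "x \<in> cell h k" by blast
  then have "j b = k b" if "b \<in> Basis" for b using that by (simp add: cell_def)
  then show False using PiE_ext[OF jk(1,2)] jk(3) by blast
qed

text \<open>The cell lies between the open and the closed box with the same corners, and these have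
  equal volume.\<close>

lemma emeasure_cell:
  assumes h: "0 < h"
  shows "emeasure lborel (cell h k :: 'a::euclidean_space set) = ennreal (h ^ DIM('a))"
proof -
  define p where "p = (\<Sum>b\<in>Basis. (of_int (k b) * h) *\<^sub>R b :: 'a)"
  define q where "q = (\<Sum>b\<in>Basis. ((of_int (k b) + 1) * h) *\<^sub>R b :: 'a)"
  have p: "p \<bullet> b = of_int (k b) * h" and q: "q \<bullet> b = (of_int (k b) + 1) * h" if "b \<in> Basis" for b
    using that by (simp_all add: p_def q_def)
  have le: "p \<bullet> b \<le> q \<bullet> b" if "b \<in> Basis" for b using h that by (simp add: p q)
  have iff: "\<lfloor>t / h\<rfloor> = j \<longleftrightarrow> of_int j * h \<le> t \<and> t < (of_int j + 1) * h" for t j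
    using h by (simp add: floor_eq_iff field_simps)
  have "box p q \<subseteq> cell h k" "cell h k \<subseteq> cbox p q"
    by (auto simp: cell_def iff box_def cbox_def p q)
  then have "emeasure lborel (box p q) \<le> emeasure lborel (cell h k)"
      "emeasure lborel (cell h k) \<le> emeasure lborel (cbox p q)"
    by (auto intro!: emeasure_mono)
  moreover have "(\<Prod>b\<in>Basis. (q - p) \<bullet> b) = h ^ DIM('a)"
    by (simp add: inner_diff_left p q algebra_simps)
  ultimately show ?thesis using le by (simp add: antisym)
qed

text \<open>The l^1 estimate gives N h instead of the sharp sqrt N h; the factor only enters the
  constant C of the embedding.\<close>

lemma cell_diameter:
  fixes x y :: "'a::euclidean_space"
  assumes h: "0 < h" and xy: "x \<in> cell h k" "y \<in> cell h k"
  shows "norm (x - y) \<le> real DIM('a) * h"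
proof -
  have "\<bar>(x - y) \<bullet> b\<bar> \<le> h" if b: "b \<in> Basis" for b
  proof -
    have "\<lfloor>x \<bullet> b / h\<rfloor> = \<lfloor>y \<bullet> b / h\<rfloor>" using xy b by (simp add: cell_def)
    then have "\<bar>x \<bullet> b / h - y \<bullet> b / h\<bar> \<le> 1" by linarith
    then have "\<bar>(x - y) \<bullet> b / h\<bar> \<le> 1" by (simp add: inner_diff_left diff_divide_distrib)
    then show ?thesis using h by (simp add: abs_divide field_simps)
  qed
  then have "(\<Sum>b\<in>Basis. \<bar>(x - y) \<bullet> b\<bar>) \<le> real DIM('a) * h"
    using sum_bounded_above[of "Basis :: 'a set" "\<lambda>b. \<bar>(x - y) \<bullet> b\<bar>" h] by simp
  then show ?thesis using norm_le_l1[of "x - y"] by linarith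
qed

lemma bounded_subset_cells:
  fixes \<Omega> :: "'a::euclidean_space set"
  assumes h: "0 < h" and \<Omega>: "bounded \<Omega>"
  obtains m :: int where "\<Omega> \<subseteq> (\<Union>k\<in>PiE Basis (\<lambda>_. {-m..m}). cell h k)"
proof -
  obtain R where R: "\<And>x. x \<in> \<Omega> \<Longrightarrow> norm x \<le> R" using \<Omega> by (auto simp: bounded_iff)
  define m where "m = \<lceil>R / h\<rceil> + 1"
  have "x \<in> (\<Union>k\<in>PiE Basis (\<lambda>_. {-m..m}). cell h k)" if x: "x \<in> \<Omega>" for x
  proof
    let ?k = "\<lambda>b\<in>Basis. \<lfloor>x \<bullet> b / h\<rfloor>"
    show "x \<in> cell h ?k" by (simp add: cell_def)
    have "\<lfloor>x \<bullet> b / h\<rfloor> \<in> {-m..m}" if b: "b \<in> Basis" for b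
    proof -
      have "\<bar>x \<bullet> b\<bar> \<le> R" using Basis_le_norm[OF b, of x] R[OF x] by linarith
      then have "\<bar>x \<bullet> b / h\<bar> \<le> R / h" using h by (simp add: abs_divide divide_right_mono)
      then have "x \<bullet> b / h \<le> R / h" "- (R / h) \<le> x \<bullet> b / h" by linarith+
      then show ?thesis unfolding m_def atLeastAtMost_iff by linarith
    qed
    then show "?k \<in> PiE Basis (\<lambda>_. {-m..m})" by auto
  qed
  then show ?thesis using that by blast
qed

definition L2_indicator :: "'a::euclidean_space set \<Rightarrow> 'a L2fun" where
  "L2_indicator Q = abs_L2fun (indicator Q)"

lemma AE_L2_indicator:
  assumes "Q \<in> sets borel" "emeasure lborel Q < \<infinity>"
  shows "AE x in lborel. L2_fun (L2_indicator Q) x = indicator Q x"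
  unfolding L2_indicator_def
  using assms by (intro L2_fun_abs) (auto simp: power2_eq_square simp flip: indicator_inter_arith)

lemma inner_L2_indicator:
  assumes "Q \<in> sets borel" "emeasure lborel Q < \<infinity>"
  shows "u \<bullet> L2_indicator Q = (\<integral>x. indicator Q x * L2_fun u x \<partial>lborel)"
proof -
  show ?thesis
    unfolding inner_L2fun_eq using AE_L2_indicator[OF assms] assms
    by (intro integral_cong_AE) (auto elim!: eventually_mono)
qed

lemma inner_L2_indicators:
  assumes "P \<in> sets borel" "emeasure lborel P < \<infinity>" "Q \<in> sets borel" "emeasure lborel Q < \<infinity>"
  shows "L2_indicator P \<bullet> L2_indicator Q = measure lborel (P \<inter> Q)"
proof -
  have "(\<integral>x. indicator Q x * L2_fun (L2_indicator P) x \<partial>lborel) = (\<integral>x. indicator (P \<inter> Q) x \<partial>lborel)"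
    using AE_L2_indicator[OF assms(1,2)] assms
    by (intro integral_cong_AE) (auto simp: indicator_def elim!: eventually_mono)
  then show ?thesis using assms by (simp add: inner_L2_indicator)
qed

text \<open>Summing the Poincare inequality over a grid covering \<Omega> leaves two terms: the cell
  means, which are the finitely many functionals, and the Gagliardo energy of the diagonal blocks
  with a factor proportional to h^(2 s). A fine grid makes this factor \<epsilon>.\<close>

lemma Hs0_compact_embedding:
  fixes \<Omega> :: "'a::euclidean_space set"
  assumes \<Omega>: "\<Omega> \<in> sets borel" "bounded \<Omega>" and s: "0 < s" "s < 1" and \<epsilon>: "0 < \<epsilon>"
  shows "\<exists>\<Phi>. finite \<Phi> \<and> (\<forall>u\<in>Hs0 \<Omega> s. u \<bullet> u \<le> \<epsilon> * frac_form \<Omega> s u u + (\<Sum>\<phi>\<in>\<Phi>. (u \<bullet> \<phi>)\<^sup>2))"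
proof -
  let ?N = "real DIM('a)"
  \<comment> \<open>C and h solve (N h)^(N + 2 s) / (2 q) * (2 / frac_const) = C h^(2 s) =
    \<epsilon>, where q = h^N is the cell volume.\<close>
  define C where "C = ?N powr (?N + 2 * s) / frac_const DIM('a) s"
  have C: "0 < C" unfolding C_def using frac_const_pos[OF s] by (simp add: DIM_positive)
  define h where "h = (\<epsilon> / C) powr (1 / (2 * s))"
  have h: "0 < h" "h powr (2 * s) = \<epsilon> / C" using \<epsilon> C s by (auto simp: h_def powr_powr)
  define q where "q = h ^ DIM('a)"
  have q: "0 < q" using h by (simp add: q_def)
  obtain m where m: "\<Omega> \<subseteq> (\<Union>k\<in>PiE Basis (\<lambda>_. {-m..m}). cell h k)"
    using bounded_subset_cells[OF h(1) \<Omega>(2)] by blast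
  define K where "K = PiE (Basis :: 'a set) (\<lambda>_. {-m..m})"
  have K: "finite K" "disjoint_family_on (cell h) K"
    unfolding K_def by (auto intro: finite_PiE cell_disjoint)
  have cell: "cell h k \<in> sets borel" "emeasure lborel (cell h k) = ennreal q"
      "emeasure lborel (cell h k) < \<infinity>" for k :: "'a \<Rightarrow> int"
    using h by (auto simp: emeasure_cell q_def)
  \<comment> \<open>The factor 1 / sqrt q turns (u \<bullet> \<phi> k)^2 into the mean-value term
    (integral of u)^2 / q of the Poincare inequality.\<close>
  define \<phi> where "\<phi> k = (1 / sqrt q) *\<^sub>R L2_indicator (cell h k)" for k :: "'a \<Rightarrow> int"
  have ortho: "L2_indicator (cell h k) \<bullet> L2_indicator (cell h j) = (if k = j then q else 0)"
    if "k \<in> K" "j \<in> K" for k j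
    using that cell K(2) q by (auto simp: inner_L2_indicators disjoint_family_on_def measure_def)
  \<comment> \<open>The compactness statement sums over a set of vectors; injectivity lets the sum
    over cells be rewritten in this way.\<close>
  have inj: "inj_on \<phi> K"
  proof (rule inj_onI, rule ccontr)
    fix k j assume kj: "k \<in> K" "j \<in> K" "\<phi> k = \<phi> j" "k \<noteq> j"
    have "\<phi> k \<bullet> L2_indicator (cell h k) = \<phi> j \<bullet> L2_indicator (cell h k)" using kj by simp
    then show False using kj q ortho[of k k] ortho[of j k] by (simp add: \<phi>_def)
  qed
  have "u \<bullet> u \<le> \<epsilon> * frac_form \<Omega> s u u + (\<Sum>f\<in>\<phi> ` K. (u \<bullet> f)\<^sup>2)" if u: "u \<in> Hs0 \<Omega> s" for u
  proof -
    let ?L = "lborel2 :: ('a \<times> 'a) measure"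
    let ?G = "\<integral>z. gagliardo s u z * gagliardo s u z \<partial>?L"
    let ?D = "(?N * h) powr (?N + 2 * s) / (2 * q)"
    have "u \<bullet> u = (\<integral>x. (\<Sum>k\<in>K. indicator (cell h k) x * (L2_fun u x)\<^sup>2) \<partial>lborel)"
      unfolding inner_L2fun_eq
    proof (rule integral_cong_AE)
      have "AE x in lborel. x \<notin> \<Omega> \<longrightarrow> L2_fun u x = 0" using u by (simp add: Hs0_def)
      then show "AE x in lborel. L2_fun u x * L2_fun u x = (\<Sum>k\<in>K. indicator (cell h k) x * (L2_fun u x)\<^sup>2)"
      proof eventually_elim
        case (elim x)
        have "(\<Sum>k\<in>K. indicator (cell h k) x * (L2_fun u x)\<^sup>2) = indicator (\<Union>k\<in>K. cell h k) x * (L2_fun u x)\<^sup>2"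
          by (simp add: indicator_UN_disjoint[OF K] sum_distrib_right)
        also have "\<dots> = L2_fun u x * L2_fun u x"
          using elim m by (auto simp: indicator_def power2_eq_square K_def)
        finally show ?case by simp
      qed
    qed measurable
    also have "\<dots> = (\<Sum>k\<in>K. \<integral>x. indicator (cell h k) x * (L2_fun u x)\<^sup>2 \<partial>lborel)"
      using integrable_mult_indicator[OF _ L2_fun_square_integrable[of u]]
      by (intro Bochner_Integration.integral_sum) auto
    also have "\<dots> \<le> (\<Sum>k\<in>K. ?D * (\<integral>z. indicator (cell h k \<times> cell h k) z * (gagliardo s u z)\<^sup>2 \<partial>?L) +
        (u \<bullet> \<phi> k)\<^sup>2)"
    proof (rule sum_mono)
      fix k
      have "(u \<bullet> \<phi> k)\<^sup>2 = (\<integral>x. indicator (cell h k) x * L2_fun u x \<partial>lborel)\<^sup>2 / q"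
        using q by (simp add: \<phi>_def inner_L2_indicator cell power_divide)
      then show "(\<integral>x. indicator (cell h k) x * (L2_fun u x)\<^sup>2 \<partial>lborel) \<le>
          ?D * (\<integral>z. indicator (cell h k \<times> cell h k) z * (gagliardo s u z)\<^sup>2 \<partial>?L) + (u \<bullet> \<phi> k)\<^sup>2"
        using Poincare_cell[where u = u and s = s, OF cell(1,2)[of k] q cell_diameter[OF h(1)]] u s
        by (simp add: Hs0_iff)
    qed
    also have "\<dots> = ?D * (\<Sum>k\<in>K. \<integral>z. indicator (cell h k \<times> cell h k) z * (gagliardo s u z)\<^sup>2 \<partial>?L) +
        (\<Sum>f\<in>\<phi> ` K. (u \<bullet> f)\<^sup>2)"
      by (simp add: sum.distrib sum_distrib_left sum.reindex[OF inj])
    also have "\<dots> \<le> ?D * ?G + (\<Sum>f\<in>\<phi> ` K. (u \<bullet> f)\<^sup>2)"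
    proof (intro add_right_mono mult_left_mono)
      have "(\<Sum>k\<in>K. \<integral>z. indicator (cell h k \<times> cell h k) z * (gagliardo s u z)\<^sup>2 \<partial>?L) \<le>
          (\<integral>z. (gagliardo s u z)\<^sup>2 \<partial>?L)"
        using K u by (intro integral_partition_le)
          (auto simp: disjoint_family_on_def Hs0_iff Hs_iff intro!: pair_measureI)
      then show "(\<Sum>k\<in>K. \<integral>z. indicator (cell h k \<times> cell h k) z * (gagliardo s u z)\<^sup>2 \<partial>?L) \<le> ?G"
        by (simp add: power2_eq_square)
    qed (use q in auto)
    also have "\<dots> \<le> ?D * (2 / frac_const DIM('a) s * frac_form \<Omega> s u u) + (\<Sum>f\<in>\<phi> ` K. (u \<bullet> f)\<^sup>2)"
      using q by (intro add_right_mono mult_left_mono gagliardo_le_frac_form \<Omega> s u) auto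
    also have "?D * (2 / frac_const DIM('a) s * frac_form \<Omega> s u u) = \<epsilon> * frac_form \<Omega> s u u"
    proof -
      have "(?N * h) powr (?N + 2 * s) = ?N powr (?N + 2 * s) * (q * (\<epsilon> / C))"
        using h by (simp add: powr_mult powr_add powr_realpow q_def)
      then have "?D * (2 / frac_const DIM('a) s) = C * (\<epsilon> / C)"
        using q unfolding C_def by simp
      then have "?D * (2 / frac_const DIM('a) s) = \<epsilon>" using C by simp
      then show ?thesis by (metis mult.assoc)
    qed
    finally show ?thesis .
  qed
  then show ?thesis using K(1) by (intro exI[of _ "\<phi> ` K"]) auto
qed

section \<open>Density of the form domain\<close>

lemma dyadic_bounds_small:
  fixes x :: real
  assumes "0 < x" "x \<le> 1"
  obtains n :: nat where "2 powr (- real n - 1) \<le> x" "x \<le> 2 powr (- real n)"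
proof -
  define n where "n = nat \<lfloor>- log 2 x\<rfloor>"
  have "0 \<le> - log 2 x" using assms by simp
  then have "real n \<le> - log 2 x" "- log 2 x < real n + 1" by (auto simp: n_def)
  then have "2 powr (- real n - 1) \<le> 2 powr (log 2 x)" "2 powr (log 2 x) \<le> 2 powr (- real n)"
    by (auto intro!: powr_mono)
  then show ?thesis using that assms by simp
qed

lemma dyadic_bounds_large:
  fixes x :: real
  assumes "1 \<le> x"
  obtains n :: nat where "2 powr (real n) \<le> x" "x \<le> 2 powr (real n + 1)"
proof -
  define n where "n = nat \<lfloor>log 2 x\<rfloor>"
  have "0 \<le> log 2 x" using assms by simp
  then have "real n \<le> log 2 x" "log 2 x < real n + 1" by (auto simp: n_def)
  then have "2 powr (real n) \<le> 2 powr (log 2 x)" "2 powr (log 2 x) \<le> 2 powr (real n + 1)"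
    by (auto intro!: powr_mono)
  then show ?thesis using that assms by simp
qed

text \<open>A ball of radius r n has volume proportional to r n ^ N, so the hypothesis makes the
  integrals a geometric series.\<close>

lemma nn_integral_sum_balls_finite:
  fixes c r :: "nat \<Rightarrow> real"
  assumes r: "\<And>n. 0 \<le> r n" and c: "\<And>n. 0 \<le> c n"
    and eq: "\<And>n. c n * r n ^ DIM('a::euclidean_space) = C * q ^ n" and q: "0 \<le> q" "q < 1"
  shows "(\<integral>\<^sup>+x. (\<Sum>n. ennreal (c n * indicator (cball 0 (r n)) x)) \<partial>(lborel :: 'a measure)) < \<infinity>"
proof -
  have C: "0 \<le> C" using eq[of 0] r[of 0] c[of 0] by (metis mult.right_neutral mult_nonneg_nonneg power_0 zero_le_power)
  let ?V = "unit_ball_vol DIM('a)"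
  have [measurable]: "(cball 0 t :: 'a set) \<in> sets borel" for t by simp
  have "(\<integral>\<^sup>+x. (\<Sum>n. ennreal (c n * indicator (cball 0 (r n)) x)) \<partial>(lborel :: 'a measure)) =
      (\<Sum>n. \<integral>\<^sup>+x. ennreal (c n * indicator (cball 0 (r n)) x) \<partial>(lborel :: 'a measure))"
    by (rule nn_integral_suminf) measurable
  also have "\<dots> = (\<Sum>n. ennreal (?V * C * q ^ n))"
  proof (rule suminf_cong)
    fix n
    have "(\<integral>\<^sup>+x. ennreal (c n * indicator (cball 0 (r n)) x) \<partial>(lborel :: 'a measure)) =
        (\<integral>\<^sup>+x. ennreal (c n) * indicator (cball 0 (r n)) x \<partial>(lborel :: 'a measure))"
      by (intro nn_integral_cong) (auto simp: indicator_def)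
    also have "\<dots> = ennreal (c n) * ennreal (?V * r n ^ DIM('a))"
      using r by (simp add: nn_integral_cmult_indicator emeasure_cball)
    also have "\<dots> = ennreal (?V * C * q ^ n)"
    proof -
      have "c n * (?V * r n ^ DIM('a)) = ?V * (c n * r n ^ DIM('a))" by simp
      also have "\<dots> = ?V * C * q ^ n" by (simp only: eq mult.assoc)
      finally have *: "c n * (?V * r n ^ DIM('a)) = ?V * C * q ^ n" .
      show ?thesis unfolding ennreal_mult'[OF c, symmetric] * ..
    qed
    finally show "(\<integral>\<^sup>+x. ennreal (c n * indicator (cball 0 (r n)) x) \<partial>(lborel :: 'a measure)) = ennreal (?V * C * q ^ n)" .
  qed
  also have "\<dots> = ennreal (?V * C * (1 / (1 - q)))"
    using q C by (intro suminf_ennreal_eq sums_mult geometric_sums) auto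
  finally show ?thesis by simp
qed

lemma le_suminf_ennreal:
  fixes f :: "nat \<Rightarrow> ennreal"
  shows "f n \<le> (\<Sum>n. f n)"
  using sum_le_suminf[of f "{n}"] by simp

text \<open>Dyadic shells, enlarged to balls, replace polar coordinates. Near 0 the numerator is
  quadratic and the shells contribute a series of ratio 2^(2 s - 2), convergent as s < 1. Far out
  the numerator is at most 1 and the ratio is 2^(- 2 s), convergent as s > 0.\<close>

lemma nn_integral_truncated_kernel_finite:
  fixes L s :: real
  assumes s: "0 < s" "s < 1"
  shows "(\<integral>\<^sup>+x. ennreal (min (L\<^sup>2 * (norm x)\<^sup>2) 1 / norm x powr (real DIM('a) + 2 * s)) \<partial>(lborel :: 'a::euclidean_space measure)) < \<infinity>"
proof -
  let ?N = "real DIM('a)"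
  let ?p = "?N + 2 * s"
  let ?g = "\<lambda>x :: 'a. min (L\<^sup>2 * (norm x)\<^sup>2) 1 / norm x powr ?p"
  \<comment> \<open>An upper bound on the shell between radii 2^(-n-1) and 2^-n: the numerator at
    the outer radius over the denominator at the inner one.\<close>
  define a where "a n = L\<^sup>2 * (2 powr (- real n))\<^sup>2 / (2 powr (- real n - 1)) powr ?p" for n :: nat
  define b where "b n = 1 / (2 powr (real n)) powr ?p" for n :: nat
  have [measurable]: "(cball 0 t :: 'a set) \<in> sets borel" for t by simp
  let ?A = "\<lambda>x :: 'a. \<Sum>n. ennreal (a n * indicator (cball 0 (2 powr (- real n))) x)"
  let ?B = "\<lambda>x :: 'a. \<Sum>n. ennreal (b n * indicator (cball 0 (2 powr (real n + 1))) x)"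
  have A: "(\<integral>\<^sup>+x. ?A x \<partial>lborel) < \<infinity>"
  proof (rule nn_integral_sum_balls_finite)
    show "a n * (2 powr (- real n)) ^ DIM('a) = (L\<^sup>2 * 2 powr ?p) * (2 powr (2 * s - 2)) ^ n" for n
    proof -
      have "(2 powr (- real n))\<^sup>2 = 2 powr (- real n * 2)" "(2 powr (- real n)) ^ DIM('a) = 2 powr (- real n * ?N)"
        by (simp_all add: powr_power mult.commute)
      moreover have "1 / (2 powr (- real n - 1)) powr ?p = 2 powr ((real n + 1) * ?p)"
      proof -
        have "(real n + 1) * ?p = - ((- real n - 1) * ?p)" by (simp only: minus_mult_left) simp
        then show ?thesis unfolding powr_powr by (simp only: powr_minus_divide)
      qed
      ultimately have "a n * (2 powr (- real n)) ^ DIM('a) =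
          L\<^sup>2 * (2 powr (- real n * 2) * 2 powr ((real n + 1) * ?p) * 2 powr (- real n * ?N))"
        by (simp only: a_def times_divide_eq_right[symmetric] divide_inverse mult_1 mult.assoc mult.left_commute)
      also have "\<dots> = L\<^sup>2 * (2 powr ?p * 2 powr ((2 * s - 2) * real n))"
        by (simp add: powr_add[symmetric] algebra_simps)
      finally show ?thesis by (simp add: powr_power mult.commute)
    qed
    have "2 powr (2 * s - 2) < 2 powr 0" using s by (intro powr_less_mono) auto
    then show "2 powr (2 * s - 2) < 1" by simp
  qed (auto simp: a_def)
  have B: "(\<integral>\<^sup>+x. ?B x \<partial>lborel) < \<infinity>"
  proof (rule nn_integral_sum_balls_finite)
    show "b n * (2 powr (real n + 1)) ^ DIM('a) = 2 powr ?N * (2 powr (- 2 * s)) ^ n" for n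
    proof -
      have "b n * (2 powr (real n + 1)) ^ DIM('a) = 2 powr (- (real n * ?p)) * 2 powr ((real n + 1) * ?N)"
        by (simp add: b_def powr_powr powr_power powr_minus_divide mult.commute)
      also have "\<dots> = 2 powr ?N * 2 powr ((- 2 * s) * real n)"
        by (simp add: powr_add[symmetric] algebra_simps)
      finally show ?thesis by (simp add: powr_power mult.commute)
    qed
    have "2 powr (- 2 * s) < 2 powr 0" using s by (intro powr_less_mono) auto
    then show "2 powr (- 2 * s) < 1" by simp
  qed (auto simp: b_def)
  have "ennreal (?g x) \<le> ?A x + ?B x" for x :: 'a
  proof (cases "x = 0")
    case False
    then have x: "0 < norm x" by simp
    show ?thesis
    proof (cases "norm x \<le> 1")
      case True
      then obtain n :: nat where n: "2 powr (- real n - 1) \<le> norm x" "norm x \<le> 2 powr (- real n)"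
        using dyadic_bounds_small[OF x] by blast
      have "?g x \<le> (L\<^sup>2 * (2 powr (- real n))\<^sup>2) / (2 powr (- real n - 1)) powr ?p"
      proof (rule frac_le)
        show "min (L\<^sup>2 * (norm x)\<^sup>2) 1 \<le> L\<^sup>2 * (2 powr (- real n))\<^sup>2"
          using mult_left_mono[OF power_mono[OF n(2), of 2], of "L\<^sup>2"] by (simp add: min.coboundedI1)
        show "(2 powr (- real n - 1)) powr ?p \<le> norm x powr ?p"
          using n s by (intro powr_mono2) auto
      qed auto
      then have "ennreal (?g x) \<le> ennreal (a n * indicator (cball 0 (2 powr (- real n))) x)"
        using n by (intro ennreal_leI) (simp add: a_def)
      also have "\<dots> \<le> ?A x" by (rule le_suminf_ennreal)
      finally show ?thesis by (simp add: add_increasing2)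
    next
      case False
      then obtain n :: nat where n: "2 powr (real n) \<le> norm x" "norm x \<le> 2 powr (real n + 1)"
        using dyadic_bounds_large[of "norm x"] by auto
      have "?g x \<le> 1 / (2 powr (real n)) powr ?p"
      proof (rule frac_le)
        show "(2 powr (real n)) powr ?p \<le> norm x powr ?p"
          using n s by (intro powr_mono2) auto
      qed auto
      then have "ennreal (?g x) \<le> ennreal (b n * indicator (cball 0 (2 powr (real n + 1))) x)"
        using n by (intro ennreal_leI) (simp add: b_def)
      also have "\<dots> \<le> ?B x" by (rule le_suminf_ennreal)
      finally show ?thesis by (simp add: add_increasing)
    qed
  qed simp
  then have "(\<integral>\<^sup>+x. ennreal (?g x) \<partial>lborel) \<le> (\<integral>\<^sup>+x. ?A x + ?B x \<partial>lborel)"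
    by (intro nn_integral_mono) auto
  also have "\<dots> = (\<integral>\<^sup>+x. ?A x \<partial>lborel) + (\<integral>\<^sup>+x. ?B x \<partial>lborel)"
    by (intro nn_integral_add) measurable
  also have "\<dots> < \<infinity>" using A B by simp
  finally show ?thesis .
qed

text \<open>Tonelli and translation invariance factor each summand into the volume of B times the
  integral of g; evenness lets g (x - y) be integrated in y as well as in x.\<close>

lemma nn_integral_convolution_finite:
  fixes g :: "'a::euclidean_space \<Rightarrow> ennreal"
  assumes [measurable]: "g \<in> borel_measurable borel" "B \<in> sets borel"
    and even: "\<And>x. g (- x) = g x"
    and fin: "emeasure lborel B < \<infinity>" "(\<integral>\<^sup>+x. g x \<partial>lborel) < \<infinity>"
  shows "(\<integral>\<^sup>+z. indicator B (fst z) * g (fst z - snd z) + indicator B (snd z) * g (fst z - snd z) \<partial>lborel2) < \<infinity>"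
proof -
  have shift: "(\<integral>\<^sup>+y. g (y - x) \<partial>lborel) = (\<integral>\<^sup>+y. g y \<partial>lborel)" for x
    by (subst (2) lborel_distr_plus[of "- x", symmetric]) (simp add: nn_integral_distr)
  have shift': "(\<integral>\<^sup>+y. g (x - y) \<partial>lborel) = (\<integral>\<^sup>+y. g y \<partial>lborel)" for x
    using shift[of x] even[of "_ - x"] by simp
  have "(\<integral>\<^sup>+z. indicator B (fst z) * g (fst z - snd z) \<partial>lborel2) =
      (\<integral>\<^sup>+x. \<integral>\<^sup>+y. indicator B x * g (x - y) \<partial>lborel \<partial>lborel)"
    by (subst lborel.nn_integral_fst[symmetric]) auto
  also have "\<dots> = (\<integral>\<^sup>+y. g y \<partial>lborel) * emeasure lborel B"
    by (simp add: nn_integral_cmult shift' nn_integral_multc mult.commute)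
  finally have fst: "(\<integral>\<^sup>+z. indicator B (fst z) * g (fst z - snd z) \<partial>lborel2) = (\<integral>\<^sup>+y. g y \<partial>lborel) * emeasure lborel B" .
  have "(\<integral>\<^sup>+z. indicator B (snd z) * g (fst z - snd z) \<partial>lborel2) =
      (\<integral>\<^sup>+y. \<integral>\<^sup>+x. indicator B y * g (x - y) \<partial>lborel \<partial>lborel)"
    by (subst lborel_pair.nn_integral_snd[symmetric]) auto
  also have "\<dots> = (\<integral>\<^sup>+y. g y \<partial>lborel) * emeasure lborel B"
    by (simp add: nn_integral_cmult shift nn_integral_multc mult.commute)
  finally have snd: "(\<integral>\<^sup>+z. indicator B (snd z) * g (fst z - snd z) \<partial>lborel2) = (\<integral>\<^sup>+y. g y \<partial>lborel) * emeasure lborel B" .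
  show ?thesis
    using fin by (subst nn_integral_add) (auto simp: fst snd ennreal_mult_less_top)
qed

text \<open>The squared difference is at most min (L^2 |x - y|^2) 1 and vanishes unless x or y lies
  in \<Omega>, so the double integral is dominated by convolutions of the indicator of \<Omega> with
  the truncated kernel.\<close>

lemma Lipschitz_mem_Hs0:
  fixes v :: "'a::euclidean_space \<Rightarrow> real"
  assumes \<Omega>: "\<Omega> \<in> sets borel" "bounded \<Omega>" and s: "0 < s" "s < 1"
    and Lip: "\<And>x y. \<bar>v x - v y\<bar> \<le> L * norm (x - y)"
    and range: "\<And>x. 0 \<le> v x" "\<And>x. v x \<le> 1" and supp: "\<And>x. x \<notin> \<Omega> \<Longrightarrow> v x = 0"
  shows "abs_L2fun v \<in> Hs0 \<Omega> s" "AE x in lborel. L2_fun (abs_L2fun v) x = v x"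
proof -
  have "continuous_on UNIV v"
  proof (rule continuous_onI)
    fix x e :: real and y :: 'a assume "0 < e"
    then show "\<exists>d>0. \<forall>z\<in>UNIV. dist z y < d \<longrightarrow> dist (v z) (v y) \<le> e"
    proof (intro exI[of _ "e / (\<bar>L\<bar> + 1)"] conjI ballI impI)
      fix z assume z: "dist z y < e / (\<bar>L\<bar> + 1)"
      have "dist (v z) (v y) \<le> L * norm (z - y)" using Lip by (simp add: dist_real_def)
      also have "\<dots> \<le> (\<bar>L\<bar> + 1) * norm (z - y)" by (rule mult_right_mono) auto
      also have "\<dots> \<le> (\<bar>L\<bar> + 1) * (e / (\<bar>L\<bar> + 1))"
        using z by (intro mult_left_mono) (auto simp: dist_norm)
      finally show "dist (v z) (v y) \<le> e" by simp
    qed simp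
  qed
  then have v [measurable]: "v \<in> borel_measurable borel" by (rule borel_measurable_continuous_onI)
  have fin: "emeasure lborel \<Omega> < \<infinity>" using emeasure_bounded_finite[OF \<Omega>(2)] .
  have "integrable lborel (\<lambda>x. (v x)\<^sup>2)"
  proof (rule Bochner_Integration.integrable_bound)
    show "integrable lborel (indicator \<Omega> :: 'a \<Rightarrow> real)" using \<Omega> fin by simp
    have "(v x)\<^sup>2 \<le> indicator \<Omega> x" for x
      using range[of x] supp[of x] by (cases "x \<in> \<Omega>") (auto simp: power_le_one)
    then show "AE x in lborel. norm ((v x)\<^sup>2) \<le> norm (indicator \<Omega> x :: real)" by simp
  qed simp
  then show ae: "AE x in lborel. L2_fun (abs_L2fun v) x = v x" by (intro L2_fun_abs) auto
  let ?p = "real DIM('a) + 2 * s"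
  define g where "g x = ennreal (min (L\<^sup>2 * (norm x)\<^sup>2) 1 / norm x powr ?p)" for x :: 'a
  have [measurable]: "g \<in> borel_measurable borel" unfolding g_def by measurable
  have pointwise: "ennreal ((v (fst z) - v (snd z))\<^sup>2 / norm (fst z - snd z) powr ?p) \<le>
      indicator \<Omega> (fst z) * g (fst z - snd z) + indicator \<Omega> (snd z) * g (fst z - snd z)" for z
  proof (cases "fst z \<in> \<Omega> \<or> snd z \<in> \<Omega>")
    case True
    have "(v (fst z) - v (snd z))\<^sup>2 \<le> L\<^sup>2 * (norm (fst z - snd z))\<^sup>2"
      using power_mono[OF Lip[of "fst z" "snd z"], of 2] by (simp add: power_mult_distrib)
    moreover have "\<bar>v (fst z) - v (snd z)\<bar> \<le> 1"
      using range[of "fst z"] range[of "snd z"] by linarith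
    then have "(v (fst z) - v (snd z))\<^sup>2 \<le> 1" by (simp add: abs_square_le_1)
    ultimately have "ennreal ((v (fst z) - v (snd z))\<^sup>2 / norm (fst z - snd z) powr ?p) \<le> g (fst z - snd z)"
      unfolding g_def by (intro ennreal_leI divide_right_mono) auto
    then show ?thesis using True by (auto simp: indicator_def add_increasing2 add_increasing)
  qed (simp add: supp)
  have "(\<integral>\<^sup>+z. ennreal ((v (fst z) - v (snd z))\<^sup>2 / norm (fst z - snd z) powr ?p) \<partial>lborel2) \<le>
      (\<integral>\<^sup>+z. indicator \<Omega> (fst z) * g (fst z - snd z) + indicator \<Omega> (snd z) * g (fst z - snd z) \<partial>lborel2)"
    by (intro nn_integral_mono pointwise)
  also have "\<dots> < \<infinity>"
    using \<Omega>(1) fin nn_integral_truncated_kernel_finite[OF s, where L = L and 'a = 'a]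
    by (intro nn_integral_convolution_finite) (auto simp: g_def[abs_def])
  finally have lt: "(\<integral>\<^sup>+z. ennreal ((v (fst z) - v (snd z))\<^sup>2 / norm (fst z - snd z) powr ?p) \<partial>lborel2) < \<infinity>" .
  have "abs_L2fun v \<in> Hs s"
    unfolding Hs_iff
  proof (rule integrable_AE_cong)
    show "integrable lborel2 (\<lambda>z. (v (fst z) - v (snd z))\<^sup>2 / norm (fst z - snd z) powr ?p)"
      using lt by (intro integrableI_bounded) auto
    show "AE z in lborel2. (gagliardo s (abs_L2fun v) z)\<^sup>2 =
        (v (fst z) - v (snd z))\<^sup>2 / norm (fst z - snd z) powr ?p"
      using AE_lborel_pair[OF ae]
      by eventually_elim (simp add: power2_eq_square gagliardo_mult)
  qed measurable
  moreover have "abs_L2fun v \<in> L2_on \<Omega>"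
    unfolding L2_on_def using ae supp by (auto elim!: eventually_mono)
  ultimately show "abs_L2fun v \<in> Hs0 \<Omega> s" by (simp add: Hs0_iff)
qed

section \<open>Test functions approximating indicators of open sets\<close>

text \<open>As \<open>ennreal\<close> cuts off negative values, the two densities are the positive
  and negative parts of f. Their finite measures agree on the open sets, an intersection-stable
  generator, hence everywhere; uniqueness of densities makes the parts equal a.e., so f = 0.\<close>

lemma integral_open_sets_zero_imp_AE_zero:
  fixes f :: "'a::euclidean_space \<Rightarrow> real"
  assumes f: "integrable lborel f"
    and zero: "\<And>W. open W \<Longrightarrow> (\<integral>x. indicator W x * f x \<partial>lborel) = 0"
  shows "AE x in lborel. f x = 0"
proof -
  have [measurable]: "f \<in> borel_measurable borel" using borel_measurable_integrable[OF f] by simp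
  have fin: "(\<integral>\<^sup>+x. ennreal (f x) \<partial>lborel) < \<infinity>" "(\<integral>\<^sup>+x. ennreal (- f x) \<partial>lborel) < \<infinity>"
    using f by (simp_all add: real_integrable_def less_top)
  let ?M = "density lborel (\<lambda>x. ennreal (f x))" and ?N = "density lborel (\<lambda>x. ennreal (- f x))"
  have "emeasure ?M UNIV \<noteq> \<infinity>"
    using fin by (subst emeasure_density) auto
  then have "?M = ?N"
  proof (intro measure_eqI_generator_eq[where E = "Collect open" and \<Omega> = UNIV and A = "\<lambda>_. UNIV"])
    fix W :: "'a set" assume "W \<in> Collect open"
    then have W: "open W" by simp
    have int: "integrable lborel (\<lambda>x. indicator W x * f x)"
      using integrable_mult_indicator[OF _ f, of W] W by simp
    have "enn2real (\<integral>\<^sup>+x. ennreal (indicator W x * f x) \<partial>lborel) = enn2real (\<integral>\<^sup>+x. ennreal (- (indicator W x * f x)) \<partial>lborel)"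
      using zero[OF W] real_lebesgue_integral_def[OF int] by simp
    then have "(\<integral>\<^sup>+x. ennreal (indicator W x * f x) \<partial>lborel) = (\<integral>\<^sup>+x. ennreal (- (indicator W x * f x)) \<partial>lborel)"
    proof -
      have "a = b" if "enn2real a = enn2real b" "a \<noteq> \<infinity>" "b \<noteq> \<infinity>" for a b :: ennreal
        using that by (metis ennreal_enn2real infinity_ennreal_def less_top)
      then show ?thesis using int \<open>enn2real _ = _\<close> by (simp add: real_integrable_def)
    qed
    moreover have "(\<integral>\<^sup>+x. ennreal (indicator W x * f x) \<partial>lborel) = emeasure ?M W"
      "(\<integral>\<^sup>+x. ennreal (- (indicator W x * f x)) \<partial>lborel) = emeasure ?N W"
      using W by (auto simp: emeasure_density indicator_def intro!: nn_integral_cong)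
    ultimately show "emeasure ?M W = emeasure ?N W" by simp
  qed (auto simp: Int_stable_def borel_def)
  then have "AE x in lborel. ennreal (f x) = ennreal (- f x)"
    using fin by (subst (asm) sigma_finite_measure.density_unique_iff[OF lborel.sigma_finite_measure_axioms]) auto
  then show ?thesis
  proof eventually_elim
    case (elim x)
    then show ?case by (cases "0 \<le> f x") (auto simp: ennreal_neg ennreal_eq_0_iff)
  qed
qed

text \<open>Orthogonality is tested on cut-offs of the distance to the complement of an open U
  inside \<Omega>. They are Lipschitz, vanish outside U and converge to its indicator, so u has
  integral 0 over every such U.\<close>

lemma Hs0_dense:
  fixes \<Omega> :: "'a::euclidean_space set"
  assumes \<Omega>: "open \<Omega>" "bounded \<Omega>" and s: "0 < s" "s < 1"
    and u: "u \<in> L2_on \<Omega>" and ortho: "\<And>v. v \<in> Hs0 \<Omega> s \<Longrightarrow> u \<bullet> v = 0"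
  shows "u = 0"
proof -
  have fin: "emeasure lborel \<Omega> < \<infinity>" using emeasure_bounded_finite[OF \<Omega>(2)] .
  have [measurable]: "\<Omega> \<in> sets borel" using \<Omega> by simp
  define f where "f x = indicator \<Omega> x * L2_fun u x" for x
  have f_int: "integrable lborel f"
    unfolding f_def
  proof (rule integrable_square_mult)
    show "integrable lborel (\<lambda>x. (indicator \<Omega> x :: real)\<^sup>2)"
      using fin by (simp add: power2_eq_square flip: indicator_inter_arith)
  qed (auto intro: L2_fun_square_integrable)
  have "AE x in lborel. f x = 0"
  proof (rule integral_open_sets_zero_imp_AE_zero[OF f_int])
    fix W :: "'a set" assume W: "open W"
    define U where "U = W \<inter> \<Omega>"
    \<comment> \<open>The complement must be nonempty: the distance to the empty set is 0 by
      convention, and the cut-offs would vanish identically.\<close>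
    have U: "open U" "U \<subseteq> \<Omega>" "- U \<noteq> {}"
    proof -
      have "bounded U" using \<Omega>(2) by (auto simp: U_def intro: bounded_subset)
      then have "U \<noteq> UNIV" using not_bounded_UNIV by metis
      then show "- U \<noteq> {}" by auto
    qed (use W \<Omega> in \<open>auto simp: U_def\<close>)
    define v where "v n x = min 1 (real n * infdist x (- U))" for n :: nat and x
    have Lip: "\<bar>v n x - v n y\<bar> \<le> real n * norm (x - y)" for n x y
    proof -
      have "\<bar>v n x - v n y\<bar> \<le> \<bar>real n * infdist x (- U) - real n * infdist y (- U)\<bar>"
        unfolding v_def by linarith
      also have "\<dots> = real n * \<bar>infdist x (- U) - infdist y (- U)\<bar>"
        by (simp add: abs_mult flip: right_diff_distrib)
      also have "\<dots> \<le> real n * norm (x - y)"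
        using infdist_triangle_abs[of x "- U" y] by (intro mult_left_mono) (auto simp: dist_norm)
      finally show ?thesis .
    qed
    have out: "v n x = 0" if "x \<notin> U" for n x using that by (simp add: v_def)
    have v_range: "0 \<le> v n x" "v n x \<le> 1" for n x by (auto simp: v_def infdist_nonneg)
    note mem = Lipschitz_mem_Hs0[where v = "v _", OF _ \<Omega>(2) s Lip v_range]
    have v_meas [measurable]: "v n \<in> borel_measurable borel" for n
      unfolding v_def by (intro borel_measurable_continuous_onI continuous_intros)
    have lim: "(\<lambda>n. v n x) \<longlonglongrightarrow> indicator U x" for x
    proof (cases "x \<in> U")
      case True
      have "0 < infdist x (- U)"
        using in_closed_iff_infdist_zero[of "- U" x] U True infdist_nonneg[of x "- U"] by (auto simp: less_le)
      then obtain k :: nat where k: "1 < real k * infdist x (- U)" using reals_Archimedean3 by blast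
      have "v n x = 1" if "n \<ge> k" for n
      proof -
        have "real k * infdist x (- U) \<le> real n * infdist x (- U)"
          using that by (intro mult_right_mono infdist_nonneg) auto
        then show ?thesis using k by (simp add: v_def)
      qed
      then have "\<forall>\<^sub>F n in sequentially. v n x = 1" unfolding eventually_sequentially by blast
      then show ?thesis using True by (simp add: tendsto_eventually)
    qed (simp add: out)
    have "(\<lambda>n. \<integral>x. v n x * f x \<partial>lborel) \<longlonglongrightarrow> (\<integral>x. indicator U x * f x \<partial>lborel)"
    proof (rule integral_dominated_convergence[where w = "\<lambda>x. \<bar>f x\<bar>"])
      show "AE x in lborel. (\<lambda>n. v n x * f x) \<longlonglongrightarrow> indicator U x * f x"
        by (intro AE_I2 tendsto_intros lim)
      show "AE x in lborel. norm (v n x * f x) \<le> \<bar>f x\<bar>" for n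
        using v_range[of n] by (intro AE_I2) (simp add: abs_mult mult_left_le_one_le)
    qed (use f_int U(1) in \<open>auto simp: f_def[abs_def]\<close>)
    moreover have "(\<integral>x. v n x * f x \<partial>lborel) = 0" for n
    proof -
      have v: "abs_L2fun (v n) \<in> Hs0 \<Omega> s" "AE x in lborel. L2_fun (abs_L2fun (v n)) x = v n x"
        using mem[of n] out U(2) by auto
      have "(\<integral>x. v n x * f x \<partial>lborel) = u \<bullet> abs_L2fun (v n)"
        unfolding inner_L2fun_eq
      proof (rule integral_cong_AE)
        show "AE x in lborel. v n x * f x = L2_fun u x * L2_fun (abs_L2fun (v n)) x"
          using v(2)
        proof eventually_elim
          case (elim x)
          then show ?case using out[of x n] U(2) by (cases "x \<in> \<Omega>") (auto simp: f_def)
        qed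
      qed (auto simp: f_def[abs_def])
      then show ?thesis using ortho[OF v(1)] by simp
    qed
    ultimately have "(\<integral>x. indicator U x * f x \<partial>lborel) = 0" by (simp add: LIMSEQ_const_iff)
    moreover have "(\<integral>x. indicator W x * f x \<partial>lborel) = (\<integral>x. indicator U x * f x \<partial>lborel)"
      by (rule Bochner_Integration.integral_cong) (auto simp: f_def U_def indicator_def)
    ultimately show "(\<integral>x. indicator W x * f x \<partial>lborel) = 0" by simp
  qed
  moreover have "AE x in lborel. x \<notin> \<Omega> \<longrightarrow> L2_fun u x = 0" using u by (simp add: L2_on_def)
  ultimately have "AE x in lborel. L2_fun u x = L2_fun 0 x"
    using L2_fun_zero by eventually_elim (auto simp: f_def indicator_def split: if_splits)
  then show ?thesis by (rule L2_fun_eqI)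
qed

section \<open>Tikhonov regularization\<close>

text \<open>Weighted AM-GM with weights \<beta> and 1 - \<beta> for the numbers \<tau>/\<beta> and
  \<alpha>/(1 - \<beta>): their weighted mean is \<tau> + \<alpha>, and clearing the denominators
  produces c_\<beta>. The cases \<beta> = 1 and \<tau> = 0 are immediate.\<close>

lemma source_bound:
  fixes \<tau> \<alpha> \<beta> :: real
  assumes "0 \<le> \<tau>" "0 < \<alpha>" "0 < \<beta>" "\<beta> \<le> 1"
  shows "\<alpha> * \<tau> powr \<beta> \<le> source_const \<beta> * \<alpha> powr \<beta> * (\<tau> + \<alpha>)"
proof (cases "\<beta> = 1 \<or> \<tau> = 0")
  case True
  have "0 \<le> source_const \<beta>" by (simp add: source_const_def)
  then show ?thesis
    using True assms by (cases "\<beta> = 1") (auto simp: source_const_def)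
next
  case False
  then have \<tau>: "0 < \<tau>" and \<beta>: "0 < \<beta>" "\<beta> < 1" using assms by auto
  have pos: "0 < \<beta> powr \<beta> * (1 - \<beta>) powr (1 - \<beta>)" using \<beta> by simp
  have "(\<tau> / \<beta>) powr \<beta> * (\<alpha> / (1 - \<beta>)) powr (1 - \<beta>) \<le> \<beta> * (\<tau> / \<beta>) + (1 - \<beta>) * (\<alpha> / (1 - \<beta>))"
    using \<tau> \<beta> assms by (intro Youngs_inequality_0) auto
  also have "\<dots> = \<tau> + \<alpha>" using \<beta> by simp
  finally have "\<tau> powr \<beta> * \<alpha> powr (1 - \<beta>) / (\<beta> powr \<beta> * (1 - \<beta>) powr (1 - \<beta>)) \<le> \<tau> + \<alpha>"
    using \<tau> \<beta> assms by (simp add: powr_divide)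
  then have "\<tau> powr \<beta> * \<alpha> powr (1 - \<beta>) \<le> source_const \<beta> * (\<tau> + \<alpha>)"
    using False \<beta> pos by (simp add: source_const_def pos_divide_le_eq mult.commute)
  then have "\<alpha> powr \<beta> * (\<tau> powr \<beta> * \<alpha> powr (1 - \<beta>)) \<le> \<alpha> powr \<beta> * (source_const \<beta> * (\<tau> + \<alpha>))"
    by (intro mult_left_mono) auto
  moreover have "\<alpha> powr \<beta> * (\<tau> powr \<beta> * \<alpha> powr (1 - \<beta>)) = \<alpha> * \<tau> powr \<beta>"
  proof -
    have "\<alpha> powr \<beta> * \<alpha> powr (1 - \<beta>) = \<alpha>" using assms by (simp add: powr_add[symmetric])
    then show ?thesis by (metis mult.assoc mult.commute)
  qed
  ultimately show ?thesis by (simp add: mult_ac)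
qed

text \<open>Equivalent to (b^2 - \<alpha>)^2 >= 0, with equality at b^2 = \<alpha>.\<close>

lemma filter_bound:
  fixes b \<alpha> :: real
  assumes "0 < \<alpha>"
  shows "(b / (b\<^sup>2 + \<alpha>))\<^sup>2 \<le> 1 / (4 * \<alpha>)"
proof -
  have pos: "0 < b\<^sup>2 + \<alpha>" using assms by (simp add: add_nonneg_pos)
  have "b\<^sup>2 * (4 * \<alpha>) \<le> (b\<^sup>2 + \<alpha>)\<^sup>2"
    using zero_le_power2[of "b\<^sup>2 - \<alpha>"] by (simp add: power2_eq_square algebra_simps)
  then show ?thesis using assms pos by (simp add: power_divide divide_simps)
qed

text \<open>With \<open>k = b \<surd>l\<close>, the scaled error coefficient is
  \<open>(- \<alpha> (b\<^sup>2)\<^sup>\<beta> w + b \<eta>) / (b\<^sup>2 + \<alpha>)\<close>.\<close>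

lemma error_coeff_bound:
  fixes l k u w \<eta> \<alpha> \<beta> :: real
  assumes l: "1 \<le> l" and k: "0 < k" and \<alpha>: "0 < \<alpha>" and \<beta>: "0 < \<beta>" "\<beta> \<le> 1"
    and source: "sqrt l * u = ((k / sqrt l)\<^sup>2) powr \<beta> * w"
  shows "l * (k * (k * u + \<eta>) / (k\<^sup>2 + \<alpha> * l) - u)\<^sup>2 \<le>
    2 * (source_const \<beta>)\<^sup>2 * \<alpha> powr (2 * \<beta>) * w\<^sup>2 + \<eta>\<^sup>2 / (2 * \<alpha>)"
proof -
  define b where "b = k / sqrt l"
  \<comment> \<open>In terms of r = sqrt l the denominator is r^2 (\<tau> + \<alpha>), so scaling
    the error by r removes l from the expression.\<close>
  define r where "r = sqrt l"
  have r: "0 < r" "l = r\<^sup>2" "k = b * r" using l by (auto simp: r_def b_def)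
  define \<tau> where "\<tau> = b\<^sup>2"
  have \<tau>: "0 \<le> \<tau>" by (simp add: \<tau>_def)
  have pos: "0 < \<tau> + \<alpha>" using \<tau> \<alpha> by simp
  \<comment> \<open>X w is the regularization error and Y \<eta> the propagated noise.\<close>
  define X where "X = \<alpha> * \<tau> powr \<beta> / (\<tau> + \<alpha>)"
  define Y where "Y = b / (\<tau> + \<alpha>)"
  have denom: "k\<^sup>2 + \<alpha> * l = r\<^sup>2 * (\<tau> + \<alpha>)"
    by (simp add: r \<tau>_def power_mult_distrib algebra_simps)
  have ru: "r * u = \<tau> powr \<beta> * w" using source by (simp add: r_def \<tau>_def b_def)
  have "r * (k * (k * u + \<eta>) / (k\<^sup>2 + \<alpha> * l) - u) = (b * (b * (r * u) + \<eta>)) / (\<tau> + \<alpha>) - r * u"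
    unfolding denom using r(1) pos by (simp add: r(3) power2_eq_square divide_simps; simp add: algebra_simps)
  also have "\<dots> = Y * \<eta> - X * w"
    unfolding ru X_def Y_def using pos by (simp add: \<tau>_def power2_eq_square divide_simps; simp add: algebra_simps)
  finally have eq: "l * (k * (k * u + \<eta>) / (k\<^sup>2 + \<alpha> * l) - u)\<^sup>2 = (Y * \<eta> - X * w)\<^sup>2"
    by (metis r(2) power_mult_distrib)
  have "0 \<le> X" using \<alpha> pos by (simp add: X_def)
  moreover have "X \<le> source_const \<beta> * \<alpha> powr \<beta>"
    using source_bound[OF \<tau> \<alpha> \<beta>] pos by (simp add: X_def pos_divide_le_eq)
  ultimately have "X\<^sup>2 \<le> (source_const \<beta> * \<alpha> powr \<beta>)\<^sup>2" by (intro power_mono)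
  also have "\<dots> = (source_const \<beta>)\<^sup>2 * \<alpha> powr (2 * \<beta>)"
    using \<alpha> by (simp add: power_mult_distrib powr_power mult.commute)
  finally have X: "X\<^sup>2 * w\<^sup>2 \<le> (source_const \<beta>)\<^sup>2 * \<alpha> powr (2 * \<beta>) * w\<^sup>2" by (rule mult_right_mono) simp
  have "Y\<^sup>2 * \<eta>\<^sup>2 \<le> 1 / (4 * \<alpha>) * \<eta>\<^sup>2"
    using filter_bound[OF \<alpha>, of b] unfolding Y_def \<tau>_def by (rule mult_right_mono) simp
  \<comment> \<open>The 2 in front of X^2 is the 2 of C_1; the other one combines with 1/(4
    \<alpha>) to 1/(2 \<alpha>), hence C_2 = 1/2.\<close>
  moreover have "(Y * \<eta> - X * w)\<^sup>2 \<le> 2 * (X\<^sup>2 * w\<^sup>2) + 2 * (Y\<^sup>2 * \<eta>\<^sup>2)"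
    using zero_le_power2[of "Y * \<eta> + X * w"] by (simp add: power2_eq_square algebra_simps)
  ultimately show ?thesis unfolding eq using X \<alpha> by simp
qed

sublocale form_eigenbasis \<subseteq> A: diagonal_operator H S l "form_op_dom H V a" "form_op H V a"
  by unfold_locales (use form_op_dom_eq form_op_coeff in auto)

section \<open>The operators of the inverse problem in the eigenbasis\<close>

context form_eigenbasis begin

definition calc :: "(real \<Rightarrow> real) \<Rightarrow> 'h \<Rightarrow> 'h" where
  "calc = fun_calc H (form_op_dom H V a) (form_op H V a)"

text \<open>All eigenvalues are at least 1, so a bound on [1, \<infinity>) suffices. It covers exp
  (- t x) and x powr (- 1 / 2).\<close>

lemma
  assumes f: "f \<in> borel_measurable borel" "\<And>x. 1 \<le> x \<Longrightarrow> \<bar>f x\<bar> \<le> 1" and u: "u \<in> H"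
  shows calc_bounded_mem: "calc f u \<in> H"
    and calc_bounded_coeff: "e \<in> S \<Longrightarrow> calc f u \<bullet> e = f (l e) * (u \<bullet> e)"
proof -
  have "(\<lambda>e. (f (l e) * (u \<bullet> e))\<^sup>2) summable_on S"
    by (rule summable_on_square_comparison[OF H.Bessel_summable[OF u], where C = 1])
       (use f(2)[OF eigenvalue_ge_1] in \<open>auto simp: abs_mult mult_left_le_one_le\<close>)
  from A.fun_calc_mem[OF f(1) u this] A.fun_calc_coeff[OF f(1) u this]
  show "calc f u \<in> H" "e \<in> S \<Longrightarrow> calc f u \<bullet> e = f (l e) * (u \<bullet> e)" by (simp_all add: calc_def)
qed

text \<open>The square root is unbounded, but its domain condition is the summability of l e * (u
  \<bullet> e)^2, which is the finiteness of a u u.\<close>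

lemma calc_sqrt_coeff:
  assumes u: "u \<in> V" and e: "e \<in> S"
  shows "calc (\<lambda>x. x powr (1 / 2)) u \<bullet> e = sqrt (l e) * (u \<bullet> e)"
proof -
  have "(\<lambda>e. l e * (u \<bullet> e) * (u \<bullet> e)) summable_on S"
    using form_has_sum[OF u u] by (auto simp: summable_on_def)
  moreover have "(l e powr (1 / 2) * (u \<bullet> e))\<^sup>2 = l e * (u \<bullet> e) * (u \<bullet> e)" if "e \<in> S" for e
    using eigenvalue_ge_1[OF that] by (simp add: powr_half_sqrt power_mult_distrib) (simp add: power2_eq_square)
  ultimately have "(\<lambda>e. (l e powr (1 / 2) * (u \<bullet> e))\<^sup>2) summable_on S" by (simp cong: summable_on_cong)
  with A.fun_calc_coeff[of "\<lambda>x. x powr (1 / 2)" u] u V_subset e show ?thesis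
    using eigenvalue_ge_1[OF e] by (auto simp: calc_def powr_half_sqrt)
qed

context
  fixes t \<alpha> :: real
  assumes t: "0 < t" and \<alpha>: "0 < \<alpha>"
begin

definition K :: "'h \<Rightarrow> 'h" where "K = calc (\<lambda>x. exp (- t * x))"

definition k :: "'h \<Rightarrow> real" where "k e = exp (- t * l e)"

definition b :: "'h \<Rightarrow> real" where "b e = k e / sqrt (l e)"

definition B :: "'h \<Rightarrow> 'h" where "B = K \<circ> calc (\<lambda>x. x powr (- 1 / 2))"

lemma k_pos: "0 < k e" by (simp add: k_def)

lemma k_le_1: "e \<in> S \<Longrightarrow> k e \<le> 1"
  using eigenvalue_ge_1[of e] t by (simp add: k_def)

lemma b_bounds: "e \<in> S \<Longrightarrow> 0 \<le> b e" "e \<in> S \<Longrightarrow> b e \<le> 1"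
proof -
  assume e: "e \<in> S"
  then have "1 \<le> sqrt (l e)" using eigenvalue_ge_1 by simp
  then have "0 < sqrt (l e)" "k e \<le> sqrt (l e)" using k_le_1[OF e] by linarith+
  then show "0 \<le> b e" "b e \<le> 1" using k_pos[of e] by (auto simp: b_def pos_divide_le_eq)
qed

lemma K_mem: "u \<in> H \<Longrightarrow> K u \<in> H"
  and K_coeff: "u \<in> H \<Longrightarrow> e \<in> S \<Longrightarrow> K u \<bullet> e = k e * (u \<bullet> e)"
proof -
  have "\<bar>exp (- t * x)\<bar> \<le> 1" if "1 \<le> x" for x using that t by simp
  note * = calc_bounded_mem[of "\<lambda>x. exp (- t * x)", OF _ this] calc_bounded_coeff[of "\<lambda>x. exp (- t * x)", OF _ this]
  show "u \<in> H \<Longrightarrow> K u \<in> H" "u \<in> H \<Longrightarrow> e \<in> S \<Longrightarrow> K u \<bullet> e = k e * (u \<bullet> e)"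
    using * by (auto simp: K_def k_def)
qed

lemma K_add: "u \<in> H \<Longrightarrow> v \<in> H \<Longrightarrow> K (u + v) = K u + K v"
  by (rule H.eqI) (auto simp: K_mem K_coeff inner_add_left distrib_left)

lemma B_mem: "u \<in> H \<Longrightarrow> B u \<in> H"
  and B_coeff: "u \<in> H \<Longrightarrow> e \<in> S \<Longrightarrow> B u \<bullet> e = b e * (u \<bullet> e)"
proof -
  have le: "\<bar>x powr (- 1 / 2)\<bar> \<le> 1" if "1 \<le> x" for x :: real
    using powr_mono[of "- 1 / 2" 0 x] that by simp
  note * = calc_bounded_mem[of "\<lambda>x. x powr (- 1 / 2)", OF _ le] calc_bounded_coeff[of "\<lambda>x. x powr (- 1 / 2)", OF _ le]
  show "u \<in> H \<Longrightarrow> B u \<in> H" using * by (auto simp: B_def K_mem)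
  show "B u \<bullet> e = b e * (u \<bullet> e)" if "u \<in> H" "e \<in> S"
  proof -
    have "l e powr (- 1 / 2) = 1 / sqrt (l e)"
      using eigenvalue_ge_1[OF that(2)] powr_minus_divide[of "l e" "1/2"] by (simp add: powr_half_sqrt)
    then show ?thesis using that * by (simp add: B_def K_coeff b_def)
  qed
qed

text \<open>B is diagonal with real coefficients, so its adjoint has the same ones; testing with
  basis vectors settles the uniqueness required by \<open>THE\<close>.\<close>

lemma adjoint_B:
  assumes v: "v \<in> H"
  shows "adjoint_on H B v \<in> H" "e \<in> S \<Longrightarrow> adjoint_on H B v \<bullet> e = b e * (v \<bullet> e)"
proof -
  have "(\<lambda>e. (b e * (v \<bullet> e))\<^sup>2) summable_on S"
    by (rule summable_on_square_comparison[OF H.Bessel_summable[OF v], where C = 1])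
       (use b_bounds in \<open>auto simp: abs_mult mult_left_le_one_le\<close>)
  then obtain w where w: "w \<in> H" "\<And>e. e \<in> S \<Longrightarrow> w \<bullet> e = b e * (v \<bullet> e)"
    by (rule H.Riesz_Fischer) blast
  have Bw: "B u \<bullet> v = u \<bullet> w" if u: "u \<in> H" for u
  proof -
    have "((\<lambda>e. b e * (u \<bullet> e) * (v \<bullet> e)) has_sum (B u \<bullet> v)) S"
      using H.Parseval[OF B_mem[OF u] v] u by (simp add: B_coeff cong: has_sum_cong)
    moreover have "((\<lambda>e. b e * (u \<bullet> e) * (v \<bullet> e)) has_sum (u \<bullet> w)) S"
      using H.Parseval[OF u w(1)] by (simp add: w(2) mult_ac cong: has_sum_cong)
    ultimately show ?thesis by (metis infsumI)
  qed
  have "adjoint_on H B v = w"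
    unfolding adjoint_on_def
  proof (rule the_equality)
    fix z assume z: "z \<in> H \<and> (\<forall>u\<in>H. B u \<bullet> v = u \<bullet> z)"
    show "z = w"
    proof (rule H.eqI)
      fix e assume "e \<in> S"
      then have "e \<in> H" by (rule H.basis_mem)
      then show "z \<bullet> e = w \<bullet> e" using z Bw[of e] by (simp add: inner_commute)
    qed (use z w in auto)
  qed (use w(1) Bw in auto)
  then show "adjoint_on H B v \<in> H" "e \<in> S \<Longrightarrow> adjoint_on H B v \<bullet> e = b e * (v \<bullet> e)"
    using w by auto
qed

text \<open>The second use of the diagonal functional calculus: B*B has multiplier (b e)^2 <= 1, so
  its domain is all of H and its positive powers are bounded.\<close>

lemma BB_power_coeff:
  assumes w: "w \<in> H" and e: "e \<in> S" and \<beta>: "0 < \<beta>"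
  shows "fun_calc H H (adjoint_on H B \<circ> B) (\<lambda>x. x powr \<beta>) w \<bullet> e = ((b e)\<^sup>2) powr \<beta> * (w \<bullet> e)"
proof -
  have b2: "(b e)\<^sup>2 \<le> 1" if "e \<in> S" for e using b_bounds[OF that] by (simp add: power_le_one)
  interpret BB: diagonal_operator H S "\<lambda>e. (b e)\<^sup>2" H "adjoint_on H B \<circ> B"
  proof unfold_locales
    have "(\<lambda>e. ((b e)\<^sup>2 * (u \<bullet> e))\<^sup>2) summable_on S" if "u \<in> H" for u
      by (rule summable_on_square_comparison[OF H.Bessel_summable[OF that], where C = 1])
         (use b2 in \<open>auto simp: abs_mult mult_left_le_one_le\<close>)
    then show "H = {u \<in> H. (\<lambda>e. ((b e)\<^sup>2 * (u \<bullet> e))\<^sup>2) summable_on S}" by auto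
  qed (auto simp: adjoint_B B_mem B_coeff power2_eq_square)
  show ?thesis
  proof (rule BB.fun_calc_coeff[OF _ w _ e])
    show "(\<lambda>e. (((b e)\<^sup>2) powr \<beta> * (w \<bullet> e))\<^sup>2) summable_on S"
    proof (rule summable_on_square_comparison[OF H.Bessel_summable[OF w], where C = 1])
      fix e assume "e \<in> S"
      then have "((b e)\<^sup>2) powr \<beta> \<le> 1 powr \<beta>" using b2 \<beta> by (intro powr_mono2) auto
      then show "\<bar>((b e)\<^sup>2) powr \<beta> * (w \<bullet> e)\<bar> \<le> 1 * \<bar>w \<bullet> e\<bar>"
        by (simp add: abs_mult mult_left_le_one_le)
    qed
  qed simp
qed

section \<open>The minimizer, its stability and its error\<close>

text \<open>In each coefficient the functional is 1/2 (k x - y)^2 + \<alpha>/2 l x^2; its normal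
  equation (k^2 + \<alpha> l) x = k y gives this factor.\<close>

definition filter_coeff :: "'h \<Rightarrow> real" where "filter_coeff e = k e / ((k e)\<^sup>2 + \<alpha> * l e)"

definition minimizer :: "'h \<Rightarrow> 'h" where
  "minimizer y = (SOME u. u \<in> V \<and> (\<forall>e\<in>S. u \<bullet> e = filter_coeff e * (y \<bullet> e)))"

text \<open>After scaling by sqrt (l e) the factor is b / (b^2 + \<alpha>). The bound puts the
  minimizer into V and also makes it Lipschitz in the data.\<close>

lemma filter_coeff_bound:
  assumes "e \<in> S"
  shows "l e * (filter_coeff e)\<^sup>2 \<le> 1 / (4 * \<alpha>)"
proof -
  define r where "r = sqrt (l e)"
  have r: "0 < r" "l e = r\<^sup>2" "k e = b e * r" using eigenvalue_ge_1[OF assms] by (auto simp: r_def b_def)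
  have "0 < (b e)\<^sup>2 + \<alpha>" using \<alpha> by (simp add: add_nonneg_pos)
  moreover have "filter_coeff e = b e * r / (r\<^sup>2 * ((b e)\<^sup>2 + \<alpha>))"
    by (simp add: filter_coeff_def r power_mult_distrib algebra_simps)
  ultimately have "r * filter_coeff e = b e / ((b e)\<^sup>2 + \<alpha>)"
    using r(1) by (simp add: power2_eq_square)
  then have "l e * (filter_coeff e)\<^sup>2 = (b e / ((b e)\<^sup>2 + \<alpha>))\<^sup>2"
    by (metis r(2) power_mult_distrib)
  then show ?thesis using filter_bound[OF \<alpha>] by simp
qed

lemma minimizer_exists:
  assumes y: "y \<in> H"
  shows "\<exists>u. u \<in> V \<and> (\<forall>e\<in>S. u \<bullet> e = filter_coeff e * (y \<bullet> e))"
proof -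
  have bound: "l e * (filter_coeff e * (y \<bullet> e))\<^sup>2 \<le> 1 / (4 * \<alpha>) * (y \<bullet> e)\<^sup>2" if "e \<in> S" for e
    using mult_right_mono[OF filter_coeff_bound[OF that], of "(y \<bullet> e)\<^sup>2"]
    by (simp add: power_mult_distrib mult.assoc)
  have "(\<lambda>e. l e * (filter_coeff e * (y \<bullet> e))\<^sup>2) summable_on S"
    by (rule summable_on_comparison_test[OF summable_on_cmult_right[OF H.Bessel_summable[OF y], of "1 / (4 * \<alpha>)"] bound])
       (auto intro!: mult_nonneg_nonneg order_trans[OF zero_le_one eigenvalue_ge_1])
  note summ = this
  have "(\<lambda>e. (filter_coeff e * (y \<bullet> e))\<^sup>2) summable_on S"
  proof (rule summable_on_comparison_test[OF summ])
    fix e assume "e \<in> S"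
    then show "(filter_coeff e * (y \<bullet> e))\<^sup>2 \<le> l e * (filter_coeff e * (y \<bullet> e))\<^sup>2"
      using mult_right_mono[OF eigenvalue_ge_1, of e "(filter_coeff e * (y \<bullet> e))\<^sup>2"] by simp
  qed simp
  then obtain u where u: "u \<in> H" "\<And>e. e \<in> S \<Longrightarrow> u \<bullet> e = filter_coeff e * (y \<bullet> e)"
    by (rule H.Riesz_Fischer) blast
  have "u \<in> V" by (rule mem_form_domain[OF u(1)]) (use summ u(2) in \<open>simp cong: summable_on_cong\<close>)
  then show ?thesis using u by blast
qed

lemma minimizer:
  assumes "y \<in> H"
  shows "minimizer y \<in> V" "e \<in> S \<Longrightarrow> minimizer y \<bullet> e = filter_coeff e * (y \<bullet> e)"
  using someI_ex[OF minimizer_exists[OF assms]] by (auto simp: minimizer_def)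

definition functional :: "'h \<Rightarrow> 'h \<Rightarrow> real" where
  "functional y u = 1 / 2 * (norm (K u - y))\<^sup>2 + \<alpha> / 2 * (sqrt (a u u))\<^sup>2"

text \<open>Expanding the quadratic functional at the minimizer leaves a cross term, which vanishes
  coefficientwise by the normal equation. Keeping the energy of the increment gives minimality and
  uniqueness at once.\<close>

lemma functional_at_minimizer:
  assumes y: "y \<in> H" and u: "u \<in> V"
  shows "functional y (minimizer y) + \<alpha> / 2 * a (u - minimizer y) (u - minimizer y) \<le> functional y u"
proof -
  define m where "m = minimizer y"
  define h where "h = u - m"
  have mV: "m \<in> V" and hV: "h \<in> V" and u_eq: "u = m + h" using minimizer[OF y] u by (auto simp: m_def h_def)
  have mH: "m \<in> H" and hH: "h \<in> H" using mV hV V_subset by auto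
  have "((\<lambda>e. (k e * (m \<bullet> e) - y \<bullet> e) * (k e * (h \<bullet> e))) has_sum ((K m - y) \<bullet> K h)) S"
    using H.Parseval[of "K m - y" "K h"] y mH hH by (simp add: K_mem K_coeff inner_diff_left cong: has_sum_cong)
  moreover have "((\<lambda>e. \<alpha> * (l e * (m \<bullet> e) * (h \<bullet> e))) has_sum (\<alpha> * a m h)) S"
    by (rule has_sum_cmult_right[OF form_has_sum[OF mV hV]])
  ultimately have "((\<lambda>e. (k e * (m \<bullet> e) - y \<bullet> e) * (k e * (h \<bullet> e)) + \<alpha> * (l e * (m \<bullet> e) * (h \<bullet> e)))
      has_sum ((K m - y) \<bullet> K h + \<alpha> * a m h)) S"
    by (rule has_sum_add)
  moreover have "(k e * (m \<bullet> e) - y \<bullet> e) * (k e * (h \<bullet> e)) + \<alpha> * (l e * (m \<bullet> e) * (h \<bullet> e)) = 0" if e: "e \<in> S" for e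
  proof -
    have "0 < (k e)\<^sup>2 + \<alpha> * l e" using k_pos[of e] \<alpha> eigenvalue_ge_1[OF e] by (intro add_pos_pos) auto
    then have "((k e)\<^sup>2 + \<alpha> * l e) * (m \<bullet> e) = k e * (y \<bullet> e)"
      using minimizer(2)[OF y e] by (simp add: m_def filter_coeff_def)
    then have "(((k e)\<^sup>2 + \<alpha> * l e) * (m \<bullet> e) - k e * (y \<bullet> e)) * (h \<bullet> e) = 0" by simp
    then show ?thesis by (simp add: power2_eq_square algebra_simps)
  qed
  ultimately have cross: "(K m - y) \<bullet> K h + \<alpha> * a m h = 0"
    by (simp cong: has_sum_cong) (metis has_sum_0_simp has_sum_unique)
  have "(norm (K u - y))\<^sup>2 = (norm (K m - y))\<^sup>2 + 2 * ((K m - y) \<bullet> K h) + (norm (K h))\<^sup>2"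
    unfolding u_eq K_add[OF mH hH] by (simp add: power2_norm_eq_inner inner_simps inner_commute)
  moreover have "a u u = a m m + 2 * a m h + a h h"
    unfolding u_eq using mV hV by (simp add: V.bilinear V.sym[of h m])
  ultimately have "functional y u = functional y m + ((K m - y) \<bullet> K h + \<alpha> * a m h) + 1 / 2 * (norm (K h))\<^sup>2 + \<alpha> / 2 * a h h"
    using V.nonneg[OF u] V.nonneg[OF mV] by (simp add: functional_def algebra_simps)
  then have "functional y u = functional y m + 1 / 2 * (norm (K h))\<^sup>2 + \<alpha> / 2 * a h h"
    unfolding cross by simp
  moreover have "0 \<le> 1 / 2 * (norm (K h))\<^sup>2" by simp
  ultimately show ?thesis unfolding m_def[symmetric] h_def[symmetric] by linarith
qed

lemma is_arg_min_iff:
  assumes y: "y \<in> H"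
  shows "is_arg_min (functional y) (\<lambda>u. u \<in> V) u \<longleftrightarrow> u = minimizer y"
proof
  assume u: "is_arg_min (functional y) (\<lambda>u. u \<in> V) u"
  then have uV: "u \<in> V" and "functional y u \<le> functional y (minimizer y)"
    using minimizer(1)[OF y] by (auto simp: is_arg_min_def not_less)
  then have "\<alpha> / 2 * a (u - minimizer y) (u - minimizer y) \<le> 0"
    using functional_at_minimizer[OF y uV] by linarith
  then have "a (u - minimizer y) (u - minimizer y) \<le> 0" using \<alpha> by (simp add: mult_le_0_iff)
  moreover have d: "u - minimizer y \<in> V" using uV minimizer(1)[OF y] by auto
  ultimately have "u - minimizer y = 0" using V.nonneg[OF d] V.eq_zero[OF d] by simp
  then show "u = minimizer y" by simp
next
  assume u: "u = minimizer y"
  have "functional y (minimizer y) \<le> functional y v" if v: "v \<in> V" for v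
  proof -
    have "0 \<le> \<alpha> / 2 * a (v - minimizer y) (v - minimizer y)"
      using \<alpha> v minimizer(1)[OF y] by (intro mult_nonneg_nonneg V.nonneg) auto
    then show ?thesis using functional_at_minimizer[OF y v] by linarith
  qed
  then show "is_arg_min (functional y) (\<lambda>u. u \<in> V) u"
    using minimizer(1)[OF y] u by (auto simp: is_arg_min_def not_less)
qed

text \<open>\<open>arg_min_on\<close> is a choice; it is determined here because the minimizer is
  unique.\<close>

lemma arg_min_on_functional: "y \<in> H \<Longrightarrow> arg_min_on (functional y) V = minimizer y"
  by (simp add: arg_min_on_def arg_min_def is_arg_min_iff)

text \<open>Stability in the data, needed for the measurability of the random error.\<close>

lemma minimizer_diff_le:
  assumes "y \<in> H" "z \<in> H"
  shows "a (minimizer y - minimizer z) (minimizer y - minimizer z) \<le> 1 / (4 * \<alpha>) * (norm (y - z))\<^sup>2"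
proof -
  let ?d = "minimizer y - minimizer z"
  have d: "?d \<in> V" using assms minimizer by auto
  have yz: "y - z \<in> H" using assms by auto
  have "((\<lambda>e. 1 / (4 * \<alpha>) * ((y - z) \<bullet> e * ((y - z) \<bullet> e))) has_sum 1 / (4 * \<alpha>) * ((y - z) \<bullet> (y - z))) S"
    by (rule has_sum_cmult_right[OF H.Parseval[OF yz yz]])
  then have "a ?d ?d \<le> 1 / (4 * \<alpha>) * ((y - z) \<bullet> (y - z))"
  proof (rule has_sum_mono[OF form_has_sum[OF d d]])
    fix e assume e: "e \<in> S"
    have "?d \<bullet> e = filter_coeff e * ((y - z) \<bullet> e)"
      using assms e by (simp add: minimizer inner_diff_left right_diff_distrib)
    then have "l e * (?d \<bullet> e) * (?d \<bullet> e) = (l e * (filter_coeff e)\<^sup>2) * ((y - z) \<bullet> e * ((y - z) \<bullet> e))"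
      by (simp add: power2_eq_square)
    also have "\<dots> \<le> 1 / (4 * \<alpha>) * ((y - z) \<bullet> e * ((y - z) \<bullet> e))"
      by (rule mult_right_mono[OF filter_coeff_bound[OF e]]) simp
    finally show "l e * (?d \<bullet> e) * (?d \<bullet> e) \<le> 1 / (4 * \<alpha>) * ((y - z) \<bullet> e * ((y - z) \<bullet> e))" .
  qed
  then show ?thesis by (simp add: power2_norm_eq_inner)
qed

text \<open>The noise is measurable into the Borel sets restricted to H, so continuity on H makes
  the squared error a random variable.\<close>

lemma continuous_on_error:
  assumes v: "v \<in> V" and z: "z \<in> H"
  shows "continuous_on H (\<lambda>\<eta>. a (minimizer (z + \<eta>) - v) (minimizer (z + \<eta>) - v))"
  unfolding continuous_on_sequentially
proof (intro allI ballI impI, elim conjE)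
  let ?e = "\<lambda>\<eta>. minimizer (z + \<eta>) - v"
  fix X x assume x: "x \<in> H" and X: "\<forall>n. X n \<in> H" and lim: "X \<longlonglongrightarrow> x"
  let ?q = "\<lambda>n. a (?e (X n) - ?e x) (?e (X n) - ?e x)"
  have mem: "?e (X n) \<in> V" "?e x \<in> V" for n
    using X x v z minimizer(1) by auto
  have "?q \<longlonglongrightarrow> 0"
  proof (rule tendsto_sandwich[OF _ _ tendsto_const])
    have "(\<lambda>n. 1 / (4 * \<alpha>) * (norm (X n - x))\<^sup>2) \<longlonglongrightarrow> 1 / (4 * \<alpha>) * (norm (x - x))\<^sup>2"
      by (intro tendsto_intros lim)
    then show "(\<lambda>n. 1 / (4 * \<alpha>) * (norm (X n - x))\<^sup>2) \<longlonglongrightarrow> 0" by simp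
    show "\<forall>\<^sub>F n in sequentially. ?q n
        \<le> 1 / (4 * \<alpha>) * (norm (X n - x))\<^sup>2"
      using minimizer_diff_le[of "z + X _" "z + x"] X x z by (intro always_eventually) simp
    show "\<forall>\<^sub>F n in sequentially. 0 \<le> ?q n"
      by (intro always_eventually allI V.nonneg V.mem_diff[OF mem])
  qed
  then show "((\<lambda>\<eta>. a (?e \<eta>) (?e \<eta>)) \<circ> X) \<longlonglongrightarrow> a (?e x) (?e x)"
    unfolding comp_def by (rule V.tendsto_form_square[OF mem])
qed

lemma error_bound:
  assumes u: "u \<in> V" and \<eta>: "\<eta> \<in> H" and w: "w \<in> H" and \<beta>: "0 < \<beta>" "\<beta> \<le> 1"
    and source: "calc (\<lambda>x. x powr (1 / 2)) u = fun_calc H H (adjoint_on H B \<circ> B) (\<lambda>x. x powr \<beta>) w"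
  shows "a (minimizer (K u + \<eta>) - u) (minimizer (K u + \<eta>) - u) \<le>
    2 * (source_const \<beta>)\<^sup>2 * \<alpha> powr (2 * \<beta>) * (norm w)\<^sup>2 + (norm \<eta>)\<^sup>2 / (2 * \<alpha>)"
proof -
  let ?d = "minimizer (K u + \<eta>) - u"
  let ?C = "2 * (source_const \<beta>)\<^sup>2 * \<alpha> powr (2 * \<beta>)"
  have uH: "u \<in> H" using u V_subset by auto
  then have y: "K u + \<eta> \<in> H" using \<eta> by (simp add: K_mem)
  have d: "?d \<in> V" using u minimizer(1)[OF y] by auto
  have "((\<lambda>e. ?C * ((w \<bullet> e) * (w \<bullet> e)) + 1 / (2 * \<alpha>) * ((\<eta> \<bullet> e) * (\<eta> \<bullet> e))) has_sum
      (?C * (w \<bullet> w) + 1 / (2 * \<alpha>) * (\<eta> \<bullet> \<eta>))) S"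
    by (intro has_sum_add has_sum_cmult_right H.Parseval w \<eta>)
  then have "a ?d ?d \<le> ?C * (w \<bullet> w) + 1 / (2 * \<alpha>) * (\<eta> \<bullet> \<eta>)"
  proof (rule has_sum_mono[OF form_has_sum[OF d d]])
    fix e assume e: "e \<in> S"
    \<comment> \<open>The source condition in one coefficient: A^(1/2) contributes sqrt l and
      (B*B)^\<beta> contributes (b^2)^\<beta>.\<close>
    have src: "sqrt (l e) * (u \<bullet> e) = ((k e / sqrt (l e))\<^sup>2) powr \<beta> * (w \<bullet> e)"
      using calc_sqrt_coeff[OF u e] BB_power_coeff[OF w e \<beta>(1)] source by (simp add: b_def)
    have "?d \<bullet> e = k e * (k e * (u \<bullet> e) + \<eta> \<bullet> e) / ((k e)\<^sup>2 + \<alpha> * l e) - u \<bullet> e"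
      using y e uH by (simp add: minimizer inner_diff_left inner_add_left K_coeff filter_coeff_def)
    then show "l e * (?d \<bullet> e) * (?d \<bullet> e) \<le> ?C * ((w \<bullet> e) * (w \<bullet> e)) + 1 / (2 * \<alpha>) * ((\<eta> \<bullet> e) * (\<eta> \<bullet> e))"
      using error_coeff_bound[OF eigenvalue_ge_1[OF e] k_pos \<alpha> \<beta> src, of "\<eta> \<bullet> e"]
      by (simp add: power2_eq_square mult.assoc)
  qed
  then show ?thesis by (simp add: power2_norm_eq_inner)
qed

end

end

section \<open>The error estimate in expectation\<close>

theorem theorem4p3:
  fixes \<Omega> :: "(real ^ 'n) set"
    and s t \<delta> \<alpha> :: real
    and u_true :: "(real ^ 'n) L2fun"
    and M :: "'w measure"
    and \<eta> y u_est :: "'w \<Rightarrow> (real ^ 'n) L2fun"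
  assumes "bounded_lipschitz_domain \<Omega>"
    and "0 < s" "s < 1" "0 < t"
    and "u_true \<in> Hs0 \<Omega> s"
    and "0 < \<delta>"
    and "prob_space M"
    and "\<eta> \<in> M \<rightarrow>\<^sub>M restrict_space borel (L2_on \<Omega>)"
    and "integrable M (\<lambda>\<omega>. (norm (\<eta> \<omega>))\<^sup>2)"
    and "prob_space.expectation M (\<lambda>\<omega>. (norm (\<eta> \<omega>))\<^sup>2) \<le> \<delta>\<^sup>2"
    and y_def: "\<And>\<omega>. y \<omega> = A_semigroup \<Omega> s t u_true + \<eta> \<omega>"
    and "0 < \<alpha>"
    and u_est_def: "\<And>\<omega>. u_est \<omega> = arg_min_on (tikhonov \<Omega> s t \<alpha> (y \<omega>)) (Hs0 \<Omega> s)"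
  shows "(\<forall>\<omega>\<in>space M. \<exists>!u. is_arg_min (tikhonov \<Omega> s t \<alpha> (y \<omega>)) (\<lambda>u. u \<in> Hs0 \<Omega> s) u) \<and>
    (\<forall>w\<in>L2_on \<Omega>. \<forall>\<beta>. 0 < \<beta> \<and> \<beta> \<le> 1 \<and> A_power \<Omega> s (1 / 2) u_true = BB_power \<Omega> s t \<beta> w \<longrightarrow>
       integrable M (\<lambda>\<omega>. (Hs0_norm \<Omega> s (u_est \<omega> - u_true))\<^sup>2) \<and>
       prob_space.expectation M (\<lambda>\<omega>. (Hs0_norm \<Omega> s (u_est \<omega> - u_true))\<^sup>2)
         \<le> 2 * (source_const \<beta>)\<^sup>2 * (norm w)\<^sup>2 * \<alpha> powr (2 * \<beta>) + 1 / 2 * (\<delta>\<^sup>2 / \<alpha>))"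
proof -
  have dom: "open \<Omega>" "bounded \<Omega>" using assms(1) by (auto simp: bounded_lipschitz_domain_def)
  have \<Omega>: "\<Omega> \<in> sets borel" using dom by simp
  note s = \<open>0 < s\<close> \<open>s < 1\<close>
  let ?H = "L2_on \<Omega>" and ?V = "Hs0 \<Omega> s" and ?a = "frac_form \<Omega> s"
  interpret C: compact_form ?H ?V ?a
  proof (intro compact_form.intro compact_form_axioms.intro)
    show "hilbert_form ?H inner" by (rule hilbert_form_L2_on)
    show "hilbert_form ?V ?a" by (rule hilbert_form_Hs0[OF \<Omega> s])
    show "u = 0" if "u \<in> ?H" "\<And>v. v \<in> ?V \<Longrightarrow> u \<bullet> v = 0" for u
      using Hs0_dense[OF dom s that] .
    show "u \<bullet> u \<le> ?a u u" if "u \<in> ?V" for u by (rule inner_le_frac_form[OF \<Omega> s that])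
    show "\<exists>\<Phi>. finite \<Phi> \<and> (\<forall>u\<in>?V. u \<bullet> u \<le> \<epsilon> * ?a u u + (\<Sum>\<phi>\<in>\<Phi>. (u \<bullet> \<phi>)\<^sup>2))" if "0 < \<epsilon>" for \<epsilon>
      by (rule Hs0_compact_embedding[OF \<Omega> dom(2) s that])
  qed (auto simp: Hs0_iff)
  obtain S l where S: "\<And>e. e \<in> S \<Longrightarrow> C.eigenvector e (l e)" "orthonormal_basis ?H inner S (\<lambda>e. e)"
    by (rule C.exists_eigenbasis) (rule that)
  interpret form_eigenbasis ?H ?V ?a S l
  proof (intro form_eigenbasis.intro form_eigenbasis_axioms.intro)
    show "hilbert_form ?V ?a" by (rule hilbert_form_Hs0[OF \<Omega> s])
    show "1 \<le> l e" if "e \<in> S" for e using C.eigenvalue_ge_1[OF S(1)[OF that]] .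
  qed (use S in \<open>auto simp: C.eigenvector_def Hs0_iff\<close>)
  note t = \<open>0 < t\<close> and \<alpha> = \<open>0 < \<alpha>\<close>
  \<comment> \<open>The operators of the statement unfold to the diagonal ones, because their form,
    domain and ambient space are those of the interpretation.\<close>
  have semigroup: "A_semigroup \<Omega> s t = K t"
    by (simp add: A_semigroup_def A_dom_def A_op_def K_def[OF t \<alpha>] calc_def)
  have sqrt_A: "A_power \<Omega> s r = calc (\<lambda>x. x powr r)" for r
    by (simp add: A_power_def A_dom_def A_op_def calc_def)
  have B_eq: "B_op \<Omega> s t = B t"
    by (simp add: B_op_def B_def[OF t \<alpha>] semigroup sqrt_A)
  have functional_eq: "tikhonov \<Omega> s t \<alpha> z = functional t \<alpha> z" for z
    by (rule ext) (simp add: tikhonov_def functional_def[OF t \<alpha>] semigroup Hs0_norm_def)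
  have uH: "u_true \<in> ?H" using assms(5) V_subset by auto
  have \<eta>H: "\<eta> \<omega> \<in> ?H" if "\<omega> \<in> space M" for \<omega>
    using measurable_space[OF assms(8) that] by (simp add: space_restrict_space)
  have y_eq: "y \<omega> = K t u_true + \<eta> \<omega>" for \<omega> by (simp add: y_def semigroup)
  have yH: "y \<omega> \<in> ?H" if "\<omega> \<in> space M" for \<omega>
    unfolding y_eq using \<eta>H[OF that] K_mem[OF t \<alpha> uH] by auto
  have "\<forall>\<omega>\<in>space M. \<exists>!u. is_arg_min (tikhonov \<Omega> s t \<alpha> (y \<omega>)) (\<lambda>u. u \<in> ?V) u"
    by (auto simp: functional_eq is_arg_min_iff[OF t \<alpha> yH])
  moreover have "integrable M (\<lambda>\<omega>. (Hs0_norm \<Omega> s (u_est \<omega> - u_true))\<^sup>2) \<and>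
       prob_space.expectation M (\<lambda>\<omega>. (Hs0_norm \<Omega> s (u_est \<omega> - u_true))\<^sup>2)
         \<le> 2 * (source_const \<beta>)\<^sup>2 * (norm w)\<^sup>2 * \<alpha> powr (2 * \<beta>) + 1 / 2 * (\<delta>\<^sup>2 / \<alpha>)"
    if w: "w \<in> ?H" and \<beta>: "0 < \<beta>" "\<beta> \<le> 1" and source: "A_power \<Omega> s (1 / 2) u_true = BB_power \<Omega> s t \<beta> w"
    for w \<beta>
  proof -
    interpret prob_space M by fact
    let ?m = "\<lambda>\<eta>. minimizer t \<alpha> (K t u_true + \<eta>) - u_true"
    let ?f = "\<lambda>\<omega>. (Hs0_norm \<Omega> s (u_est \<omega> - u_true))\<^sup>2"
    let ?c = "2 * (source_const \<beta>)\<^sup>2 * \<alpha> powr (2 * \<beta>) * (norm w)\<^sup>2"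
    have f_eq: "?f \<omega> = ?a (?m (\<eta> \<omega>)) (?m (\<eta> \<omega>))" if "\<omega> \<in> space M" for \<omega>
    proof -
      have "u_est \<omega> = minimizer t \<alpha> (K t u_true + \<eta> \<omega>)"
        using arg_min_on_functional[OF t \<alpha> yH[OF that]] by (simp add: u_est_def functional_eq y_eq)
      moreover have "?m (\<eta> \<omega>) \<in> ?V"
        using minimizer(1)[OF t \<alpha> yH[OF that]] assms(5) unfolding y_eq by auto
      ultimately show ?thesis using C.V.nonneg by (simp add: Hs0_norm_def)
    qed
    have bound: "?f \<omega> \<le> ?c + (norm (\<eta> \<omega>))\<^sup>2 / (2 * \<alpha>)" if "\<omega> \<in> space M" for \<omega>
      unfolding f_eq[OF that] using source
      by (intro error_bound[OF t \<alpha> assms(5) \<eta>H[OF that] w \<beta>])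
         (simp add: sqrt_A BB_power_def B_eq)
    \<comment> \<open>The squared error is a continuous function of the noise alone, composed with
      the measurable noise.\<close>
    have "(\<lambda>z. ?a (?m z) (?m z)) \<in> borel_measurable (restrict_space borel ?H)"
      by (intro borel_measurable_continuous_on_restrict continuous_on_error[OF t \<alpha> assms(5) K_mem[OF t \<alpha> uH]])
    from measurable_compose[OF assms(8) this]
    have meas: "?f \<in> borel_measurable M" by (simp add: f_eq cong: measurable_cong)
    have int_bound: "integrable M (\<lambda>\<omega>. ?c + (norm (\<eta> \<omega>))\<^sup>2 / (2 * \<alpha>))"
      using assms(9) by auto
    \<comment> \<open>Integrability is inherited from the pathwise bound, which is affine in the
      squared norm of the noise.\<close>
    have int: "integrable M ?f"
      by (rule Bochner_Integration.integrable_bound[OF int_bound meas])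
         (use bound in \<open>auto intro!: AE_I2 order_trans[OF _ abs_ge_self]\<close>)
    have "expectation ?f \<le> expectation (\<lambda>\<omega>. ?c + (norm (\<eta> \<omega>))\<^sup>2 / (2 * \<alpha>))"
      by (rule integral_mono[OF int int_bound bound])
    also have "\<dots> = ?c + expectation (\<lambda>\<omega>. (norm (\<eta> \<omega>))\<^sup>2) / (2 * \<alpha>)"
      using assms(9) by (simp add: prob_space)
    also have "\<dots> \<le> ?c + \<delta>\<^sup>2 / (2 * \<alpha>)"
      using assms(10) \<alpha> by (intro add_left_mono divide_right_mono) auto
    finally show ?thesis using int by (simp add: mult_ac)
  qed
  ultimately show ?thesis by blast
qed

end
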